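(* Let $\bar A=(A_0,A_1)$ be a compatible couple of (quasi-)Banach spaces with $A_0\cap A_1\neq\{0\}$. Let $0<q_1,r_1\le\infty$ and $a_1,b_1\in SV$ be such that $\left\|s^{-1/r_1}b_1(s)\|u^{-1/q_1}a_1(u)\|_{q_1,(s,1)}\right\|_{r_1,(0,1)}<\infty$, and put $$\chi_1(t)=\left\|s^{-1/r_1}b_1(s)\|u^{-1/q_1}a_1(u)\|_{q_1,(s,t)}\right\|_{r_1,(0,t)}.$$ Let $0<\theta_0<1$, $0<r,r_0,q_0\le\infty$, $a,a_0,b_0\in SV$, and $\|s^{-1/r_0}b_0(s)\|_{r_0,(0,1)}<\infty$. Put $\chi_0(t)=a_0(t)\|s^{-1/r_0}b_0(s)\|_{r_0,(0,t)}$ and $\rho(t)=t^{1-\theta_0}\frac{\chi_0(t)}{\chi_1(t)}$. For given $0\le\theta\le1$ denote $a^{\#}=\chi_0^{1-\theta}\chi_1^{\theta}\,(a\circ\rho)$ and $\eta=(1-\theta)\theta_0+\theta$. (i) If $0<\theta<1$, then $\left(\bar A^{\mathcal R}_{\theta_0,r_0,b_0,q_0,a_0},\bar A^{\mathcal R}_{1,r_1,b_1,q_1,a_1}\right)_{\theta,r,a}=\bar A_{\eta,r,a^{\#}}$. (ii) If $\|s^{-1/r}a(s)\|_{r,(1,\infty)}<\infty$, then $\left(\bar A^{\mathcal R}_{\theta_0,r_0,b_0,q_0,a_0},\bar A^{\mathcal R}_{1,r_1,b_1,q_1,a_1}\right)_{0,r,a}=\bar A^{\mathcal R,\mathcal L}_{\theta_0,r,a\circ\rho,r_0,b_0,q_0,a_0}$.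 (iii) If $\|s^{-1/r}a(s)\|_{r,(0,1)}<\infty$, then, with $\theta=1$ (i.e. $a^{\#}=\chi_1\,(a\circ\rho)$), $$\left(\bar A^{\mathcal R}_{\theta_0,r_0,b_0,q_0,a_0},\bar A^{\mathcal R}_{1,r_1,b_1,q_1,a_1}\right)_{1,r,a}=\bar A_{1,r,a^{\#}}\cap\bar A^{\mathcal R}_{1,r,B_1,q_1,a_1}\cap\bar A^{\mathcal R,\mathcal R}_{1,r,a\circ\rho,r_1,b_1,q_1,a_1},$$ where $B_1(t)=\|s^{-1/r_1}b_1(s)\|_{r_1,(0,t)}\,a(\rho(t))$.
   Context: Conventions: $1/\infty=0$; $\|\cdot\|_{q,(a,b)}$ is the usual (quasi-)norm of $L_q$ on the interval $(a,b)$, $0<q\le\infty$. Two positive functions satisfy $f\approx g$ (are equivalent) if $C^{-1}g\le f\le Cg$ for some constant $C>0$ independent of all significant quantities. $b\in SV$ (slowly varying) means that $b$ is a positive Lebesgue measurable function on $(0,\infty)$ such that for each $\varepsilon>0$ the function $t^{\varepsilon}b(t)$ is equivalent to an increasing function and $t^{-\varepsilon}b(t)$ is equivalent to a decreasing function. For a compatible couple $(X_0,X_1)$ of (quasi-)normed spaces, $K(t,f;X_0,X_1)=\inf\{\|f_0\|_{X_0}+t\|f_1\|_{X_1}: f=f_0+f_1,\ f_i\in X_i\}$ for $f\in X_0+X_1$, $t>0$; $K(t,f):=K(t,f;A_0,A_1)$. For $0\le\theta\le1$, $0<q\le\infty$, $b\in SV$, $(X_0,X_1)_{\theta,q,b}$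 is the space of all $f\in X_0+X_1$ with finite (quasi-)norm $\|u^{-\theta-1/q}b(u)K(u,f;X_0,X_1)\|_{q,(0,\infty)}$, and $\bar A_{\theta,q,b}:=(A_0,A_1)_{\theta,q,b}$. For $0<p,r,q\le\infty$ and $a,b,c\in SV$, the following are the spaces of all $f\in A_0+A_1$ with finite (quasi-)norm: - $\bar A^{\mathcal R}_{\theta,r,b,q,a}$: $\left\|t^{-1/r}b(t)\|u^{-\theta-1/q}a(u)K(u,f)\|_{q,(t,\infty)}\right\|_{r,(0,\infty)}$; - $\bar A^{\mathcal R,\mathcal L}_{\theta,p,c,r,b,q,a}$: $\left\|t^{-1/p}c(t)\left\|u^{-1/r}b(u)\|v^{-\theta-1/q}a(v)K(v,f)\|_{q,(u,t)}\right\|_{r,(0,t)}\right\|_{p,(0,\infty)}$; - $\bar A^{\mathcal R,\mathcal R}_{\theta,p,c,r,b,q,a}$: $\left\|t^{-1/p}c(t)\left\|u^{-1/r}b(u)\|v^{-\theta-1/q}a(v)K(v,f)\|_{q,(u,\infty)}\right\|_{r,(t,\infty)}\right\|_{p,(0,\infty)}$. Equality of (quasi-)normed spaces means that each is continuously embedded in the other; intersections carry the maximum (equivalently, the sum) of the (quasi-)norms. Standing assumption: none of the spaces under consideration is $\{0\}$. *)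

theory Defs
  imports "HOL-Analysis.Analysis"
begin

section \<open>Weighted $L_q$ quasi-norms with values in $[0,\infty]$\<close>

(* Exponents range over ennreal. Because inverse \<infinity> = 0, this realises the convention 1/\<infinity> = 0. *)
definition recip :: "ennreal \<Rightarrow> real" where
  "recip q = enn2real (inverse q)"

(* The power x^p for 0 < p < \<infinity> (the only case used), with \<infinity>^p = \<infinity>. *)
definition ennpowr :: "ennreal \<Rightarrow> real \<Rightarrow> ennreal" where
  "ennpowr x p = (if x = \<infinity> then \<infinity> else ennreal (enn2real x powr p))"

(* The essential supremum is written out rather than taken from the library, whose esssup is top
   on every non-measurable function. The composition of two Lebesgue measurable weights need not be
   measurable; with the definition below (and the lower integral that nn_integral computes)
   the norm is monotone and homogeneous in F without any measurability, so it remains meaningful,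
   up to equivalence, for every F that is equivalent to a measurable function. *)
definition Lq_norm :: "ennreal \<Rightarrow> real set \<Rightarrow> (real \<Rightarrow> ennreal) \<Rightarrow> ennreal" where
  "Lq_norm q I F =
     (if q = \<infinity> then Inf {c. AE x\<in>I in lebesgue. F x \<le> c}
      else ennpowr (\<integral>\<^sup>+x\<in>I. ennpowr (F x) (enn2real q) \<partial>lebesgue) (recip q))"

(* || t^(-1/q) b(t) F(t) ||_{q,I}, where I is a subset of (0,\<infinity>) *)
definition wnorm :: "ennreal \<Rightarrow> (real \<Rightarrow> real) \<Rightarrow> real set \<Rightarrow> (real \<Rightarrow> ennreal) \<Rightarrow> ennreal" where
  "wnorm q b I F = Lq_norm q I (\<lambda>t. ennreal (t powr (- recip q) * b t) * F t)"

section \<open>Slowly varying functions\<close>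

definition equivalent_on_pos :: "(real \<Rightarrow> real) \<Rightarrow> (real \<Rightarrow> real) \<Rightarrow> bool" where
  "equivalent_on_pos f g \<longleftrightarrow> (\<exists>C>0. \<forall>t>0. inverse C * g t \<le> f t \<and> f t \<le> C * g t)"

(* Increasing and decreasing are meant in the wide sense; up to equivalence this
   is the same as the strict sense. *)
definition SV :: "(real \<Rightarrow> real) set" where
  "SV = {b. b \<in> borel_measurable (lebesgue_on {0<..}) \<and> (\<forall>t>0. 0 < b t) \<and>
     (\<forall>\<epsilon>>0.
        (\<exists>g. (\<forall>t>0. 0 < g t) \<and> mono_on {0<..} g \<and>
             equivalent_on_pos (\<lambda>t. t powr \<epsilon> * b t) g) \<and>
        (\<exists>h. (\<forall>t>0. 0 < h t) \<and> antimono_on {0<..} h \<and>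
             equivalent_on_pos (\<lambda>t. t powr (- \<epsilon>) * b t) h))}"

section \<open>Quasi-normed spaces and compatible couples\<close>

(* A space is a subset of an ambient real vector space with a functional that matters on that
   subset only. Complex spaces are covered by restriction of scalars, which changes neither
   the norms nor the K-functional. *)
record 'a qspace =
  qcarrier :: "'a set"
  qnorm :: "'a \<Rightarrow> real"

definition quasi_normed :: "'a::real_vector qspace \<Rightarrow> bool" where
  "quasi_normed X \<longleftrightarrow>
     subspace (qcarrier X) \<and>
     (\<forall>f\<in>qcarrier X. 0 \<le> qnorm X f \<and> (qnorm X f = 0 \<longleftrightarrow> f = 0)) \<and>
     (\<forall>c. \<forall>f\<in>qcarrier X. qnorm X (c *\<^sub>R f) = \<bar>c\<bar> * qnorm X f) \<and>
     (\<exists>C\<ge>1. \<forall>f\<in>qcarrier X. \<forall>g\<in>qcarrier X. qnorm X (f + g) \<le> C * (qnorm X f + qnorm X g))"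

definition quasi_banach :: "'a::real_vector qspace \<Rightarrow> bool" where
  "quasi_banach X \<longleftrightarrow>
     quasi_normed X \<and>
     (\<forall>s::nat \<Rightarrow> 'a.
        range s \<subseteq> qcarrier X \<longrightarrow>
        (\<forall>e>0. \<exists>N. \<forall>m\<ge>N. \<forall>n\<ge>N. qnorm X (s m - s n) < e) \<longrightarrow>
        (\<exists>f\<in>qcarrier X. (\<lambda>n. qnorm X (s n - f)) \<longlonglongrightarrow> 0))"

definition hausdorff_vector_topology :: "'a::real_vector topology \<Rightarrow> bool" where
  "hausdorff_vector_topology T \<longleftrightarrow>
     topspace T = UNIV \<and> Hausdorff_space T \<and>
     continuous_map (prod_topology T T) T (\<lambda>(f, g). f + g) \<and>
     continuous_map (prod_topology euclideanreal T) T (\<lambda>(c, f). c *\<^sub>R f)"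

definition continuously_included :: "'a::real_vector qspace \<Rightarrow> 'a topology \<Rightarrow> bool" where
  "continuously_included X T \<longleftrightarrow>
     (\<forall>U f. openin T U \<longrightarrow> f \<in> qcarrier X \<inter> U \<longrightarrow>
        (\<exists>e>0. \<forall>g\<in>qcarrier X. qnorm X (g - f) < e \<longrightarrow> g \<in> U))"

definition compatible_couple :: "'a::real_vector qspace \<Rightarrow> 'a qspace \<Rightarrow> bool" where
  "compatible_couple X\<^sub>0 X\<^sub>1 \<longleftrightarrow>
     (\<exists>T. hausdorff_vector_topology T \<and> continuously_included X\<^sub>0 T \<and> continuously_included X\<^sub>1 T)"

definition cont_embedded :: "'a qspace \<Rightarrow> 'a qspace \<Rightarrow> bool" where
  "cont_embedded X Y \<longleftrightarrow>
     qcarrier X \<subseteq> qcarrier Y \<and> (\<exists>C>0. \<forall>f\<in>qcarrier X. qnorm Y f \<le> C * qnorm X f)"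

definition space_eq :: "'a qspace \<Rightarrow> 'a qspace \<Rightarrow> bool" (infix "\<doteq>" 50) where
  "X \<doteq> Y \<longleftrightarrow> cont_embedded X Y \<and> cont_embedded Y X"

definition space_inter :: "'a qspace \<Rightarrow> 'a qspace \<Rightarrow> 'a qspace" (infixl "\<sqinter>\<^sub>q" 70) where
  "X \<sqinter>\<^sub>q Y = \<lparr>qcarrier = qcarrier X \<inter> qcarrier Y, qnorm = (\<lambda>f. max (qnorm X f) (qnorm Y f))\<rparr>"

section \<open>The K-functional and the interpolation spaces\<close>

definition sum_carrier :: "'a::real_vector qspace \<Rightarrow> 'a qspace \<Rightarrow> 'a set" where
  "sum_carrier X\<^sub>0 X\<^sub>1 = {f\<^sub>0 + f\<^sub>1 | f\<^sub>0 f\<^sub>1. f\<^sub>0 \<in> qcarrier X\<^sub>0 \<and> f\<^sub>1 \<in> qcarrier X\<^sub>1}"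

definition K_fun :: "'a::real_vector qspace \<Rightarrow> 'a qspace \<Rightarrow> real \<Rightarrow> 'a \<Rightarrow> real" where
  "K_fun X\<^sub>0 X\<^sub>1 t f =
     Inf {qnorm X\<^sub>0 f\<^sub>0 + t * qnorm X\<^sub>1 f\<^sub>1 | f\<^sub>0 f\<^sub>1.
            f\<^sub>0 \<in> qcarrier X\<^sub>0 \<and> f\<^sub>1 \<in> qcarrier X\<^sub>1 \<and> f = f\<^sub>0 + f\<^sub>1}"

definition space_of :: "'a::real_vector qspace \<Rightarrow> 'a qspace \<Rightarrow> ('a \<Rightarrow> ennreal) \<Rightarrow> 'a qspace" where
  "space_of X\<^sub>0 X\<^sub>1 \<Phi> =
     \<lparr>qcarrier = {f \<in> sum_carrier X\<^sub>0 X\<^sub>1. \<Phi> f < \<infinity>}, qnorm = (\<lambda>f. enn2real (\<Phi> f))\<rparr>"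

(* || u^(-\<theta>-1/q) a(u) K(u,f) ||_{q,I}; the factor u^(-1/q) a(u) is supplied by wnorm *)
definition K_norm :: "'a::real_vector qspace \<Rightarrow> 'a qspace \<Rightarrow>
    real \<Rightarrow> ennreal \<Rightarrow> (real \<Rightarrow> real) \<Rightarrow> real set \<Rightarrow> 'a \<Rightarrow> ennreal" where
  "K_norm X\<^sub>0 X\<^sub>1 \<theta> q a I f =
     wnorm q a I (\<lambda>u. ennreal (u powr (- \<theta>) * K_fun X\<^sub>0 X\<^sub>1 u f))"

definition K_space :: "'a::real_vector qspace \<Rightarrow> 'a qspace \<Rightarrow>
    real \<Rightarrow> ennreal \<Rightarrow> (real \<Rightarrow> real) \<Rightarrow> 'a qspace" where
  "K_space X\<^sub>0 X\<^sub>1 \<theta> q b = space_of X\<^sub>0 X\<^sub>1 (K_norm X\<^sub>0 X\<^sub>1 \<theta> q b {0<..})"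

definition R_space :: "'a::real_vector qspace \<Rightarrow> 'a qspace \<Rightarrow>
    real \<Rightarrow> ennreal \<Rightarrow> (real \<Rightarrow> real) \<Rightarrow> ennreal \<Rightarrow> (real \<Rightarrow> real) \<Rightarrow> 'a qspace" where
  "R_space A\<^sub>0 A\<^sub>1 \<theta> r b q a = space_of A\<^sub>0 A\<^sub>1 (\<lambda>f.
     wnorm r b {0<..} (\<lambda>t. K_norm A\<^sub>0 A\<^sub>1 \<theta> q a {t<..} f))"

definition RL_space :: "'a::real_vector qspace \<Rightarrow> 'a qspace \<Rightarrow> real \<Rightarrow> ennreal \<Rightarrow> (real \<Rightarrow> real) \<Rightarrow>
    ennreal \<Rightarrow> (real \<Rightarrow> real) \<Rightarrow> ennreal \<Rightarrow> (real \<Rightarrow> real) \<Rightarrow> 'a qspace" where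
  "RL_space A\<^sub>0 A\<^sub>1 \<theta> p c r b q a = space_of A\<^sub>0 A\<^sub>1 (\<lambda>f.
     wnorm p c {0<..} (\<lambda>t. wnorm r b {0<..<t} (\<lambda>u. K_norm A\<^sub>0 A\<^sub>1 \<theta> q a {u<..<t} f)))"

definition RR_space :: "'a::real_vector qspace \<Rightarrow> 'a qspace \<Rightarrow> real \<Rightarrow> ennreal \<Rightarrow> (real \<Rightarrow> real) \<Rightarrow>
    ennreal \<Rightarrow> (real \<Rightarrow> real) \<Rightarrow> ennreal \<Rightarrow> (real \<Rightarrow> real) \<Rightarrow> 'a qspace" where
  "RR_space A\<^sub>0 A\<^sub>1 \<theta> p c r b q a = space_of A\<^sub>0 A\<^sub>1 (\<lambda>f.
     wnorm p c {0<..} (\<lambda>t. wnorm r b {t<..} (\<lambda>u. K_norm A\<^sub>0 A\<^sub>1 \<theta> q a {u<..} f)))"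

end

(* Every weighted norm here is taken of a function that varies by a bounded factor on dyadic
   intervals, so it is equivalent to a sequence norm over the integers. This removes all
   measurability questions, in particular for the composition of a with rho.

   On the sequence side one proves Holmstedt's formula. Write kappa i = K(2^i, f). Then
     K(rho(2^k), f; R0, R1)  is equivalent to  N0 {..k} kappa + rho k * (I2 k kappa + N1 {k..} kappa):
   the upper bound splits f almost optimally at 2^k, and the lower bound uses that
   K(2^i, g) <= C |g|_R0 / S0 i for g in R0 and K(2^i, g) <= C |g|_R1 / S1 i for g in R1.
   Since rho grows geometrically up to slowly varying factors, s = rho(2^k) is an admissible
   change of variables in the outer norm. In that norm the first term (for theta > 0) and the
   second one (for theta < 1) are dominated by the single term S0 k * kappa k, which is at most
   the first term; this gives (i)-(iii). *)

theory Submission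
  imports Defs
begin

section \<open>Powers of extended nonnegative reals\<close>

text \<open>Exponents may be below 1 and the composite weight need not be measurable, so duality,
  Minkowski and the classical Hardy inequalities are out of reach. What remains is monotonicity,
  homogeneity, a quasi-triangle inequality and comparison with geometric series. The two ends behave
  differently. For the part of f in the first space, K stays below a multiple of
  \<open>\<kappa> k\<close> above 2^k, and the weight 2^(-\<theta>0 i) makes that tail geometric: it
  is absorbed by the term at k. For the part in the second space, K is at most a multiple of 2^(i-k)
  \<open>\<kappa> k\<close> below 2^k, which exactly cancels the weight 2^(-i). No geometric decay
  is left there; the double sum converges by the finiteness hypothesis on \<open>a1\<close>,
  \<open>b1\<close>, and its value is the double norm \<open>chi1\<close>, whereas
  \<open>chi0\<close> is a product. \<open>I2\<close> is the part of the double norm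
  \<open>N1\<close> with outer index below k and inner index above k. At \<theta> = 1 the powers of
  \<open>\<rho>\<close> cancel, nothing is left to absorb \<open>I2\<close> or the tail
  \<open>N1 {k..}\<close>, and each becomes a space of its own.\<close>

lemma ennpowr_mono: "0 < p \<Longrightarrow> x \<le> y \<Longrightarrow> ennpowr x p \<le> ennpowr y p"
  by (auto simp: ennpowr_def top_unique less_top intro!: ennreal_leI powr_mono2 enn2real_mono)

lemma ennpowr_ennreal: "0 \<le> c \<Longrightarrow> ennpowr (ennreal c) p = ennreal (c powr p)"
  by (simp add: ennpowr_def)

lemma ennpowr_top [simp]: "ennpowr top p = top"
  by (simp add: ennpowr_def)

lemma ennpowr_0 [simp]: "ennpowr 0 p = 0"
  by (simp add: ennpowr_def)

lemma ennpowr_less_top: "x < top \<Longrightarrow> ennpowr x p < top"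
  by (auto simp: ennpowr_def)

lemma ennpowr_mult: "0 < p \<Longrightarrow> ennpowr (x * y) p = ennpowr x p * ennpowr y p"
  by (cases x; cases y)
    (auto simp: ennpowr_ennreal powr_mult ennreal_mult_top ennreal_top_mult ennreal_mult[symmetric])

lemma ennpowr_ennpowr: "0 < p \<Longrightarrow> 0 < s \<Longrightarrow> ennpowr (ennpowr x p) s = ennpowr x (p * s)"
  by (cases x) (auto simp: ennpowr_ennreal powr_powr)

lemma ennpowr_one [simp]: "ennpowr x 1 = x"
  by (cases x) (auto simp: ennpowr_ennreal)

text \<open>Comparing the sum with twice its larger summand treats p < 1 and p >= 1 alike; after
  p-th roots the factor 2^p is just 2.\<close>

lemma ennpowr_add_le:
  assumes "0 < p"
  shows "ennpowr (x + y) p \<le> ennreal (2 powr p) * (ennpowr x p + ennpowr y p)"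
proof -
  have *: "ennpowr (u + v) p \<le> ennreal (2 powr p) * ennpowr v p" if "u \<le> v" for u v
  proof -
    have "u + v \<le> ennreal 2 * v" using that by (simp add: mult_2 add_right_mono)
    then have "ennpowr (u + v) p \<le> ennpowr (ennreal 2 * v) p" by (rule ennpowr_mono[OF assms])
    then show ?thesis by (simp only: ennpowr_mult[OF assms]) (simp add: ennpowr_ennreal del: ennreal_numeral)
  qed
  show ?thesis
  proof (cases "x \<le> y")
    case True
    from *[OF this] show ?thesis by (rule order_trans) (auto intro!: mult_left_mono)
  next
    case False
    then have "y \<le> x" by simp
    from *[OF this] show ?thesis by (subst add.commute, rule order_trans) (auto intro!: mult_left_mono)
  qed
qed

lemma recip_finite:
  assumes "0 < q" "q \<noteq> \<infinity>"
  shows "0 < enn2real q" "recip q = 1 / enn2real q"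
proof -
  obtain p where p: "q = ennreal p" "0 < p" using assms by (cases q) auto
  then show "0 < enn2real q" "recip q = 1 / enn2real q"
    by (auto simp: recip_def inverse_ennreal field_simps)
qed

section \<open>Sequence quasi-norms over the integers\<close>

text \<open>The factor t^(-1/q) of \<open>wnorm\<close> has no counterpart here: dt/t gives all
  dyadic blocks the same mass, so each block counts as one index.\<close>

definition lq :: "ennreal \<Rightarrow> int set \<Rightarrow> (int \<Rightarrow> ennreal) \<Rightarrow> ennreal" where
  "lq q S F =
     (if q = \<infinity> then SUP k\<in>S. F k
      else ennpowr (\<integral>\<^sup>+k\<in>S. ennpowr (F k) (enn2real q) \<partial>count_space UNIV) (recip q))"

lemma lq_mono:
  assumes "0 < q" "S \<subseteq> T" "\<And>k. k \<in> S \<Longrightarrow> F k \<le> G k"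
  shows "lq q S F \<le> lq q T G"
proof (cases "q = \<infinity>")
  case True
  then show ?thesis using assms by (auto simp: lq_def intro!: SUP_mono)
next
  case False
  note q = recip_finite[OF assms(1) this]
  show ?thesis using False q assms
    by (auto simp: lq_def intro!: ennpowr_mono nn_integral_mono split: split_indicator)
qed

lemma lq_cmult:
  assumes "0 < q"
  shows "lq q S (\<lambda>k. c * F k) = c * lq q S F"
proof (cases "q = \<infinity>")
  case True
  then show ?thesis by (cases "S = {}") (auto simp: lq_def SUP_mult_left_ennreal bot_ennreal)
next
  case False
  note q = recip_finite[OF assms(1) this]
  have "lq q S (\<lambda>k. c * F k) = ennpowr (\<integral>\<^sup>+k\<in>S. ennpowr c (enn2real q) * ennpowr (F k) (enn2real q) \<partial>count_space UNIV) (recip q)"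
    using False q by (simp add: lq_def ennpowr_mult)
  also have "\<dots> = ennpowr (ennpowr c (enn2real q) * (\<integral>\<^sup>+k\<in>S. ennpowr (F k) (enn2real q) \<partial>count_space UNIV)) (recip q)"
    by (simp add: mult.assoc nn_integral_cmult)
  also have "\<dots> = c * lq q S F"
    using False q by (simp add: lq_def ennpowr_mult ennpowr_ennpowr)
  finally show ?thesis .
qed

lemma lq_cmult_right:
  assumes "0 < q"
  shows "lq q S (\<lambda>k. F k * c) = lq q S F * c"
  using lq_cmult[OF assms, of S c F] by (simp add: mult.commute)

lemma lq_upper: "0 < q \<Longrightarrow> k \<in> S \<Longrightarrow> F k \<le> lq q S F"
proof (cases "q = \<infinity>")
  case True
  moreover assume "k \<in> S" 
  ultimately show ?thesis by (auto simp: lq_def intro!: SUP_upper)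
next
  case False
  assume *: "0 < q" "k \<in> S"
  note q = recip_finite[OF *(1) False]
  have "ennpowr (F k) (enn2real q) = (\<integral>\<^sup>+j\<in>{k}. ennpowr (F j) (enn2real q) \<partial>count_space UNIV)"
    by simp
  also have "\<dots> \<le> (\<integral>\<^sup>+j\<in>S. ennpowr (F j) (enn2real q) \<partial>count_space UNIV)"
    using * by (intro nn_integral_mono) (auto split: split_indicator)
  finally have "ennpowr (ennpowr (F k) (enn2real q)) (recip q) \<le> lq q S F"
    using False q by (auto simp: lq_def intro!: ennpowr_mono)
  then show ?thesis using q by (simp add: ennpowr_ennpowr)
qed

lemma lq_shift: "lq q S (\<lambda>k. F (k + m)) = lq q ((\<lambda>k. k + m) ` S) F"
proof (cases "q = \<infinity>")
  case True
  then show ?thesis by (simp add: lq_def image_image)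
next
  case False
  have bij: "bij_betw (\<lambda>k. k + m) (UNIV::int set) UNIV"
    by (intro bij_betwI[where g="\<lambda>k. k - m"]) auto
  have "(\<integral>\<^sup>+k\<in>(\<lambda>k. k + m) ` S. ennpowr (F k) (enn2real q) \<partial>count_space UNIV)
     = (\<integral>\<^sup>+k\<in>S. ennpowr (F (k + m)) (enn2real q) \<partial>count_space UNIV)"
    by (subst nn_integral_bij_count_space[OF bij, symmetric])
       (auto intro!: nn_integral_cong split: split_indicator)
  then show ?thesis using False by (simp add: lq_def)
qed

text \<open>The 2 is the p-th root of the constant of \<open>ennpowr_add_le\<close> for the
  summands; 2^(1/p) comes from the same lemma applied to the outer root.\<close>

definition quasi_const :: "ennreal \<Rightarrow> ennreal" where
  "quasi_const q = (if q = \<infinity> then 1 else ennreal 2 * ennreal (2 powr recip q))"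

lemma quasi_const_less_top: "quasi_const q < top"
  by (simp add: quasi_const_def ennreal_mult_less_top)

lemma lq_add_le:
  assumes "0 < q"
  shows "lq q S (\<lambda>k. F k + G k) \<le> quasi_const q * (lq q S F + lq q S G)"
proof (cases "q = \<infinity>")
  case True
  then show ?thesis
    by (auto simp: lq_def quasi_const_def intro!: SUP_least add_mono SUP_upper)
next
  case False
  note q = recip_finite[OF assms(1) False]
  define p where "p = enn2real q"
  have p: "0 < p" "recip q = 1 / p" using q by (auto simp: p_def)
  let ?I = "\<lambda>F. \<integral>\<^sup>+k\<in>S. ennpowr (F k) p \<partial>count_space UNIV"
  have "?I (\<lambda>k. F k + G k) \<le> (\<integral>\<^sup>+k. ennreal (2 powr p) * (ennpowr (F k) p * indicator S k + ennpowr (G k) p * indicator S k) \<partial>count_space UNIV)"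
    using ennpowr_add_le[OF p(1)] by (intro nn_integral_mono) (auto split: split_indicator)
  also have "\<dots> = ennreal (2 powr p) * (?I F + ?I G)"
    by (simp add: nn_integral_cmult nn_integral_add)
  finally have "ennpowr (?I (\<lambda>k. F k + G k)) (1/p) \<le> ennpowr (ennreal (2 powr p) * (?I F + ?I G)) (1/p)"
    using p by (intro ennpowr_mono) auto
  also have "\<dots> = ennreal 2 * ennpowr (?I F + ?I G) (1/p)"
    using p by (simp add: ennpowr_mult ennpowr_ennreal powr_powr)
  also have "\<dots> \<le> ennreal 2 * (ennreal (2 powr (1/p)) * (ennpowr (?I F) (1/p) + ennpowr (?I G) (1/p)))"
    using p by (intro mult_left_mono ennpowr_add_le) auto
  finally show ?thesis using False p(2) by (simp add: lq_def quasi_const_def p_def mult.assoc)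
qed

lemma lq_Un_le:
  assumes "0 < q"
  shows "lq q (S \<union> T) F \<le> quasi_const q * (lq q S F + lq q T F)"
proof -
  have restr: "lq q (S \<union> T) (\<lambda>k. F k * indicator X k) \<le> lq q X F" for X
  proof (cases "q = \<infinity>")
    case True
    then show ?thesis by (auto simp: lq_def split: split_indicator intro!: SUP_least SUP_upper)
  next
    case False
    note q = recip_finite[OF assms(1) False]
    show ?thesis using False q
      by (auto simp: lq_def intro!: ennpowr_mono nn_integral_mono split: split_indicator)
  qed
  have "lq q (S \<union> T) F \<le> lq q (S \<union> T) (\<lambda>k. F k * indicator S k + F k * indicator T k)"
    by (rule lq_mono[OF assms]) (auto split: split_indicator)
  also have "\<dots> \<le> quasi_const q * (lq q S F + lq q T F)"
    by (rule order_trans[OF lq_add_le[OF assms]]) (intro mult_left_mono add_mono restr; simp)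
  finally show ?thesis .
qed

text \<open>Tonelli regroups the sum over k by the value j = \<open>\<phi> k\<close>, so each
  \<open>F j\<close> is counted as often as its fibre has elements.\<close>

lemma lq_compose_le:
  fixes \<phi> :: "int \<Rightarrow> int"
  assumes q: "0 < q" and fin: "\<And>j. finite {k. \<phi> k = j}" and card: "\<And>j. card {k. \<phi> k = j} \<le> N"
  shows "lq q UNIV (\<lambda>k. F (\<phi> k)) \<le> ennreal (real N powr recip q) * lq q UNIV F"
proof (cases "q = \<infinity>")
  case True
  \<comment> \<open>\<open>0 powr 0\<close> is 0, so for q = \<infinity> the constant is 1 only if N
    is nonzero; the fibre over \<open>\<phi> 0\<close> is nonempty.\<close>
  have "N \<noteq> 0"
  proof
    assume "N = 0"
    then have "card {k. \<phi> k = \<phi> 0} = 0" using card[of "\<phi> 0"] by simp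
    then have "{k. \<phi> k = \<phi> 0} = {}" using fin by simp
    then show False by auto
  qed
  then show ?thesis using True by (auto simp: lq_def recip_def intro!: SUP_least SUP_upper)
next
  case False
  note q' = recip_finite[OF q False]
  define G where "G k = ennpowr (F k) (enn2real q)" for k
  have "(\<integral>\<^sup>+k. G (\<phi> k) \<partial>count_space UNIV) = (\<integral>\<^sup>+k. (\<integral>\<^sup>+j. G j * indicator {\<phi> k} j \<partial>count_space UNIV) \<partial>count_space UNIV)"
    by simp
  also have "\<dots> = (\<integral>\<^sup>+j. (\<integral>\<^sup>+k. G j * indicator {\<phi> k} j \<partial>count_space UNIV) \<partial>count_space UNIV)"
    by (rule nn_integral_count_space_nn_integral) auto
  also have "\<dots> = (\<integral>\<^sup>+j. (\<integral>\<^sup>+k. G j * indicator {k. \<phi> k = j} k \<partial>count_space UNIV) \<partial>count_space UNIV)"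
    by (intro nn_integral_cong) (auto split: split_indicator)
  also have "\<dots> = (\<integral>\<^sup>+j. G j * of_nat (card {k. \<phi> k = j}) \<partial>count_space UNIV)"
    by (intro nn_integral_cong) (simp add: nn_integral_cmult emeasure_count_space fin)
  also have "\<dots> \<le> (\<integral>\<^sup>+j. ennreal (real N) * G j \<partial>count_space UNIV)"
    using card by (intro nn_integral_mono) (simp add: mult.commute mult_left_mono ennreal_of_nat_eq_real_of_nat)
  also have "\<dots> = ennreal (real N) * (\<integral>\<^sup>+j. G j \<partial>count_space UNIV)"
    by (simp add: nn_integral_cmult)
  finally have "ennpowr (\<integral>\<^sup>+k. G (\<phi> k) \<partial>count_space UNIV) (recip q)
     \<le> ennpowr (ennreal (real N) * (\<integral>\<^sup>+j. G j \<partial>count_space UNIV)) (recip q)"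
    using q' by (intro ennpowr_mono) auto
  then show ?thesis using False q' 
    by (simp add: lq_def G_def ennpowr_mult ennpowr_ennreal)
qed

section \<open>Dyadic discretisation of weighted norms\<close>

lemma le_mult_trans: "u \<le> c * v \<Longrightarrow> v \<le> d * w \<Longrightarrow> u \<le> c * d * w" for u v w c d :: ennreal
  by (metis mult.assoc mult_left_mono order_trans zero_le)

abbreviation dyad :: "int \<Rightarrow> real" where
  "dyad k \<equiv> 2 powr real_of_int k"

definition dlog :: "real \<Rightarrow> int" where
  "dlog t = \<lfloor>log 2 t\<rfloor>"

lemma dlog_eq_iff: "0 < t \<Longrightarrow> dlog t = k \<longleftrightarrow> dyad k \<le> t \<and> t < 2 * dyad k"
  unfolding dlog_def floor_eq_iff
  by (subst le_log_iff less_log_iff log_less_iff, simp, simp)+ (simp add: powr_add mult.commute)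

lemma dlog_lower: "0 < t \<Longrightarrow> dyad (dlog t) \<le> t"
  and dlog_upper: "0 < t \<Longrightarrow> t < 2 * dyad (dlog t)"
  using dlog_eq_iff[of t "dlog t"] by auto

lemma dlog_dyad [simp]: "dlog (dyad k) = k"
  by (subst dlog_eq_iff) auto

lemma dlog_mono: "0 < s \<Longrightarrow> s \<le> t \<Longrightarrow> dlog s \<le> dlog t"
  unfolding dlog_def by (intro floor_mono) auto

lemma dlog_less_imp_less: "0 < s \<Longrightarrow> 0 < t \<Longrightarrow> dlog s < dlog t \<Longrightarrow> s < t"
  using dlog_mono[of t s] by force

definition dblock :: "int \<Rightarrow> real set" where
  "dblock k = {dyad k..<2 * dyad k}"

lemma dblock_iff: "t \<in> dblock k \<longleftrightarrow> 0 < t \<and> dlog t = k"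
proof (cases "0 < t")
  case True
  then show ?thesis by (auto simp: dblock_def dlog_eq_iff)
next
  case False
  moreover have "0 < dyad k" by simp
  ultimately show ?thesis unfolding dblock_def by auto
qed

lemma sets_dblock [measurable, simp]: "dblock k \<in> sets lebesgue"
  by (simp add: dblock_def)

lemma emeasure_dblock: "emeasure lebesgue (dblock k) = ennreal (dyad k)"
proof -
  have "emeasure lborel {dyad k..<2 * dyad k} = ennreal (2 * dyad k - dyad k)"
    by (rule emeasure_lborel_Ico) simp
  then show ?thesis by (simp add: dblock_def)
qed

text \<open>Step functions on dyadic blocks are measurable, so Tonelli applies to them even when the
  function compared with them is not measurable.\<close>

lemma nn_integral_dblocks:
  "(\<integral>\<^sup>+t. (\<integral>\<^sup>+k. g k * indicator (dblock k) t \<partial>count_space UNIV) \<partial>lebesgue)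
   = (\<integral>\<^sup>+k. g k * ennreal (dyad k) \<partial>count_space UNIV)"
proof -
  have "(\<integral>\<^sup>+t. (\<integral>\<^sup>+k. g k * indicator (dblock k) t \<partial>count_space UNIV) \<partial>lebesgue)
   = (\<integral>\<^sup>+k. (\<integral>\<^sup>+t. g k * indicator (dblock k) t \<partial>lebesgue) \<partial>count_space UNIV)"
    by (rule nn_integral_count_space_nn_integral) auto
  then show ?thesis by (simp add: nn_integral_cmult emeasure_dblock)
qed

lemma nn_integral_indicator_dblock:
  "(\<integral>\<^sup>+k. g k * indicator (dblock k) t \<partial>count_space UNIV) = (if 0 < t then g (dlog t) else 0)"
proof (cases "0 < t")
  case True
  then have "(\<integral>\<^sup>+k. g k * indicator (dblock k) t \<partial>count_space UNIV)
     = (\<integral>\<^sup>+k. g k * indicator {dlog t} k \<partial>count_space UNIV)"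
    by (intro nn_integral_cong) (auto simp: dblock_iff split: split_indicator)
  then show ?thesis using True by simp
next
  case False
  then have "indicator (dblock k) t = (0::ennreal)" for k by (auto simp: dblock_iff)
  then show ?thesis using False by simp
qed

text \<open>The p-th power of t^(-1/p) is the density of dt/t.\<close>

lemma ennpowr_weight:
  assumes "0 < p" "0 < t"
  shows "ennpowr (ennreal (t powr (- (1 / p)) * b) * F) p = ennreal (inverse t) * ennpowr (ennreal b * F) p"
proof -
  have "ennreal (t powr (- (1 / p)) * b) * F = ennreal (t powr (- (1 / p))) * (ennreal b * F)"
    by (simp add: ennreal_mult' mult.assoc)
  moreover have "(t powr (- (1 / p))) powr p = inverse t"
    using assms by (simp only: powr_powr) (simp add: powr_minus)
  ultimately show ?thesis
    by (simp only: ennpowr_mult[OF assms(1)] ennpowr_ennreal powr_ge_zero)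
qed

text \<open>On block k the density 1/t is at most 2^(-k), so the block has mass at most 1 and no
  constant appears. Monotonicity of the lower integral suffices, and \<open>I\<close> may meet a
  block only partly.\<close>

lemma wnorm_le_lq:
  assumes q: "0 < q" and I: "I \<subseteq> {0<..}"
    and le: "\<And>t. t \<in> I \<Longrightarrow> dlog t \<in> S \<and> ennreal (b t) * F t \<le> c (dlog t)"
  shows "wnorm q b I F \<le> lq q S c"
proof (cases "q = \<infinity>")
  case True
  have "AE t\<in>I in lebesgue. ennreal (t powr (- recip q) * b t) * F t \<le> lq q S c"
  proof (intro AE_I2 impI)
    fix t assume t: "t \<in> I"
    then have "t powr (- recip q) = 1" using I True by (auto simp: recip_def)
    then show "ennreal (t powr (- recip q) * b t) * F t \<le> lq q S c"
      using le[OF t] lq_upper[OF q, of "dlog t" S c] by auto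
  qed
  then show ?thesis using True
    by (simp add: wnorm_def Lq_norm_def Inf_lower)
next
  case False
  define p where "p = enn2real q"
  have p: "0 < p" "recip q = 1 / p" using recip_finite[OF q False] by (auto simp: p_def)
  define g where "g k = ennreal (inverse (dyad k)) * ennpowr (c k) p * indicator S k" for k
  have "(\<integral>\<^sup>+t\<in>I. ennpowr (ennreal (t powr (- recip q) * b t) * F t) p \<partial>lebesgue)
     \<le> (\<integral>\<^sup>+t. (\<integral>\<^sup>+k. g k * indicator (dblock k) t \<partial>count_space UNIV) \<partial>lebesgue)"
  proof (rule nn_integral_mono)
    fix t
    show "ennpowr (ennreal (t powr (- recip q) * b t) * F t) p * indicator I t
       \<le> (\<integral>\<^sup>+k. g k * indicator (dblock k) t \<partial>count_space UNIV)"
    proof (cases "t \<in> I")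
      case True
      then have t: "0 < t" using I by auto
      have "inverse t \<le> inverse (dyad (dlog t))" using dlog_lower[OF t] by (intro le_imp_inverse_le) auto
      then have "ennreal (inverse t) * ennpowr (ennreal (b t) * F t) p \<le> g (dlog t)"
        using le[OF True] p(1) by (auto simp: g_def intro!: mult_mono ennpowr_mono ennreal_leI)
      then show ?thesis using t True p
        by (simp add: nn_integral_indicator_dblock ennpowr_weight)
    qed simp
  qed
  also have "\<dots> = (\<integral>\<^sup>+k\<in>S. ennpowr (c k) p \<partial>count_space UNIV)"
    unfolding nn_integral_dblocks
  proof (intro nn_integral_cong)
    fix k
    have "ennreal (inverse (dyad k)) * ennreal (dyad k) = 1"
      by (simp flip: ennreal_mult add: powr_minus)
    moreover have "g k * ennreal (dyad k)
       = (ennreal (inverse (dyad k)) * ennreal (dyad k)) * (ennpowr (c k) p * indicator S k)"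
      by (simp only: g_def ac_simps)
    ultimately show "g k * ennreal (dyad k) = ennpowr (c k) p * indicator S k" by simp
  qed
  finally have "ennpowr (\<integral>\<^sup>+t\<in>I. ennpowr (ennreal (t powr (- recip q) * b t) * F t) p \<partial>lebesgue) (recip q)
     \<le> ennpowr (\<integral>\<^sup>+k\<in>S. ennpowr (c k) p \<partial>count_space UNIV) (recip q)"
    using p by (intro ennpowr_mono) auto
  then show ?thesis using False by (simp add: wnorm_def Lq_norm_def lq_def p_def)
qed

text \<open>Here 1/t exceeds half of 2^(-k), whence 2^(1/q), and \<open>I\<close> must contain every
  block of \<open>S\<close> entirely. This is why lower bounds over intervals with arbitrary
  endpoints lose boundary blocks below.\<close>

lemma lq_le_wnorm:
  assumes q: "0 < q"
    and le: "\<And>t. 0 < t \<Longrightarrow> dlog t \<in> S \<Longrightarrow> t \<in> I \<and> c (dlog t) \<le> ennreal (b t) * F t"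
  shows "lq q S c \<le> ennreal (2 powr recip q) * wnorm q b I F"
proof (cases "q = \<infinity>")
  case True
  have "c k \<le> z" if k: "k \<in> S" and z: "AE t\<in>I in lebesgue. ennreal (t powr (- recip q) * b t) * F t \<le> z" for k z
  proof (rule ccontr)
    assume *: "\<not> c k \<le> z"
    \<comment> \<open>An a.e. bound smaller than \<open>c k\<close> would turn the whole block, of
      measure 2^k, into a null set.\<close>
    have "AE t in lebesgue. t \<notin> dblock k"
      using z
    proof eventually_elim
      case (elim t)
      show ?case
      proof
        assume "t \<in> dblock k"
        then have t: "0 < t" "dlog t = k" by (auto simp: dblock_iff)
        then have "t powr (- recip q) = 1" using True by (auto simp: recip_def)
        then show False using * elim le[of t] t k by auto
      qed
    qed
    then have "emeasure lebesgue (dblock k) = 0"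
      by (subst (asm) AE_iff_measurable[of "dblock k"]) auto
    then show False by (simp add: emeasure_dblock)
  qed
  then show ?thesis using True
    by (auto simp: wnorm_def Lq_norm_def lq_def recip_def intro!: SUP_least Inf_greatest)
next
  case False
  define p where "p = enn2real q"
  have p: "0 < p" "recip q = 1 / p" using recip_finite[OF q False] by (auto simp: p_def)
  define g where "g k = ennreal (inverse (2 * dyad k)) * ennpowr (c k) p * indicator S k" for k
  have "(\<integral>\<^sup>+k\<in>S. ennpowr (c k) p \<partial>count_space UNIV) = (\<integral>\<^sup>+k. 2 * (g k * ennreal (dyad k)) \<partial>count_space UNIV)"
  proof (intro nn_integral_cong)
    fix k
    have "ennreal 2 * ennreal (inverse (2 * dyad k)) * ennreal (dyad k) = 1"
      by (simp flip: ennreal_mult add: powr_minus del: ennreal_numeral)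
    moreover have "2 * (g k * ennreal (dyad k))
       = (ennreal 2 * ennreal (inverse (2 * dyad k)) * ennreal (dyad k)) * (ennpowr (c k) p * indicator S k)"
      by (simp add: g_def ac_simps)
    ultimately show "ennpowr (c k) p * indicator S k = 2 * (g k * ennreal (dyad k))" by simp
  qed
  also have "\<dots> = 2 * (\<integral>\<^sup>+t. (\<integral>\<^sup>+k. g k * indicator (dblock k) t \<partial>count_space UNIV) \<partial>lebesgue)"
    unfolding nn_integral_dblocks by (simp add: nn_integral_cmult)
  also have "\<dots> \<le> 2 * (\<integral>\<^sup>+t\<in>I. ennpowr (ennreal (t powr (- recip q) * b t) * F t) p \<partial>lebesgue)"
  proof (intro mult_left_mono nn_integral_mono)
    fix t
    show "(\<integral>\<^sup>+k. g k * indicator (dblock k) t \<partial>count_space UNIV)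
       \<le> ennpowr (ennreal (t powr (- recip q) * b t) * F t) p * indicator I t"
    proof (cases "0 < t \<and> dlog t \<in> S")
      case True
      then have t: "0 < t" "dlog t \<in> S" by auto
      have "inverse (2 * dyad (dlog t)) \<le> inverse t" using dlog_upper[OF t(1)] t by (intro le_imp_inverse_le) auto
      then have "g (dlog t) \<le> ennreal (inverse t) * ennpowr (ennreal (b t) * F t) p"
        using le[OF t] p(1) t(2) by (auto simp: g_def intro!: mult_mono ennpowr_mono ennreal_leI)
      then show ?thesis using t True p le[OF t]
        by (simp add: nn_integral_indicator_dblock ennpowr_weight)
    qed (auto simp: nn_integral_indicator_dblock g_def)
  qed simp
  finally have "ennpowr (\<integral>\<^sup>+k\<in>S. ennpowr (c k) p \<partial>count_space UNIV) (recip q)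
     \<le> ennpowr (ennreal 2 * (\<integral>\<^sup>+t\<in>I. ennpowr (ennreal (t powr (- recip q) * b t) * F t) p \<partial>lebesgue)) (recip q)"
    using p by (intro ennpowr_mono) auto
  also have "\<dots> = ennreal (2 powr recip q) * ennpowr (\<integral>\<^sup>+t\<in>I. ennpowr (ennreal (t powr (- recip q) * b t) * F t) p \<partial>lebesgue) (recip q)"
    using p by (subst ennpowr_mult) (auto simp: ennpowr_ennreal simp del: ennreal_numeral)
  finally show ?thesis using False by (simp add: wnorm_def Lq_norm_def lq_def p_def)
qed

text \<open>The neighbour condition pays for boundary blocks: where an interval ends inside a block,
  the indices are shifted by one or two, at the cost of powers of M.\<close>

definition comparable :: "ennreal \<Rightarrow> (real \<Rightarrow> ennreal) \<Rightarrow> (int \<Rightarrow> ennreal) \<Rightarrow> bool" where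
  "comparable M g x \<longleftrightarrow> 1 \<le> M \<and> M < top \<and>
     (\<forall>t>0. g t \<le> M * x (dlog t) \<and> x (dlog t) \<le> M * g t) \<and>
     (\<forall>i. x i \<le> M * x (i + 1) \<and> x (i + 1) \<le> M * x i)"

lemma comparableD:
  assumes "comparable M g x"
  shows "0 < t \<Longrightarrow> g t \<le> M * x (dlog t)" "0 < t \<Longrightarrow> x (dlog t) \<le> M * g t"
    "x i \<le> M * x (i + 1)" "x (i + 1) \<le> M * x i" "1 \<le> M" "M < top"
  using assms by (auto simp: comparable_def)

lemma comparable_mult:
  assumes "comparable M g x" "comparable N h y"
  shows "comparable (M * N) (\<lambda>t. g t * h t) (\<lambda>i. x i * y i)"
proof -
  have *: "u * v \<le> M * N * (u' * v')" if "u \<le> M * u'" "v \<le> N * v'" for u v u' v' :: ennreal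
    using mult_mono[OF that] by (simp add: ac_simps)
  have "1 \<le> M * N" using mult_mono[of 1 M 1 N] assms by (simp add: comparable_def)
  then show ?thesis using assms unfolding comparable_def
    by (intro conjI allI impI *) (auto simp: ennreal_mult_less_top)
qed

lemma comparable_mono:
  assumes "comparable M g x" "M \<le> N" "N < top"
  shows "comparable N g x"
proof -
  have "u \<le> N * v" if "u \<le> M * v" for u v :: ennreal
    using that assms(2) by (meson mult_right_mono order_trans zero_le)
  then show ?thesis using assms by (auto simp: comparable_def)
qed

text \<open>The condition \<open>1 \<le> M < top\<close> makes \<open>M\<close> invertible in \<^typ>\<open>ennreal\<close>; for a
  nonmeasurable \<open>F\<close> the lower integral need not commute with multiplication by \<open>M\<close>, hence
  the detour through the sequence side.\<close>

lemma lq_le_wnorm_scaled: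
  assumes q: "0 < q" and M: "1 \<le> M" "M < top"
    and le: "\<And>t. 0 < t \<Longrightarrow> dlog t \<in> S \<Longrightarrow> t \<in> I \<and> c (dlog t) \<le> M * (ennreal (b t) * F t)"
  shows "lq q S c \<le> M * ennreal (2 powr recip q) * wnorm q b I F"
proof -
  have M': "M * inverse M = 1" using M ennreal_divide_self[of M] by (cases "M = 0") (auto simp: divide_ennreal_def)
  have cancel: "M * (inverse M * u) = u" "inverse M * (M * u) = u" for u
    using M' by (simp_all flip: mult.assoc) (simp_all add: mult.commute)
  have "lq q S (\<lambda>k. inverse M * c k) \<le> ennreal (2 powr recip q) * wnorm q b I F"
  proof (rule lq_le_wnorm[OF q])
    fix t :: real assume "0 < t" "dlog t \<in> S"
    from le[OF this] have "t \<in> I" "inverse M * c (dlog t) \<le> inverse M * (M * (ennreal (b t) * F t))"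
      by (auto intro: mult_left_mono)
    then show "t \<in> I \<and> inverse M * c (dlog t) \<le> ennreal (b t) * F t" by (simp only: cancel)
  qed
  then have "M * lq q S (\<lambda>k. inverse M * c k) \<le> M * (ennreal (2 powr recip q) * wnorm q b I F)"
    by (rule mult_left_mono) simp
  then show ?thesis by (simp only: lq_cmult[OF q] cancel mult.assoc)
qed

lemma wnorm_le_lq_comparable:
  assumes q: "0 < q" and c: "comparable M (\<lambda>t. ennreal (a t) * \<phi> t) x"
    and "I \<subseteq> {0<..}" "dlog ` I \<subseteq> S"
  shows "wnorm q a I \<phi> \<le> M * lq q S x"
  unfolding lq_cmult[OF q, symmetric]
  using assms by (intro wnorm_le_lq) (auto intro: comparableD(1))

lemma lq_le_wnorm_comparable:
  assumes q: "0 < q" and c: "comparable M (\<lambda>t. ennreal (a t) * \<phi> t) x"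
    and "\<And>t. 0 < t \<Longrightarrow> dlog t \<in> S \<Longrightarrow> t \<in> I"
  shows "lq q S x \<le> M * ennreal (2 powr recip q) * wnorm q a I \<phi>"
  by (rule lq_le_wnorm_scaled) (use assms comparableD[OF c] in auto)

subsection \<open>Iterated norms\<close>

text \<open>One set \<open>S\<close> truncates both indices: \<open>UNIV\<close>,
  \<open>{k..}\<close> and \<open>{..k}\<close> yield the discrete double norms of the R-, RR- and
  RL-spaces, and \<open>{..k}\<close> with the bare weights yields that of
  \<open>chi1\<close>.\<close>

definition DN :: "ennreal \<Rightarrow> ennreal \<Rightarrow> int set \<Rightarrow> (int \<Rightarrow> ennreal) \<Rightarrow> (int \<Rightarrow> ennreal) \<Rightarrow> ennreal" where
  "DN r q S y x = lq r S (\<lambda>j. y j * lq q (S \<inter> {j..}) x)"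

lemma DN_mono:
  assumes "0 < r" "0 < q" "S \<subseteq> T" "\<And>i. i \<in> S \<Longrightarrow> x i \<le> x' i"
  shows "DN r q S y x \<le> DN r q T y x'"
  unfolding DN_def using assms by (auto intro!: lq_mono mult_left_mono)

lemma DN_cmult:
  assumes "0 < r" "0 < q"
  shows "DN r q S y (\<lambda>i. c * x i) = c * DN r q S y x"
  by (simp add: DN_def lq_cmult assms mult.left_commute)

lemma DN_shift: 
  assumes "0 < r" "0 < q" and y: "\<And>j. y j \<le> M * y (j + m)" and x: "\<And>j. x j \<le> N * x (j + m)"
  shows "DN r q S y x \<le> M * N * DN r q ((\<lambda>i. i + m) ` S) y x"
proof -
  have *: "(\<lambda>i. i + m) ` S \<inter> {j + m..} = (\<lambda>i. i + m) ` (S \<inter> {j..})" for j by auto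
  have "DN r q S y x \<le> lq r S (\<lambda>j. M * y (j + m) * lq q (S \<inter> {j..}) (\<lambda>i. N * x (i + m)))"
    unfolding DN_def using assms by (intro lq_mono mult_mono) auto
  also have "\<dots> = M * N * lq r S (\<lambda>j. y (j + m) * lq q (S \<inter> {j..}) (\<lambda>i. x (i + m)))"
    unfolding lq_cmult[OF assms(1), symmetric] lq_cmult[OF assms(2)] by (simp add: ac_simps)
  also have "lq r S (\<lambda>j. y (j + m) * lq q (S \<inter> {j..}) (\<lambda>i. x (i + m))) = DN r q ((\<lambda>i. i + m) ` S) y x"
    unfolding DN_def lq_shift[where F="\<lambda>j. y j * lq q ((\<lambda>i. i + m) ` S \<inter> {j..}) x", symmetric] * lq_shift ..
  finally show ?thesis .
qed

text \<open>Leaving \<open>J\<close> open covers the inner intervals (u,\<infinity>) and (u,t) at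
  once; points after u lie in blocks from \<open>dlog u\<close> on.\<close>

lemma iterated_le:
  assumes "0 < r" "0 < q"
    and y: "comparable M (\<lambda>t. ennreal (b t)) y" and x: "comparable M (\<lambda>t. ennreal (a t) * \<phi> t) x"
    and I: "I \<subseteq> {0<..}" "dlog ` I \<subseteq> S" and J: "\<And>u. u \<in> I \<Longrightarrow> J u \<subseteq> I \<inter> {u<..}"
  shows "wnorm r b I (\<lambda>u. wnorm q a (J u) \<phi>) \<le> M * M * DN r q S y x"
  unfolding DN_def lq_cmult[OF assms(1), symmetric]
proof (rule wnorm_le_lq[OF assms(1) I(1)])
  fix u assume u: "u \<in> I"
  have "wnorm q a (J u) \<phi> \<le> M * lq q (S \<inter> {dlog u..}) x"
  proof (rule wnorm_le_lq_comparable[OF assms(2) x])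
    show "J u \<subseteq> {0<..}" using I J[OF u] by auto
    have "dlog u \<le> dlog v" if "v \<in> J u" for v
      using that I J[OF u] u by (intro dlog_mono) auto
    then show "dlog ` J u \<subseteq> S \<inter> {dlog u..}" using I J[OF u] by blast
  qed
  then have "ennreal (b u) * wnorm q a (J u) \<phi> \<le> (M * y (dlog u)) * (M * lq q (S \<inter> {dlog u..}) x)"
    using comparableD(1)[OF y] u I by (intro mult_mono) auto
  then show "dlog u \<in> S \<and> ennreal (b u) * wnorm q a (J u) \<phi> \<le> M * M * (y (dlog u) * lq q (S \<inter> {dlog u..}) x)"
    using I u by (auto simp: ac_simps)
qed

definition nested_const :: "ennreal \<Rightarrow> ennreal \<Rightarrow> ennreal \<Rightarrow> ennreal" where
  "nested_const r q M = M * M * M * ennreal (2 powr recip r) * ennreal (2 powr recip q)"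

text \<open>A point u of block j may have part of that block to its left, so only the blocks from j
  + 1 on are known to lie beyond u. The inner index is therefore shifted by one, which costs a
  factor M and requires i + 1 in \<open>S\<close> for i in \<open>S'\<close>.\<close>

lemma iterated_ge:
  assumes rq: "0 < r" "0 < q"
    and y: "comparable M (\<lambda>t. ennreal (b t)) y" and x: "comparable M (\<lambda>t. ennreal (a t) * \<phi> t) x"
    and I: "\<And>t. 0 < t \<Longrightarrow> dlog t \<in> S \<Longrightarrow> t \<in> I"
    and J: "\<And>u v. u \<in> I \<Longrightarrow> v \<in> I \<Longrightarrow> u < v \<Longrightarrow> v \<in> J u"
    and S': "S' \<subseteq> S" "\<And>i. i \<in> S' \<Longrightarrow> i + 1 \<in> S"
  shows "DN r q S' y x \<le> nested_const r q M * wnorm r b I (\<lambda>u. wnorm q a (J u) \<phi>)"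
proof -
  note M = comparableD(5,6)[OF x]
  define c where "c = M * M * ennreal (2 powr recip q)"
  have "DN r q S' y x \<le> lq r S (\<lambda>j. M * (y j * lq q (S \<inter> {j+1..}) x))"
    unfolding DN_def
  proof (rule lq_mono[OF rq(1) S'(1)])
    fix j assume "j \<in> S'"
    have "lq q (S' \<inter> {j..}) x \<le> lq q (S' \<inter> {j..}) (\<lambda>i. M * x (i + 1))"
      using comparableD(3)[OF x] by (intro lq_mono rq) auto
    also have "\<dots> = M * lq q ((\<lambda>i. i + 1) ` (S' \<inter> {j..})) x"
      by (simp add: lq_cmult rq lq_shift)
    also have "\<dots> \<le> M * lq q (S \<inter> {j+1..}) x"
      using S' by (intro mult_left_mono lq_mono rq) auto
    finally show "y j * lq q (S' \<inter> {j..}) x \<le> M * (y j * lq q (S \<inter> {j+1..}) x)"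
      by (metis mult.left_commute mult_left_mono zero_le)
  qed
  also have "\<dots> = M * lq r S (\<lambda>j. y j * lq q (S \<inter> {j+1..}) x)"
    by (simp add: lq_cmult rq)
  also note pre = calculation
  have "lq r S (\<lambda>j. y j * lq q (S \<inter> {j+1..}) x)
     \<le> c * ennreal (2 powr recip r) * wnorm r b I (\<lambda>u. wnorm q a (J u) \<phi>)"
  proof (rule lq_le_wnorm_scaled[OF rq(1)])
    have "1 \<le> 2 powr recip q" by (rule ge_one_powr_ge_zero) (auto simp: recip_def)
    then have "1 * 1 * 1 \<le> c" unfolding c_def using M by (intro mult_mono) auto
    then show "1 \<le> c" by simp
    show "c < top" using M by (simp add: c_def ennreal_mult_less_top)
    fix u :: real assume u: "0 < u" "dlog u \<in> S"
    have "lq q (S \<inter> {dlog u+1..}) x \<le> M * ennreal (2 powr recip q) * wnorm q a (J u) \<phi>"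
      by (rule lq_le_wnorm_comparable[OF rq(2) x]) (use u I J dlog_less_imp_less in auto)
    then have "y (dlog u) * lq q (S \<inter> {dlog u+1..}) x \<le> (M * ennreal (b u)) * (M * ennreal (2 powr recip q) * wnorm q a (J u) \<phi>)"
      using comparableD(2)[OF y] u by (intro mult_mono) auto
    then show "u \<in> I \<and> y (dlog u) * lq q (S \<inter> {dlog u+1..}) x \<le> c * (ennreal (b u) * wnorm q a (J u) \<phi>)"
      using I u by (auto simp: c_def ac_simps)
  qed
  from le_mult_trans[OF pre this] show ?thesis by (simp add: c_def nested_const_def ac_simps)
qed

lemma iterated_whole:
  assumes "0 < r" "0 < q"
    and "comparable M (\<lambda>t. ennreal (b t)) y" and "comparable M (\<lambda>t. ennreal (a t) * \<phi> t) x"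
  shows "wnorm r b {0<..} (\<lambda>u. wnorm q a {u<..} \<phi>) \<le> M * M * DN r q UNIV y x"
    and "DN r q UNIV y x \<le> nested_const r q M * wnorm r b {0<..} (\<lambda>u. wnorm q a {u<..} \<phi>)"
  by (rule iterated_le[OF assms] iterated_ge[OF assms]; force)+

lemma iterated_upper:
  assumes "0 < r" "0 < q"
    and y: "comparable M (\<lambda>t. ennreal (b t)) y" and x: "comparable M (\<lambda>t. ennreal (a t) * \<phi> t) x"
    and t: "0 < t"
  shows "wnorm r b {t<..} (\<lambda>u. wnorm q a {u<..} \<phi>) \<le> M * M * DN r q {dlog t..} y x"
    and "DN r q {dlog t..} y x \<le> M * M * nested_const r q M * wnorm r b {t<..} (\<lambda>u. wnorm q a {u<..} \<phi>)"
proof -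
  show "wnorm r b {t<..} (\<lambda>u. wnorm q a {u<..} \<phi>) \<le> M * M * DN r q {dlog t..} y x"
    by (rule iterated_le) (use assms dlog_mono in auto)
  \<comment> \<open>The block of t is cut by t, so whole blocks are available only from
    \<open>dlog t + 1\<close> on.\<close>
  have *: "(\<lambda>i. i + 1) ` {dlog t..} = {dlog t + 1..}"
    by (auto simp: image_iff intro!: bexI[of _ "_ - 1"])
  have "DN r q {dlog t..} y x \<le> M * M * DN r q {dlog t + 1..} y x"
    unfolding *[symmetric] using assms by (intro DN_shift) (auto intro: comparableD)
  also note pre = calculation
  have "DN r q {dlog t + 1..} y x \<le> nested_const r q M * wnorm r b {t<..} (\<lambda>u. wnorm q a {u<..} \<phi>)"
    by (rule iterated_ge[where S="{dlog t + 1..}"]) (use assms dlog_less_imp_less in auto)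
  from le_mult_trans[OF pre this] show "DN r q {dlog t..} y x \<le> M * M * nested_const r q M * wnorm r b {t<..} (\<lambda>u. wnorm q a {u<..} \<phi>)"
    by (simp only: mult.assoc)
qed

lemma iterated_lower:
  assumes "0 < r" "0 < q"
    and y: "comparable M (\<lambda>t. ennreal (b t)) y" and x: "comparable M (\<lambda>t. ennreal (a t) * \<phi> t) x"
    and t: "0 < t"
  shows "wnorm r b {0<..<t} (\<lambda>u. wnorm q a {u<..<t} \<phi>) \<le> M * M * DN r q {..dlog t} y x"
    and "DN r q {..dlog t} y x \<le> M * M * M * M * nested_const r q M * wnorm r b {0<..<t} (\<lambda>u. wnorm q a {u<..<t} \<phi>)"
proof -
  show "wnorm r b {0<..<t} (\<lambda>u. wnorm q a {u<..<t} \<phi>) \<le> M * M * DN r q {..dlog t} y x"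
    by (rule iterated_le) (use assms dlog_mono in auto)
  \<comment> \<open>Two steps are lost: (0,t) is sure to contain whole blocks only up to
    \<open>dlog t - 1\<close>, and \<open>iterated_ge\<close> needs i + 1 to be such a block
    too.\<close>
  have *: "(\<lambda>i. i + (-2)) ` {..dlog t} = {..dlog t - 2}"
    by (auto simp: image_iff intro!: bexI[of _ "_ + 2"])
  have twice: "z i \<le> M * M * z (i + (-2))" if z: "comparable M g z" for g and z :: "int \<Rightarrow> ennreal" and i
  proof -
    have "z i \<le> M * z (i - 1)" using comparableD(4)[OF z, of "i - 1"] by simp
    also have "z (i - 1) \<le> M * z (i - 2)" using comparableD(4)[OF z, of "i - 2"] by simp
    finally show ?thesis by (simp add: mult.assoc mult_left_mono)
  qed
  have "DN r q {..dlog t} y x \<le> (M * M) * (M * M) * DN r q {..dlog t - 2} y x"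
    unfolding *[symmetric] using assms by (intro DN_shift twice)
  also note pre = calculation
  have "DN r q {..dlog t - 2} y x \<le> nested_const r q M * wnorm r b {0<..<t} (\<lambda>u. wnorm q a {u<..<t} \<phi>)"
    by (rule iterated_ge[where S="{..dlog t - 1}"]) (use assms dlog_less_imp_less in auto)
  from le_mult_trans[OF pre this] show "DN r q {..dlog t} y x \<le> M * M * M * M * nested_const r q M * wnorm r b {0<..<t} (\<lambda>u. wnorm q a {u<..<t} \<phi>)"
    by (simp only: mult.assoc)
qed

lemma single_lower:
  assumes q: "0 < q" and x: "comparable M (\<lambda>t. ennreal (a t) * \<phi> t) x" and t: "0 < t"
  shows "wnorm q a {0<..<t} \<phi> \<le> M * lq q {..dlog t} x"
    and "lq q {..dlog t} x \<le> M * M * ennreal (2 powr recip q) * wnorm q a {0<..<t} \<phi>"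
proof -
  show "wnorm q a {0<..<t} \<phi> \<le> M * lq q {..dlog t} x"
    by (rule wnorm_le_lq_comparable) (use assms dlog_mono in auto)
  have *: "(\<lambda>i. i + (-1)) ` {..dlog t} = {..dlog t - 1}"
    by (auto simp: image_iff intro!: bexI[of _ "_ + 1"])
  have "lq q {..dlog t} x \<le> lq q {..dlog t} (\<lambda>i. M * x (i + (-1)))"
    using comparableD(4)[OF x, of "_ - 1"] by (intro lq_mono q) auto
  also have "\<dots> = M * lq q {..dlog t - 1} x"
    by (simp only: lq_cmult[OF q] lq_shift *)
  also note pre = calculation
  have "lq q {..dlog t - 1} x \<le> M * ennreal (2 powr recip q) * wnorm q a {0<..<t} \<phi>"
    by (rule lq_le_wnorm_comparable) (use assms dlog_less_imp_less in auto)
  from le_mult_trans[OF pre this] show "lq q {..dlog t} x \<le> M * M * ennreal (2 powr recip q) * wnorm q a {0<..<t} \<phi>"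
    by (simp only: mult.assoc)
qed

lemma single_upper:
  assumes q: "0 < q" and x: "comparable M (\<lambda>t. ennreal (a t) * \<phi> t) x" and t: "0 < t"
  shows "wnorm q a {t<..} \<phi> \<le> M * lq q {dlog t..} x"
    and "lq q {dlog t..} x \<le> M * M * ennreal (2 powr recip q) * wnorm q a {t<..} \<phi>"
proof -
  show "wnorm q a {t<..} \<phi> \<le> M * lq q {dlog t..} x"
    by (rule wnorm_le_lq_comparable) (use assms dlog_mono in auto)
  have *: "(\<lambda>i. i + 1) ` {dlog t..} = {dlog t + 1..}"
    by (auto simp: image_iff intro!: bexI[of _ "_ - 1"])
  have "lq q {dlog t..} x \<le> lq q {dlog t..} (\<lambda>i. M * x (i + 1))"
    using comparableD(3)[OF x] by (intro lq_mono q) auto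
  also have "\<dots> = M * lq q {dlog t + 1..} x"
    by (simp only: lq_cmult[OF q] lq_shift *)
  also note pre = calculation
  have "lq q {dlog t + 1..} x \<le> M * ennreal (2 powr recip q) * wnorm q a {t<..} \<phi>"
    by (rule lq_le_wnorm_comparable) (use assms dlog_less_imp_less in auto)
  from le_mult_trans[OF pre this] show "lq q {dlog t..} x \<le> M * M * ennreal (2 powr recip q) * wnorm q a {t<..} \<phi>"
    by (simp only: mult.assoc)
qed

section \<open>Slowly varying sequences\<close>

abbreviation pw :: "real \<Rightarrow> int \<Rightarrow> int \<Rightarrow> real" where
  "pw s i j \<equiv> 2 powr (s * real_of_int \<bar>i - j\<bar>)"

text \<open>With |i - j| in the exponent, both monotonicity conditions of \<open>SV\<close> become
  one estimate: it bounds growth for i > j and decay for i < j.\<close>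

definition dsv :: "(int \<Rightarrow> real) \<Rightarrow> bool" where
  "dsv w \<longleftrightarrow> (\<forall>k. 0 < w k) \<and>
     (\<forall>\<epsilon>>0. \<exists>C>0. \<forall>i j. w i \<le> C * pw \<epsilon> i j * w j)"

lemma dsv_pos: "dsv w \<Longrightarrow> 0 < w k"
  by (simp add: dsv_def)

lemma dsvE:
  assumes "dsv w" "0 < \<epsilon>"
  obtains C where "0 < C" "\<And>i j. w i \<le> C * pw \<epsilon> i j * w j"
  using assms unfolding dsv_def by meson

lemma dsv_mult:
  assumes "dsv v" "dsv w"
  shows "dsv (\<lambda>k. v k * w k)"
  unfolding dsv_def
proof (intro conjI allI impI)
  show "0 < v k * w k" for k using assms by (simp add: dsv_def)
  fix e :: real assume "0 < e"
  then have e: "0 < e / 2" by simp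
  obtain C where C: "0 < C" "\<And>i j. v i \<le> C * pw (e / 2) i j * v j" using dsvE[OF assms(1) e] by blast
  obtain D where D: "0 < D" "\<And>i j. w i \<le> D * pw (e / 2) i j * w j" using dsvE[OF assms(2) e] by blast
  have "v i * w i \<le> C * D * pw e i j * (v j * w j)" for i j
  proof -
    have "v i * w i \<le> (C * pw (e / 2) i j * v j) * (D * pw (e / 2) i j * w j)"
      using C D assms by (intro mult_mono) (auto simp: dsv_def less_imp_le)
    also have "\<dots> = C * D * (pw (e / 2) i j * pw (e / 2) i j) * (v j * w j)"
      by (simp add: ac_simps)
    also have "pw (e / 2) i j * pw (e / 2) i j = pw e i j"
      by (simp flip: powr_add)
    finally show ?thesis .
  qed
  then show "\<exists>C>0. \<forall>i j. v i * w i \<le> C * pw e i j * (v j * w j)"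
    using C(1) D(1) by (intro exI[of _ "C * D"]) auto
qed

lemma dsv_powr:
  assumes "dsv w"
  shows "dsv (\<lambda>k. w k powr s)"
  unfolding dsv_def
proof (intro conjI allI impI)
  show "0 < w k powr s" for k using dsv_pos[OF assms, of k] by simp
  fix e :: real assume e: "0 < e"
  show "\<exists>C>0. \<forall>i j. w i powr s \<le> C * pw e i j * w j powr s"
  proof (cases "s = 0")
    case True
    then show ?thesis using dsv_pos[OF assms] e
      by (intro exI[of _ 1]) (auto simp: less_imp_neq[symmetric] intro!: ge_one_powr_ge_zero)
  next
    case False
    then have "0 < e / \<bar>s\<bar>" using e by simp
    from dsvE[OF assms this] obtain C where
      C: "0 < C" "\<And>i j. w i \<le> C * pw (e / \<bar>s\<bar>) i j * w j" by blast
    have C1: "w i powr \<bar>s\<bar> \<le> C powr \<bar>s\<bar> * pw e i j * w j powr \<bar>s\<bar>" for i j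
    proof -
      have "w i powr \<bar>s\<bar> \<le> (C * pw (e / \<bar>s\<bar>) i j * w j) powr \<bar>s\<bar>"
        using C dsv_pos[OF assms] by (intro powr_mono2) (auto simp: less_imp_le)
      also have "\<dots> = C powr \<bar>s\<bar> * pw e i j * w j powr \<bar>s\<bar>"
        using C(1) dsv_pos[OF assms, of j] False by (simp add: powr_mult powr_powr)
      finally show ?thesis .
    qed
    show ?thesis
    proof (cases "0 < s")
      case True
      then show ?thesis using C1 C(1) by (intro exI[of _ "C powr s"]) auto
    next
      case F: False
      \<comment> \<open>A negative power reverses the inequality, so the estimate for |s| is used
        with i and j exchanged.\<close>
      have "w i powr s \<le> C powr \<bar>s\<bar> * pw e i j * w j powr s" for i j
      proof -
        have "s = - \<bar>s\<bar>" using F by simp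
        then have "w k powr s = inverse (w k powr \<bar>s\<bar>)" for k by (metis powr_minus)
        moreover have "inverse u \<le> K * inverse v" if "v \<le> K * u" "0 < u" "0 < v" for u v K :: real
          using that by (simp add: field_simps)
        moreover have "0 < w k powr \<bar>s\<bar>" for k using dsv_pos[OF assms, of k] by simp
        ultimately show ?thesis using C1[of j i] by (simp add: abs_minus_commute)
      qed
      then show ?thesis using C(1) by (intro exI[of _ "C powr \<bar>s\<bar>"]) auto
    qed
  qed
qed

lemma dsv_inverse: "dsv w \<Longrightarrow> dsv (\<lambda>k. inverse (w k))"
  using dsv_powr[of w "-1"] dsv_pos[of w] by (simp add: powr_minus less_imp_le)

lemma dsv_divide: "dsv v \<Longrightarrow> dsv w \<Longrightarrow> dsv (\<lambda>k. v k / w k)"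
  using dsv_mult[OF _ dsv_inverse, of v w] by (simp add: divide_inverse)

text \<open>The relative bound carries finiteness from the index \<open>k0\<close> to all others,
  after which passing to reals loses nothing.\<close>

lemma dsv_enn2real:
  assumes pos: "\<And>k. z k \<noteq> 0" and fin: "z k0 < top"
    and le: "\<And>e. 0 < e \<Longrightarrow> \<exists>C. 0 < C \<and> (\<forall>i j. z i \<le> ennreal (C * pw e i j) * z j)"
  shows "z k < top" "dsv (\<lambda>k. enn2real (z k))"
proof -
  have fin': "z k < top" for k
  proof -
    obtain C where "0 < C" "\<And>i j. z i \<le> ennreal (C * pw 1 i j) * z j"
      using le[of 1] by auto
    then have "z k \<le> ennreal (C * 2 powr (1 * real_of_int \<bar>k - k0\<bar>)) * z k0" by blast
    also have "\<dots> < top" using fin by (simp add: ennreal_mult_less_top)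
    finally show ?thesis .
  qed
  then show "z k < top" .
  have pos': "0 < enn2real (z k)" for k
    using pos fin' by (simp add: enn2real_positive_iff zero_less_iff_neq_zero)
  show "dsv (\<lambda>k. enn2real (z k))"
    unfolding dsv_def
  proof (intro conjI allI impI pos')
    fix e :: real assume "0 < e"
    from le[OF this] obtain C where C: "0 < C" "\<And>i j. z i \<le> ennreal (C * pw e i j) * z j" by auto
    have "enn2real (z i) \<le> C * pw e i j * enn2real (z j)" for i j
    proof -
      have "ennreal (enn2real (z i)) \<le> ennreal (C * pw e i j) * ennreal (enn2real (z j))"
        using C(2)[of i j] fin' by simp
      also have "\<dots> = ennreal (C * pw e i j * enn2real (z j))"
        using C(1) by (simp add: ennreal_mult'')
      finally show ?thesis using C(1) by (subst (asm) ennreal_le_iff) auto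
    qed
    then show "\<exists>C>0. \<forall>i j. enn2real (z i) \<le> C * pw e i j * enn2real (z j)"
      using C(1) by blast
  qed
qed

lemma dsv_ennreal_shift:
  assumes "0 < C" "\<And>i j. w i \<le> C * pw e i j * w j" "\<And>i. 0 < w i"
  shows "ennreal (w i) \<le> ennreal (C * 2 powr (e * real_of_int \<bar>m\<bar>)) * ennreal (w (i + m))"
proof -
  have "ennreal (w i) \<le> ennreal (C * 2 powr (e * real_of_int \<bar>m\<bar>) * w (i + m))"
    using assms(2)[of i "i + m"] by (intro ennreal_leI) simp
  then show ?thesis using assms by (simp add: ennreal_mult less_imp_le)
qed

lemma image_add_atMost_int: "(\<lambda>i. i + m) ` {..k::int} = {..k + m}"
  by (auto simp: image_iff intro!: bexI[of _ "_ - m"])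

text \<open>Translation by j - i maps {..i} onto {..j} and changes each term by at most a factor C
  2^(e|i-j|), so partial norms inherit the estimate with the same constant.\<close>

lemma dsv_lq_atMost:
  assumes q: "0 < q" and b: "dsv b" and fin: "lq q {..k0} (\<lambda>i. ennreal (b i)) < top"
  shows "lq q {..k} (\<lambda>i. ennreal (b i)) < top" "dsv (\<lambda>k. enn2real (lq q {..k} (\<lambda>i. ennreal (b i))))"
proof -
  have "\<exists>C. 0 < C \<and> (\<forall>i j. lq q {..i} (\<lambda>i. ennreal (b i)) \<le> ennreal (C * pw e i j) * lq q {..j} (\<lambda>i. ennreal (b i)))"
    if e: "0 < e" for e
  proof -
    from dsvE[OF b e] obtain C where C: "0 < C" "\<And>i j. b i \<le> C * pw e i j * b j" by blast
    have "lq q {..i} (\<lambda>i. ennreal (b i)) \<le> ennreal (C * pw e i j) * lq q {..j} (\<lambda>i. ennreal (b i))" for i j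
    proof -
      have "lq q {..i} (\<lambda>i. ennreal (b i)) \<le> lq q {..i} (\<lambda>k. ennreal (C * pw e j i) * ennreal (b (k + (j - i))))"
        by (intro lq_mono q order_refl dsv_ennreal_shift[OF C dsv_pos[OF b]])
      also have "\<dots> = ennreal (C * pw e i j) * lq q {..j} (\<lambda>i. ennreal (b i))"
        by (simp add: lq_cmult[OF q] lq_shift[where F="\<lambda>k. ennreal (b k)"] image_add_atMost_int abs_minus_commute)
      finally show ?thesis .
    qed
    then show ?thesis using C(1) by blast
  qed
  moreover have "lq q {..k} (\<lambda>i. ennreal (b i)) \<noteq> 0" for k
    using lq_upper[OF q, of k "{..k}" "\<lambda>i. ennreal (b i)"] dsv_pos[OF b, of k] by auto
  ultimately show "lq q {..k} (\<lambda>i. ennreal (b i)) < top" "dsv (\<lambda>k. enn2real (lq q {..k} (\<lambda>i. ennreal (b i))))"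
    using fin by (auto intro: dsv_enn2real[of "\<lambda>k. lq q {..k} (\<lambda>i. ennreal (b i))"])
qed

text \<open>Keeping only the inner term i = k decouples the double norm. This is the source of
  \<open>N0_lower\<close> and of \<open>B1a1_le\<close>.\<close>

lemma DN_lower_bound:
  assumes "0 < r" "0 < q"
  shows "lq r {..k} y * x k \<le> DN r q {..k} y x"
  unfolding DN_def lq_cmult_right[OF assms(1), symmetric]
  using assms by (intro lq_mono) (auto intro!: mult_left_mono lq_upper)

lemma dsv_DN_atMost:
  assumes rq: "0 < r" "0 < q" and b: "dsv b" and a: "dsv a"
    and fin: "DN r q {..k0} (\<lambda>i. ennreal (b i)) (\<lambda>i. ennreal (a i)) < top"
  shows "DN r q {..k} (\<lambda>i. ennreal (b i)) (\<lambda>i. ennreal (a i)) < top"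
    "dsv (\<lambda>k. enn2real (DN r q {..k} (\<lambda>i. ennreal (b i)) (\<lambda>i. ennreal (a i))))"
proof -
  let ?z = "\<lambda>k. DN r q {..k} (\<lambda>i. ennreal (b i)) (\<lambda>i. ennreal (a i))"
  have "\<exists>C. 0 < C \<and> (\<forall>i j. ?z i \<le> ennreal (C * pw e i j) * ?z j)"
    if "0 < e" for e
  proof -
    from that have e: "0 < e / 2" by simp
    from dsvE[OF b e] obtain C where C: "0 < C" "\<And>i j. b i \<le> C * pw (e / 2) i j * b j" by blast
    from dsvE[OF a e] obtain D where D: "0 < D" "\<And>i j. a i \<le> D * pw (e / 2) i j * a j" by blast
    have "?z i \<le> ennreal (C * D * pw e i j) * ?z j" for i j
    proof -
      have "?z i \<le> ennreal (C * pw (e / 2) j i) * ennreal (D * pw (e / 2) j i) *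
          DN r q ((\<lambda>k. k + (j - i)) ` {..i}) (\<lambda>i. ennreal (b i)) (\<lambda>i. ennreal (a i))"
        using dsv_ennreal_shift[OF C dsv_pos[OF b]] dsv_ennreal_shift[OF D dsv_pos[OF a]]
        by (intro DN_shift rq) 
      also have "ennreal (C * pw (e / 2) j i) * ennreal (D * pw (e / 2) j i)
         = ennreal (C * D * pw e i j)"
      proof -
        have "pw (e / 2) i j * pw (e / 2) i j = pw e i j"
          by (simp flip: powr_add)
        then show ?thesis using C(1) D(1) by (simp flip: ennreal_mult add: abs_minus_commute[of j i] ac_simps)
      qed
      finally show ?thesis by (simp add: image_add_atMost_int)
    qed
    then show ?thesis using C(1) D(1) by (intro exI[of _ "C * D"]) auto
  qed
  moreover have "?z k \<noteq> 0" for k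
  proof -
    have "0 < ennreal (b k) * ennreal (a k)"
      using dsv_pos[OF b, of k] dsv_pos[OF a, of k] by (simp flip: ennreal_mult'')
    also have "\<dots> \<le> lq r {..k} (\<lambda>i. ennreal (b i)) * ennreal (a k)"
      by (intro mult_right_mono lq_upper rq) auto
    also have "\<dots> \<le> ?z k" by (rule DN_lower_bound[OF rq])
    finally show ?thesis by simp
  qed
  ultimately show "?z k < top" "dsv (\<lambda>k. enn2real (?z k))"
    using fin by (auto intro: dsv_enn2real[of ?z])
qed

subsection \<open>Sampling slowly varying functions\<close>

lemma SV_pos: "b \<in> SV \<Longrightarrow> 0 < t \<Longrightarrow> 0 < b t"
  by (simp add: SV_def)

lemma SV_growth:
  assumes b: "b \<in> SV" and e: "0 < e"
  shows "\<exists>C>0. \<forall>s>0. \<forall>t>0. b s \<le> C * max (s / t) (t / s) powr e * b t"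
proof -
  obtain g where g: "mono_on {0<..} g" "equivalent_on_pos (\<lambda>t. t powr e * b t) g"
    using b e unfolding SV_def by blast
  obtain h where h: "antimono_on {0<..} h" "equivalent_on_pos (\<lambda>t. t powr (- e) * b t) h"
    using b e unfolding SV_def by blast
  obtain C where C: "0 < C" "\<And>t. 0 < t \<Longrightarrow> inverse C * g t \<le> t powr e * b t \<and> t powr e * b t \<le> C * g t"
    using g(2) unfolding equivalent_on_pos_def by blast
  obtain D where D: "0 < D" "\<And>t. 0 < t \<Longrightarrow> inverse D * h t \<le> t powr (- e) * b t \<and> t powr (- e) * b t \<le> D * h t"
    using h(2) unfolding equivalent_on_pos_def by blast
  have up: "b s \<le> C * C * (t / s) powr e * b t" if "0 < s" "s \<le> t" for s t
  proof -
    have t: "0 < t" using that by simp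
    have "s powr e * b s \<le> C * g s" using C that by blast
    also have "\<dots> \<le> C * g t" using that t C(1) monotone_onD[OF g(1), of s t] by simp
    also have "\<dots> \<le> C * (C * (t powr e * b t))" using C(1) C(2)[OF t] by (simp add: field_simps)
    finally show ?thesis using that by (simp add: powr_divide field_simps)
  qed
  have down: "b s \<le> D * D * (s / t) powr e * b t" if "0 < t" "t \<le> s" for s t
  proof -
    have s: "0 < s" using that by simp
    have "s powr (- e) * b s \<le> D * h s" using D s by blast
    also have "\<dots> \<le> D * h t" using that s D(1) monotone_onD[OF h(1), of t s] by simp
    also have "\<dots> \<le> D * (D * (t powr (- e) * b t))" using D(1) D(2)[OF that(1)] by (simp add: field_simps)
    finally show ?thesis using that s by (simp add: powr_divide powr_minus field_simps)
  qed
  show ?thesis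
  proof (intro exI[of _ "C * C + D * D"] conjI allI impI)
    show "0 < C * C + D * D" using C(1) D(1) by (simp add: add_pos_pos)
    fix s t :: real assume st: "0 < s" "0 < t"
    have p: "0 \<le> X powr e * b t" for X using SV_pos[OF b st(2)] by simp
    show "b s \<le> (C * C + D * D) * max (s / t) (t / s) powr e * b t"
    proof (cases "s \<le> t")
      case True
      have "b s \<le> C * C * (t / s) powr e * b t" by (rule up[OF st(1) True])
      also have "\<dots> \<le> (C * C + D * D) * (t / s) powr e * b t"
        using mult_right_mono[OF _ p[of "t / s"], of "C * C" "C * C + D * D"] by (simp add: mult.assoc)
      also have "t / s = max (s / t) (t / s)" using st True by (simp add: max_def field_simps mult_mono)
      finally show ?thesis .
    next
      case False
      then have "t \<le> s" by simp
      have "b s \<le> D * D * (s / t) powr e * b t" by (rule down[OF st(2) \<open>t \<le> s\<close>])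
      also have "\<dots> \<le> (C * C + D * D) * (s / t) powr e * b t"
        using mult_right_mono[OF _ p[of "s / t"], of "D * D" "C * C + D * D"] by (simp add: mult.assoc)
      also have "s / t = max (s / t) (t / s)"
      proof -
        have "t / s \<le> 1" "1 \<le> s / t" using st \<open>t \<le> s\<close> by auto
        then show ?thesis by simp
      qed
      finally show ?thesis .
    qed
  qed
qed

text \<open>When \<rho> varies at most at the exponential rate N, the rate e/N for b becomes e after
  composition.\<close>

lemma SV_compose_growth:
  assumes b: "b \<in> SV" and e: "0 < e" and N: "0 < N"
    and \<rho>: "\<And>i. 0 < \<rho> i" "0 < C0" "\<And>i j. \<rho> i \<le> C0 * pw N i j * \<rho> j"
  shows "\<exists>C>0. \<forall>i j. b (\<rho> i) \<le> C * pw e i j * b (\<rho> j)"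
proof -
  have "0 < e / N" using e N by simp
  from SV_growth[OF b this] obtain C where C: "0 < C"
    "\<And>s t. 0 < s \<Longrightarrow> 0 < t \<Longrightarrow> b s \<le> C * max (s / t) (t / s) powr (e / N) * b t" by blast
  have "b (\<rho> i) \<le> (C * C0 powr (e / N)) * pw e i j * b (\<rho> j)" for i j
  proof -
    have "\<rho> i / \<rho> j \<le> C0 * pw N i j"
      using \<rho>(3)[of i j] \<rho>(1)[of j] by (simp add: field_simps)
    moreover have "\<rho> j / \<rho> i \<le> C0 * pw N i j"
      using \<rho>(3)[of j i] \<rho>(1)[of i] by (simp add: field_simps abs_minus_commute)
    ultimately have m: "max (\<rho> i / \<rho> j) (\<rho> j / \<rho> i) \<le> C0 * pw N i j" by simp
    have "b (\<rho> i) \<le> C * max (\<rho> i / \<rho> j) (\<rho> j / \<rho> i) powr (e / N) * b (\<rho> j)"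
      by (rule C(2)[OF \<rho>(1) \<rho>(1)])
    also have "\<dots> \<le> C * (C0 * pw N i j) powr (e / N) * b (\<rho> j)"
      using C(1) e N m \<rho>(1) SV_pos[OF b \<rho>(1)]
      by (intro mult_right_mono mult_left_mono powr_mono2) (auto simp: less_imp_le le_max_iff_disj)
    also have "\<dots> = (C * C0 powr (e / N)) * pw e i j * b (\<rho> j)"
      using N \<rho>(2) by (simp add: powr_mult powr_powr mult.commute[of e])
    finally show ?thesis .
  qed
  then show ?thesis using C(1) \<rho>(2) by (intro exI[of _ "C * C0 powr (e / N)"]) auto
qed

lemma dsv_SV_compose:
  assumes b: "b \<in> SV" and N: "0 < N"
    and \<rho>: "\<And>i. 0 < \<rho> i" "0 < C0" "\<And>i j. \<rho> i \<le> C0 * pw N i j * \<rho> j"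
  shows "dsv (\<lambda>k. b (\<rho> k))"
  unfolding dsv_def using SV_compose_growth[OF b _ N \<rho>] SV_pos[OF b \<rho>(1)] by auto

lemma dsv_SV:
  assumes "b \<in> SV"
  shows "dsv (\<lambda>k. b (dyad k))"
  by (rule dsv_SV_compose[OF assms, of 1 _ 1]) (auto simp flip: powr_add)

text \<open>Both t and 2^(dlog t), and 2^i and 2^(i+1), are within a factor 2 of each other, so one
  doubling estimate gives every condition of \<open>comparable\<close>.\<close>

lemma comparableI:
  assumes C: "0 < C" and pos: "\<And>t. 0 < t \<Longrightarrow> 0 \<le> g t"
    and le: "\<And>s t. 0 < s \<Longrightarrow> 0 < t \<Longrightarrow> s \<le> 2 * t \<Longrightarrow> t \<le> 2 * s \<Longrightarrow> g s \<le> C * g t"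
  shows "comparable (ennreal (max 1 C)) (\<lambda>t. ennreal (g t)) (\<lambda>k. ennreal (g (dyad k)))"
proof -
  have *: "ennreal (g s) \<le> ennreal (max 1 C) * ennreal (g t)"
    if st: "0 < s" "0 < t" "s \<le> 2 * t" "t \<le> 2 * s" for s t
  proof -
    have "g s \<le> C * g t" by (rule le[OF st])
    also have "\<dots> \<le> max 1 C * g t" using pos[OF st(2)] by (intro mult_right_mono) auto
    finally show ?thesis using pos[OF st(2)] by (simp flip: ennreal_mult'')
  qed
  have d: "dyad (i + 1) = 2 * dyad i" for i by (simp add: powr_add)
  show ?thesis unfolding comparable_def
  proof (intro conjI allI impI)
    fix t :: real assume t: "0 < t"
    note b = dlog_lower[OF t] dlog_upper[OF t]
    show "ennreal (g t) \<le> ennreal (max 1 C) * ennreal (g (dyad (dlog t)))"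
      "ennreal (g (dyad (dlog t))) \<le> ennreal (max 1 C) * ennreal (g t)"
      using t b by (auto intro!: *)
  next
    fix i :: int
    have "0 < dyad i" by simp
    then show "ennreal (g (dyad i)) \<le> ennreal (max 1 C) * ennreal (g (dyad (i + 1)))"
      "ennreal (g (dyad (i + 1))) \<le> ennreal (max 1 C) * ennreal (g (dyad i))"
      unfolding d by (auto intro!: *)
  qed (auto simp: ennreal_le_1 simp flip: ennreal_1)
qed

lemma comparable_SV:
  assumes b: "b \<in> SV"
  shows "\<exists>M. comparable M (\<lambda>t. ennreal (b t)) (\<lambda>k. ennreal (b (dyad k)))"
proof -
  from SV_growth[OF b, of 1] obtain C where C: "0 < C"
    "\<And>s t. 0 < s \<Longrightarrow> 0 < t \<Longrightarrow> b s \<le> C * max (s / t) (t / s) powr 1 * b t" by auto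
  have "b s \<le> C * 2 * b t" if st: "0 < s" "0 < t" "s \<le> 2 * t" "t \<le> 2 * s" for s t
  proof -
    have "max (s / t) (t / s) \<le> 2" using st by (simp add: field_simps)
    then have "max (s / t) (t / s) powr 1 \<le> 2" using st by (simp add: le_max_iff_disj)
    then have "C * max (s / t) (t / s) powr 1 * b t \<le> C * 2 * b t"
      using C(1) SV_pos[OF b st(2)] by (intro mult_right_mono mult_left_mono) auto
    then show ?thesis using C(2)[OF st(1,2)] by linarith
  qed
  then have "comparable (ennreal (max 1 (C * 2))) (\<lambda>t. ennreal (b t)) (\<lambda>k. ennreal (b (dyad k)))"
    using C(1) SV_pos[OF b] by (intro comparableI) (auto simp: less_imp_le)
  then show ?thesis ..
qed

section \<open>Geometric sums and the envelope\<close>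

lemma ennreal_decay_le_one:
  assumes "0 < \<delta>"
  shows "ennreal (2 powr (- \<delta> * real_of_int \<bar>i\<bar>)) \<le> 1"
  using assms powr_mono[of "- \<delta> * real_of_int \<bar>i\<bar>" 0 2] by (simp add: ennreal_le_1)

definition geo :: "ennreal \<Rightarrow> real \<Rightarrow> ennreal" where
  "geo q \<delta> = lq q UNIV (\<lambda>i. ennreal (2 powr (- \<delta> * real_of_int \<bar>i\<bar>)))"

lemma nn_integral_geometric_finite:
  fixes x :: real
  assumes x: "0 < x" "x < 1"
  shows "(\<integral>\<^sup>+i. ennreal (x powr real_of_int \<bar>i\<bar>) \<partial>count_space UNIV) < top"
proof -
  let ?f = "\<lambda>i::int. ennreal (x powr real_of_int \<bar>i\<bar>)"
  have sum: "(\<integral>\<^sup>+n. ennreal (x ^ n) \<partial>count_space (UNIV::nat set)) < top"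
  proof -
    have "summable (\<lambda>n. x ^ n)" using x by (intro summable_geometric) simp
    then show ?thesis using x by (simp add: nn_integral_count_space_nat suminf_ennreal2)
  qed
  have b1: "bij_betw int UNIV {0..}" by (intro bij_betwI[where g=nat]) auto
  have b2: "bij_betw (\<lambda>n. - int n) UNIV {..0}" by (intro bij_betwI[where g="\<lambda>i. nat (- i)"]) auto
  have p: "(\<integral>\<^sup>+i\<in>{0..}. ?f i \<partial>count_space UNIV) < top"
  proof -
    have "(\<integral>\<^sup>+i\<in>{0..}. ?f i \<partial>count_space UNIV) = (\<integral>\<^sup>+i. ?f i \<partial>count_space {0..})"
      by (simp add: nn_integral_count_space_indicator)
    also have "\<dots> = (\<integral>\<^sup>+n. ennreal (x ^ n) \<partial>count_space (UNIV::nat set))"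
      using x by (subst nn_integral_bij_count_space[OF b1, symmetric]) (simp add: powr_realpow)
    finally show ?thesis using sum by simp
  qed
  have n: "(\<integral>\<^sup>+i\<in>{..0}. ?f i \<partial>count_space UNIV) < top"
  proof -
    have "(\<integral>\<^sup>+i\<in>{..0}. ?f i \<partial>count_space UNIV) = (\<integral>\<^sup>+i. ?f i \<partial>count_space {..0})"
      by (simp add: nn_integral_count_space_indicator)
    also have "\<dots> = (\<integral>\<^sup>+n. ennreal (x ^ n) \<partial>count_space (UNIV::nat set))"
      using x by (subst nn_integral_bij_count_space[OF b2, symmetric]) (simp add: powr_realpow)
    finally show ?thesis using sum by simp
  qed
  have "(\<integral>\<^sup>+i. ?f i \<partial>count_space UNIV) \<le> (\<integral>\<^sup>+i. ?f i * indicator {0..} i + ?f i * indicator {..0} i \<partial>count_space UNIV)"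
    by (intro nn_integral_mono) (auto split: split_indicator)
  also have "\<dots> = (\<integral>\<^sup>+i\<in>{0..}. ?f i \<partial>count_space UNIV) + (\<integral>\<^sup>+i\<in>{..0}. ?f i \<partial>count_space UNIV)"
    by (rule nn_integral_add) auto
  also have "\<dots> < top" using p n by simp
  finally show ?thesis .
qed

lemma geo_less_top:
  assumes "0 < q" "0 < \<delta>"
  shows "geo q \<delta> < top"
proof (cases "q = \<infinity>")
  case True
  have "geo q \<delta> \<le> 1"
    unfolding geo_def lq_def using True by (simp only: if_True simp_thms) (intro SUP_least ennreal_decay_le_one assms)
  then show ?thesis by (rule le_less_trans) simp
next
  case False
  define p where "p = enn2real q"
  have p: "0 < p" using recip_finite[OF assms(1) False] by (auto simp: p_def)
  have "(2 powr (- \<delta> * real_of_int \<bar>i\<bar>)) powr p = (2 powr (- \<delta> * p)) powr real_of_int \<bar>i\<bar>" for i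
    by (simp add: powr_powr ac_simps)
  then have "geo q \<delta> = ennpowr (\<integral>\<^sup>+i. ennreal ((2 powr (- \<delta> * p)) powr real_of_int \<bar>i\<bar>) \<partial>count_space UNIV) (recip q)"
    using False by (simp only: geo_def lq_def p_def[symmetric] ennpowr_ennreal powr_ge_zero) simp
  also have "\<dots> < top"
    using assms p by (intro ennpowr_less_top nn_integral_geometric_finite) (auto simp: powr_less_one)
  finally show ?thesis .
qed

lemma lq_geo_shift:
  shows "lq q UNIV (\<lambda>i. ennreal (pw (- \<delta>) i k)) = geo q \<delta>"
proof -
  have "surj (\<lambda>i. i + - k)" by (rule surjI[of _ "\<lambda>i. i + k"]) simp
  then show ?thesis
    using lq_shift[of q UNIV "\<lambda>i. ennreal (2 powr (- \<delta> * real_of_int \<bar>i\<bar>))" "- k"]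
    by (simp add: geo_def)
qed

lemma lq_geo_le:
  assumes "0 < q" "\<And>i. i \<in> S \<Longrightarrow> F i \<le> ennreal (pw (- \<delta>) i k) * v"
  shows "lq q S F \<le> geo q \<delta> * v"
proof -
  have "lq q S F \<le> lq q UNIV (\<lambda>i. ennreal (pw (- \<delta>) i k) * v)"
    using assms by (intro lq_mono) auto
  then show ?thesis by (simp only: lq_cmult_right[OF assms(1)] lq_geo_shift)
qed

text \<open>The envelope dominates \<open>D\<close>, has a comparable sequence norm, and grows at most at rate
  \<open>\<delta>\<close>. Bounding \<open>D\<close> by its envelope and summing geometric series replaces the weighted
  Hardy inequalities, uniformly in all exponents, including those below 1.\<close>

definition env :: "real \<Rightarrow> (int \<Rightarrow> ennreal) \<Rightarrow> int \<Rightarrow> ennreal" where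
  "env \<delta> D i = (SUP l. ennreal (pw (- \<delta>) i l) * D l)"

lemma le_env: "D i \<le> env \<delta> D i"
  unfolding env_def by (rule SUP_upper2[of i]) auto

lemma env_regular:
  assumes "0 < \<delta>"
  shows "env \<delta> D i \<le> ennreal (pw \<delta> i j) * env \<delta> D j"
  unfolding env_def
proof (rule SUP_least)
  fix l
  have "real_of_int \<bar>j - l\<bar> \<le> real_of_int \<bar>i - j\<bar> + real_of_int \<bar>i - l\<bar>" by linarith
  then have "- \<delta> * real_of_int \<bar>i - l\<bar> \<le> \<delta> * real_of_int \<bar>i - j\<bar> + - \<delta> * real_of_int \<bar>j - l\<bar>"
    using mult_left_mono[of _ _ \<delta>] assms by (fastforce simp: ring_distribs)
  then have "pw (- \<delta>) i l \<le> pw \<delta> i j * pw (- \<delta>) j l"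
    by (simp flip: powr_add)
  then have "ennreal (pw (- \<delta>) i l) * D l
     \<le> ennreal (pw \<delta> i j * pw (- \<delta>) j l) * D l"
    by (intro mult_right_mono ennreal_leI) auto
  also have "\<dots> = ennreal (pw \<delta> i j) * (ennreal (pw (- \<delta>) j l) * D l)"
    by (simp add: ennreal_mult mult.assoc)
  also have "\<dots> \<le> ennreal (pw \<delta> i j) * (SUP l. ennreal (pw (- \<delta>) j l) * D l)"
    by (intro mult_left_mono SUP_upper) auto
  finally show "ennreal (pw (- \<delta>) i l) * D l
     \<le> ennreal (pw \<delta> i j) * (SUP l. ennreal (pw (- \<delta>) j l) * D l)" .
qed

text \<open>For finite r the supremum over l is at most the sequence norm over l; p-th powers then
  make the estimate a convolution, summed by Tonelli for any p > 0. The summand 1 in the constant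
  serves r = \<infinity>, where the kernel is at most 1.\<close>

lemma lq_env_le:
  assumes r: "0 < r" and d: "0 < \<delta>"
  shows "lq r UNIV (env \<delta> D) \<le> (1 + geo r \<delta>) * lq r UNIV D"
proof (cases "r = \<infinity>")
  case True
  have "env \<delta> D i \<le> lq r UNIV D" for i
    unfolding env_def
  proof (rule SUP_least)
    fix l
    have "ennreal (pw (- \<delta>) i l) * D l \<le> 1 * lq r UNIV D"
      by (intro mult_mono lq_upper r ennreal_decay_le_one d) auto
    then show "ennreal (pw (- \<delta>) i l) * D l \<le> lq r UNIV D" by simp
  qed
  then have "lq r UNIV (env \<delta> D) \<le> lq r UNIV D" unfolding lq_def[of r _ "env \<delta> D"] using True by (simp add: SUP_least)
  also have "\<dots> \<le> (1 + geo r \<delta>) * lq r UNIV D" by (simp add: distrib_right)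
  finally show ?thesis .
next
  case False
  define p where "p = enn2real r"
  have p: "0 < p" "recip r = 1 / p" using recip_finite[OF r False] by (auto simp: p_def)
  define w where "w i l = ennpowr (ennreal (pw (- \<delta>) i l)) p" for i l
  have "ennpowr (env \<delta> D i) p \<le> (\<integral>\<^sup>+l. w i l * ennpowr (D l) p \<partial>count_space UNIV)" for i
  proof -
    have "env \<delta> D i \<le> lq r UNIV (\<lambda>l. ennreal (pw (- \<delta>) i l) * D l)"
      unfolding env_def by (intro SUP_least) (rule lq_upper[OF r], simp)
    then have "ennpowr (env \<delta> D i) p \<le> ennpowr (lq r UNIV (\<lambda>l. ennreal (pw (- \<delta>) i l) * D l)) p"
      by (rule ennpowr_mono[OF p(1)])
    also have "\<dots> = (\<integral>\<^sup>+l. w i l * ennpowr (D l) p \<partial>count_space UNIV)"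
      using False p by (simp add: lq_def p_def[symmetric] ennpowr_ennpowr ennpowr_mult w_def)
    finally show ?thesis .
  qed
  then have "(\<integral>\<^sup>+i. ennpowr (env \<delta> D i) p \<partial>count_space UNIV)
     \<le> (\<integral>\<^sup>+i. (\<integral>\<^sup>+l. w i l * ennpowr (D l) p \<partial>count_space UNIV) \<partial>count_space UNIV)"
    by (intro nn_integral_mono)
  also have "\<dots> = (\<integral>\<^sup>+l. (\<integral>\<^sup>+i. w i l * ennpowr (D l) p \<partial>count_space UNIV) \<partial>count_space UNIV)"
    by (rule nn_integral_count_space_nn_integral) auto
  also have "\<dots> = (\<integral>\<^sup>+l. ennpowr (geo r \<delta>) p * ennpowr (D l) p \<partial>count_space UNIV)"
  proof (intro nn_integral_cong)
    fix l
    have "ennpowr (geo r \<delta>) p = (\<integral>\<^sup>+i. w i l \<partial>count_space UNIV)"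
      unfolding lq_geo_shift[of r \<delta> l, symmetric] w_def
      using False p by (simp add: lq_def p_def[symmetric] ennpowr_ennpowr)
    then show "(\<integral>\<^sup>+i. w i l * ennpowr (D l) p \<partial>count_space UNIV) = ennpowr (geo r \<delta>) p * ennpowr (D l) p"
      by (simp add: nn_integral_multc)
  qed
  also have "\<dots> = ennpowr (geo r \<delta>) p * (\<integral>\<^sup>+l. ennpowr (D l) p \<partial>count_space UNIV)"
    by (simp add: nn_integral_cmult)
  finally have "lq r UNIV (env \<delta> D) \<le> ennpowr (ennpowr (geo r \<delta>) p * (\<integral>\<^sup>+l. ennpowr (D l) p \<partial>count_space UNIV)) (1 / p)"
    using False p by (simp add: lq_def p_def[symmetric] ennpowr_mono)
  also have "\<dots> = geo r \<delta> * lq r UNIV D"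
    using False p by (simp add: lq_def p_def[symmetric] ennpowr_ennpowr ennpowr_mult)
  also have "\<dots> \<le> (1 + geo r \<delta>) * lq r UNIV D" by (simp add: distrib_right)
  finally show ?thesis .
qed

section \<open>Change of variables\<close>

lemma finite_card_int_diam:
  fixes A :: "int set"
  assumes "\<And>x y. x \<in> A \<Longrightarrow> y \<in> A \<Longrightarrow> \<bar>x - y\<bar> \<le> int L"
  shows "finite A \<and> card A \<le> 2 * L + 1"
proof (cases "A = {}")
  case False
  then obtain a where "a \<in> A" by blast
  then have "A \<subseteq> {a - int L..a + int L}" using assms[of _ a] by force
  moreover have "card {a - int L..a + int L} = 2 * L + 1" by simp
  ultimately show ?thesis by (metis card_mono finite_atLeastAtMost_int finite_subset)
qed simp

lemma int_transition:
  fixes P :: "int \<Rightarrow> bool"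
  assumes "P k1" "\<not> P k2" "k1 \<le> k2"
  shows "\<exists>k. P k \<and> \<not> P (k + 1)"
proof (rule ccontr)
  assume *: "\<not> ?thesis"
  have "P k2" using assms(3)
    by (induction rule: int_ge_induct) (use assms(1) * in auto)
  then show False using assms(2) by simp
qed

text \<open>The factor \<open>C\<close> lets \<rho> decrease locally. The condition
  \<open>step\<close> limits upward jumps, which makes \<rho> onto up to boundedly many dyadic
  blocks.\<close>

locale growing =
  fixes \<rho> :: "int \<Rightarrow> real" and C \<gamma> D N :: real
  assumes pos: "0 < \<rho> k" and C: "1 \<le> C" "0 < \<gamma>" and D: "1 \<le> D" 
    and growth: "i \<le> j \<Longrightarrow> \<rho> i \<le> C * 2 powr (- \<gamma> * real_of_int (j - i)) * \<rho> j"
    and step: "\<rho> (k + 1) \<le> D * \<rho> k"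
begin

text \<open>Two values in one dyadic block differ by a factor below 2, so geometric growth keeps
  their indices within log_2(2C)/\<gamma> of each other.\<close>

lemma fibres: "\<exists>L. \<forall>j. finite {k. dlog (\<rho> k) = j} \<and> card {k. dlog (\<rho> k) = j} \<le> L"
proof -
  define L where "L = nat \<lceil>log 2 (2 * C) / \<gamma>\<rceil>"
  have *: "j - i \<le> int L" if "i \<le> j" "dlog (\<rho> i) = dlog (\<rho> j)" for i j
  proof -
    have "\<rho> j < 2 * \<rho> i"
      using dlog_upper[OF pos, of j] dlog_lower[OF pos, of i] that by simp
    also have "\<dots> \<le> 2 * (C * 2 powr (- \<gamma> * real_of_int (j - i)) * \<rho> j)"
      using growth[OF that(1)] by simp
    finally have "1 < 2 * C * 2 powr (- \<gamma> * real_of_int (j - i))"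
      using pos[of j] by simp
    moreover have "2 powr u \<le> 2 * C" if "1 < 2 * C * 2 powr (- u)" for u
      using that by (simp add: powr_minus field_simps)
    ultimately have "2 powr (\<gamma> * real_of_int (j - i)) \<le> 2 * C" by simp
    then have "\<gamma> * real_of_int (j - i) \<le> log 2 (2 * C)"
      using C by (subst le_log_iff) auto
    then have "real_of_int (j - i) \<le> log 2 (2 * C) / \<gamma>" using C by (simp add: field_simps)
    then show ?thesis unfolding L_def by linarith
  qed
  have "\<bar>x - y\<bar> \<le> int L" if "dlog (\<rho> x) = j" "dlog (\<rho> y) = j" for x y j
    using *[of x y] *[of y x] that by (cases "x \<le> y") auto
  then show ?thesis by (intro exI[of _ "2 * L + 1"] allI finite_card_int_diam) auto
qed

lemma small_index: "\<exists>k. \<rho> k \<le> dyad m"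
proof -
  define n where "n = nat \<lceil>(log 2 (C * \<rho> 0) - m) / \<gamma>\<rceil>"
  have "(log 2 (C * \<rho> 0) - m) / \<gamma> \<le> real n" unfolding n_def by linarith
  then have n: "log 2 (C * \<rho> 0) \<le> m + \<gamma> * real n" using C by (simp add: field_simps)
  have "C * \<rho> 0 = 2 powr log 2 (C * \<rho> 0)" using C pos[of 0] by simp
  also have "\<dots> \<le> 2 powr (m + \<gamma> * real n)" using n by simp
  finally have *: "C * \<rho> 0 \<le> dyad m * 2 powr (\<gamma> * real n)" by (simp add: powr_add)
  have "\<rho> (- int n) \<le> C * 2 powr (- \<gamma> * real n) * \<rho> 0"
    using growth[of "- int n" 0] by simp
  also have "\<dots> \<le> dyad m" using * by (simp add: powr_minus field_simps)
  finally show ?thesis ..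
qed

text \<open>All l >= k are covered because \<rho> need not be monotone: every index with a small
  value is then forced to lie before k.\<close>

lemma large_index: "\<exists>k. \<forall>l\<ge>k. dyad m < \<rho> l"
proof -
  define n where "n = nat (\<lceil>(log 2 (C / \<rho> 0) + m) / \<gamma>\<rceil> + 1)"
  have l: "dyad m < \<rho> l" if "int n \<le> l" for l
  proof -
    have "0 \<le> l" using that by simp
    have "(log 2 (C / \<rho> 0) + m) / \<gamma> < real_of_int l" using that unfolding n_def by linarith
    then have n: "log 2 (C / \<rho> 0) + m < \<gamma> * real_of_int l" using C by (simp add: field_simps)
    have "C / \<rho> 0 * dyad m = 2 powr (log 2 (C / \<rho> 0) + m)" using C pos[of 0] by (simp add: powr_add)
    also have "\<dots> < 2 powr (\<gamma> * real_of_int l)" using n by simp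
    finally have *: "C * dyad m < \<rho> 0 * 2 powr (\<gamma> * real_of_int l)" using pos[of 0] by (simp add: field_simps)
    have "\<rho> 0 \<le> C * 2 powr (- \<gamma> * real_of_int l) * \<rho> l"
      using growth[of 0 l] \<open>0 \<le> l\<close> by simp
    then have "\<rho> 0 * 2 powr (\<gamma> * real_of_int l) \<le> C * \<rho> l" by (simp add: powr_minus field_simps)
    with * have "C * dyad m < C * \<rho> l" by linarith
    then show ?thesis using C by simp
  qed
  then show ?thesis by blast
qed

text \<open>Since \<open>\<rho>\<close> need be neither monotone nor onto, its inverse is replaced by a map \<open>\<psi>\<close>
  that is correct up to \<open>L\<close> dyadic steps.\<close>

lemma rough_inverse: "\<exists>L \<psi>. (\<forall>m. \<bar>dlog (\<rho> (\<psi> m)) - m\<bar> \<le> int L) \<and>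
    (\<forall>j. finite {m. \<psi> m = j} \<and> card {m. \<psi> m = j} \<le> 2 * (2 * L) + 1)"
proof -
  define L where "L = nat (\<lceil>log 2 D\<rceil> + 1)"
  have "\<exists>k. \<bar>dlog (\<rho> k) - m\<bar> \<le> int L" for m
  proof -
    obtain k1 where k1: "\<rho> k1 \<le> dyad m" using small_index by blast
    obtain k2 where k2: "\<And>l. k2 \<le> l \<Longrightarrow> dyad m < \<rho> l" using large_index by blast
    have "k1 \<le> k2" using k1 k2[of k1] by linarith
    \<comment> \<open>At a transition the value is at most 2^m and the next one exceeds it; by
      \<open>step\<close> the former is within a factor D of 2^m.\<close>
    with int_transition[of "\<lambda>k. \<rho> k \<le> dyad m" k1 k2] k1 k2[of k2]
    obtain k where k: "\<rho> k \<le> dyad m" "dyad m < \<rho> (k + 1)" by auto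
    have "dlog (\<rho> k) \<le> m" using dlog_mono[OF pos k(1)] by simp
    moreover have "m - int L \<le> dlog (\<rho> k)"
    proof -
      have "log 2 D \<le> int L" unfolding L_def by linarith
      then have "D \<le> dyad (int L)" using D by (subst (asm) log_le_iff) auto
      moreover have "dyad m < D * \<rho> k" using k(2) step[of k] by linarith
      ultimately have "dyad m < dyad (int L) * \<rho> k" using pos[of k] by (meson less_le_trans mult_right_mono less_imp_le)
      then have "dyad (m - int L) \<le> \<rho> k" by (simp add: powr_diff field_simps)
      then have "dlog (dyad (m - int L)) \<le> dlog (\<rho> k)" by (intro dlog_mono) auto
      then show ?thesis by (simp only: dlog_dyad)
    qed
    ultimately show ?thesis by (intro exI[of _ k]) auto
  qed
  then obtain \<psi> where \<psi>: "\<And>m. \<bar>dlog (\<rho> (\<psi> m)) - m\<bar> \<le> int L" by metis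
  have "finite {m. \<psi> m = j} \<and> card {m. \<psi> m = j} \<le> 2 * (2 * L) + 1" for j
  proof (rule finite_card_int_diam)
    fix x y assume "x \<in> {m. \<psi> m = j}" "y \<in> {m. \<psi> m = j}"
    then show "\<bar>x - y\<bar> \<le> int (2 * L)" using \<psi>[of x] \<psi>[of y] by auto
  qed
  then show ?thesis using \<psi> by blast
qed

text \<open>One direction reads x along \<open>dlog (\<rho> k)\<close>, which has bounded fibres;
  the other reads H along \<open>\<psi>\<close>, where an error of L2 blocks costs M^L2. The
  constant is the same for all comparable pairs, hence later for all f.\<close>

lemma change_of_variables:
  assumes r: "0 < r"
  shows "\<exists>Q<top. \<forall>H x. comparable M H x \<longrightarrow>
    lq r UNIV x \<le> Q * lq r UNIV (\<lambda>k. H (\<rho> k)) \<and> lq r UNIV (\<lambda>k. H (\<rho> k)) \<le> Q * lq r UNIV x"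
proof (cases "1 \<le> M \<and> M < top")
  \<comment> \<open>\<open>M\<close> is free here; outside [1, \<infinity>) no pair is comparable
    and the claim is vacuous.\<close>
  case False
  then show ?thesis by (intro exI[of _ 1]) (auto simp: comparable_def)
next
  case M: True
  obtain L1 where L1: "\<And>j. finite {k. dlog (\<rho> k) = j}" "\<And>j. card {k. dlog (\<rho> k) = j} \<le> L1"
    using fibres by blast
  obtain L2 \<psi> where L2: "\<And>m. \<bar>dlog (\<rho> (\<psi> m)) - m\<bar> \<le> int L2"
    "\<And>j. finite {m. \<psi> m = j}" "\<And>j. card {m. \<psi> m = j} \<le> 2 * (2 * L2) + 1"
    using rough_inverse by blast
  define c1 where "c1 = ennreal (real L1 powr recip r)"
  define c2 where "c2 = ennreal (real (2 * (2 * L2) + 1) powr recip r)"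
  define Q where "Q = M * c1 + M ^ L2 * M * c2"
  have "M ^ L2 < top" using M by (simp add: power_less_top_ennreal)
  then have "Q < top" using M by (simp add: Q_def c1_def c2_def ennreal_mult_less_top)
  moreover have "lq r UNIV x \<le> Q * lq r UNIV (\<lambda>k. H (\<rho> k)) \<and> lq r UNIV (\<lambda>k. H (\<rho> k)) \<le> Q * lq r UNIV x"
    if H: "comparable M H x" for H x
  proof
    have up: "x i \<le> M ^ n * x (i + int n)" for i n
    proof (induction n)
      case (Suc n)
      have "x (i + int n) \<le> M * x (i + int (Suc n))"
        using comparableD(3)[OF H, of "i + int n"] by (simp add: ac_simps)
      from le_mult_trans[OF Suc this] show ?case by (simp add: ac_simps)
    qed simp
    have down: "x i \<le> M ^ n * x (i - int n)" for i n
    proof (induction n)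
      case (Suc n)
      have "x (i - int n) \<le> M * x (i - int (Suc n))"
        using comparableD(4)[OF H, of "i - int (Suc n)"] by (simp add: ac_simps)
      from le_mult_trans[OF Suc this] show ?case by (simp add: ac_simps)
    qed simp
    have near: "x i \<le> M ^ L2 * x j" if "\<bar>j - i\<bar> \<le> int L2" for i j
    proof -
      have "x i \<le> M ^ nat \<bar>j - i\<bar> * x j"
        using up[of i "nat (j - i)"] down[of i "nat (i - j)"] by (cases "i \<le> j") auto
      also have "\<dots> \<le> M ^ L2 * x j"
        using M that by (intro mult_right_mono power_increasing) auto
      finally show ?thesis .
    qed
    have "lq r UNIV (\<lambda>k. H (\<rho> k)) \<le> lq r UNIV (\<lambda>k. M * x (dlog (\<rho> k)))"
      using comparableD(1)[OF H pos] by (intro lq_mono r) auto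
    also have "\<dots> = M * lq r UNIV (\<lambda>k. x (dlog (\<rho> k)))" by (rule lq_cmult[OF r])
    also have "\<dots> \<le> M * (c1 * lq r UNIV x)"
      unfolding c1_def by (intro mult_left_mono lq_compose_le r L1) auto
    also have "\<dots> \<le> Q * lq r UNIV x" unfolding Q_def by (simp add: distrib_right mult.assoc)
    finally show "lq r UNIV (\<lambda>k. H (\<rho> k)) \<le> Q * lq r UNIV x" .
    have "lq r UNIV x \<le> lq r UNIV (\<lambda>m. M ^ L2 * M * H (\<rho> (\<psi> m)))"
      using le_mult_trans[OF near[OF L2(1)] comparableD(2)[OF H pos]] by (intro lq_mono r) auto
    also have "\<dots> = M ^ L2 * M * lq r UNIV (\<lambda>m. H (\<rho> (\<psi> m)))" by (rule lq_cmult[OF r])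
    also have "\<dots> \<le> M ^ L2 * M * (c2 * lq r UNIV (\<lambda>k. H (\<rho> k)))"
      unfolding c2_def by (intro mult_left_mono lq_compose_le[where F="\<lambda>k. H (\<rho> k)"] r L2) auto
    also have "\<dots> \<le> Q * lq r UNIV (\<lambda>k. H (\<rho> k))" unfolding Q_def by (simp add: distrib_right mult.assoc)
    finally show "lq r UNIV x \<le> Q * lq r UNIV (\<lambda>k. H (\<rho> k))" .
  qed
  ultimately show ?thesis by blast
qed

end

section \<open>Holmstedt-type estimates for sequences\<close>

lemma ennreal_mult_eq: "0 \<le> x \<Longrightarrow> ennreal x * (ennreal y * z) = ennreal (x * y) * z"
  by (simp add: ennreal_mult' mult.assoc)

text \<open>Half of the rate \<gamma> pays for the slowly varying factor, half remains.\<close>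

lemma dsv_geom_up:
  assumes s: "dsv \<sigma>" and g: "0 < \<gamma>"
  shows "\<exists>C\<ge>1. \<forall>i k. i \<le> k \<longrightarrow> 2 powr (\<gamma> * real_of_int i) * \<sigma> i
     \<le> C * pw (- (\<gamma> / 2)) i k * (2 powr (\<gamma> * real_of_int k) * \<sigma> k)"
proof -
  have "0 < \<gamma> / 2" using g by simp
  from dsvE[OF s this] obtain C where C: "0 < C" "\<And>i j. \<sigma> i \<le> C * pw (\<gamma> / 2) i j * \<sigma> j" by blast
  have "2 powr (\<gamma> * real_of_int i) * \<sigma> i
     \<le> max 1 C * pw (- (\<gamma> / 2)) i k * (2 powr (\<gamma> * real_of_int k) * \<sigma> k)" if "i \<le> k" for i k
  proof -
    have "\<sigma> i \<le> C * pw (\<gamma> / 2) i k * \<sigma> k" by (rule C(2))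
    also have "\<dots> \<le> max 1 C * pw (\<gamma> / 2) i k * \<sigma> k"
      using dsv_pos[OF s, of k] by (intro mult_right_mono) auto
    finally have "\<sigma> i \<le> max 1 C * pw (\<gamma> / 2) i k * \<sigma> k" .
    then have "2 powr (\<gamma> * real_of_int i) * \<sigma> i \<le> 2 powr (\<gamma> * real_of_int i) * (max 1 C * pw (\<gamma> / 2) i k * \<sigma> k)"
      by (rule mult_left_mono) simp
    also have "\<dots> = max 1 C * (2 powr (\<gamma> * real_of_int i) * pw (\<gamma> / 2) i k) * \<sigma> k" by simp
    also have "2 powr (\<gamma> * real_of_int i) * pw (\<gamma> / 2) i k
       = pw (- (\<gamma> / 2)) i k * 2 powr (\<gamma> * real_of_int k)"
      using that unfolding powr_add[symmetric] by (intro arg_cong[of _ _ "\<lambda>x. 2 powr x"]) (simp add: field_simps)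
    finally show ?thesis by (simp add: mult.assoc)
  qed
  then show ?thesis by (intro exI[of _ "max 1 C"]) auto
qed

lemma dsv_geom_down:
  assumes s: "dsv \<sigma>" and g: "0 < \<gamma>"
  shows "\<exists>C\<ge>1. \<forall>i k. k \<le> i \<longrightarrow> 2 powr (- \<gamma> * real_of_int i) * \<sigma> i
     \<le> C * pw (- (\<gamma> / 2)) i k * (2 powr (- \<gamma> * real_of_int k) * \<sigma> k)"
proof -
  \<comment> \<open>Reflecting the index turns decay into growth.\<close>
  have "dsv (\<lambda>i. \<sigma> (- i))" unfolding dsv_def
  proof (intro conjI allI impI)
    show "0 < \<sigma> (- k)" for k by (rule dsv_pos[OF s])
    fix e :: real assume "0 < e"
    from dsvE[OF s this] obtain C where C: "0 < C" "\<And>i j. \<sigma> i \<le> C * pw e i j * \<sigma> j" by blast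
    have "\<sigma> (- i) \<le> C * pw e i j * \<sigma> (- j)" for i j
    proof -
      have "\<bar>- i - - j\<bar> = \<bar>i - j\<bar>" by linarith
      then show ?thesis using C(2)[of "- i" "- j"] by metis
    qed
    then show "\<exists>C>0. \<forall>i j. \<sigma> (- i) \<le> C * pw e i j * \<sigma> (- j)" using C(1) by blast
  qed
  from dsv_geom_up[OF this g] obtain C where C: "1 \<le> C" "\<And>i k. i \<le> k \<Longrightarrow> 2 powr (\<gamma> * real_of_int i) * \<sigma> (- i)
     \<le> C * pw (- (\<gamma> / 2)) i k * (2 powr (\<gamma> * real_of_int k) * \<sigma> (- k))" by blast
  have "2 powr (- \<gamma> * real_of_int i) * \<sigma> i
     \<le> C * pw (- (\<gamma> / 2)) i k * (2 powr (- \<gamma> * real_of_int k) * \<sigma> k)" if "k \<le> i" for i k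
  proof -
    have "\<bar>- i - - k\<bar> = \<bar>i - k\<bar>" by linarith
    then show ?thesis using C(2)[of "- i" "- k"] that by simp
  qed
  then show ?thesis using C(1) by blast
qed

lemma growing_geom:
  assumes s: "dsv \<sigma>" and g: "0 < \<gamma>"
  shows "\<exists>C D. growing (\<lambda>k. 2 powr (\<gamma> * real_of_int k) * \<sigma> k) C (\<gamma> / 2) D"
proof -
  from dsv_geom_up[OF s g] obtain C where C: "1 \<le> C" "\<And>i k. i \<le> k \<Longrightarrow> 2 powr (\<gamma> * real_of_int i) * \<sigma> i
     \<le> C * pw (- (\<gamma> / 2)) i k * (2 powr (\<gamma> * real_of_int k) * \<sigma> k)" by blast
  from dsvE[OF s, of 1] obtain D where D: "0 < D" "\<And>i j. \<sigma> i \<le> D * pw 1 i j * \<sigma> j" by auto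
  have "growing (\<lambda>k. 2 powr (\<gamma> * real_of_int k) * \<sigma> k) C (\<gamma> / 2) (max 1 (2 powr \<gamma> * (D * 2)))"
  proof
    fix k
    have "\<sigma> (k + 1) \<le> D * 2 * \<sigma> k" using D(2)[of "k + 1" k] by simp
    then have "2 powr (\<gamma> * real_of_int k) * 2 powr \<gamma> * \<sigma> (k + 1) \<le> 2 powr (\<gamma> * real_of_int k) * 2 powr \<gamma> * (D * 2 * \<sigma> k)"
      by (rule mult_left_mono) simp
    also have "\<dots> = (2 powr \<gamma> * (D * 2)) * (2 powr (\<gamma> * real_of_int k) * \<sigma> k)" by simp
    also have "\<dots> \<le> max 1 (2 powr \<gamma> * (D * 2)) * (2 powr (\<gamma> * real_of_int k) * \<sigma> k)"
      using dsv_pos[OF s, of k] by (intro mult_right_mono) auto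
    finally show "2 powr (\<gamma> * real_of_int (k + 1)) * \<sigma> (k + 1) \<le> max 1 (2 powr \<gamma> * (D * 2)) * (2 powr (\<gamma> * real_of_int k) * \<sigma> k)"
      by (simp add: powr_add distrib_left)
  next
    fix i j :: int assume "i \<le> j"
    then have "\<bar>i - j\<bar> = j - i" by simp
    then show "2 powr (\<gamma> * real_of_int i) * \<sigma> i \<le> C * 2 powr (- (\<gamma> / 2) * real_of_int (j - i)) * (2 powr (\<gamma> * real_of_int j) * \<sigma> j)"
      using C(2)[OF \<open>i \<le> j\<close>] by metis
  qed (use dsv_pos[OF s] C(1) g in auto)
  then show ?thesis by blast
qed

lemma DN_add:
  assumes "0 < r" "0 < q"
  shows "\<exists>C<top. \<forall>S y x x'. DN r q S y (\<lambda>i. x i + x' i) \<le> C * (DN r q S y x + DN r q S y x')"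
proof (intro exI[of _ "quasi_const q * quasi_const r"] conjI allI)
  show "quasi_const q * quasi_const r < top" by (simp add: ennreal_mult_less_top quasi_const_less_top)
  fix S y x x'
  have "DN r q S y (\<lambda>i. x i + x' i) \<le> lq r S (\<lambda>j. y j * (quasi_const q * (lq q (S \<inter> {j..}) x + lq q (S \<inter> {j..}) x')))"
    unfolding DN_def by (intro lq_mono mult_left_mono lq_add_le assms) auto
  also have "\<dots> = quasi_const q * lq r S (\<lambda>j. y j * lq q (S \<inter> {j..}) x + y j * lq q (S \<inter> {j..}) x')"
    by (simp add: distrib_left mult.left_commute lq_cmult[OF assms(1), symmetric])
  also have "\<dots> \<le> quasi_const q * (quasi_const r * (DN r q S y x + DN r q S y x'))"
    unfolding DN_def by (intro mult_left_mono lq_add_le assms) auto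
  finally show "DN r q S y (\<lambda>i. x i + x' i) \<le> quasi_const q * quasi_const r * (DN r q S y x + DN r q S y x')"
    by (simp add: mult.assoc)
qed

lemma pw_mult: "pw s i k * pw t i k = pw (s + t) i k"
  by (simp add: distrib_right flip: powr_add)

lemma dsv_decay:
  assumes "dsv w" "0 < \<delta>"
  shows "\<exists>C>0. \<forall>i k. w i * pw (- \<delta>) i k \<le> pw (- (\<delta> / 2)) i k * (C * w k)"
proof -
  have "0 < \<delta> / 2" using assms(2) by simp
  from dsvE[OF assms(1) this] obtain C where C: "0 < C" "\<And>i j. w i \<le> C * pw (\<delta> / 2) i j * w j" by blast
  have "w i * pw (- \<delta>) i k \<le> pw (- (\<delta> / 2)) i k * (C * w k)" for i k
  proof -
    have "w i * pw (- \<delta>) i k \<le> (C * pw (\<delta> / 2) i k * w k) * pw (- \<delta>) i k"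
      by (intro mult_right_mono C) simp
    also have "\<dots> = (pw (\<delta> / 2) i k * pw (- \<delta>) i k) * (C * w k)" by (simp only: ac_simps)
    also have "pw (\<delta> / 2) i k * pw (- \<delta>) i k = pw (- (\<delta> / 2)) i k" unfolding pw_mult by simp
    finally show ?thesis .
  qed
  then show ?thesis using C(1) by blast
qed

text \<open>The inner tail from j is summed at rate \<delta>/2 and still decays in j at that rate.
  Half of this decay absorbs the growth of \<open>b\<close>, and the remaining \<delta>/4 sums the
  outer norm.\<close>

lemma tail_bounds:
  assumes r: "0 < r" and q: "0 < q" and b: "dsv b" and d: "0 < \<delta>"
  shows "\<exists>C<top. \<forall>x v k. (\<forall>i\<ge>k. x i \<le> ennreal (pw (- \<delta>) i k) * v) \<longrightarrow>
    lq q {k..} x \<le> C * v \<and> lq r {k..} (\<lambda>j. ennreal (b j) * lq q {j..} x) \<le> C * (ennreal (b k) * v)"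
proof -
  have d2: "0 < \<delta> / 2" and d4: "0 < \<delta> / 2 / 2" using d by auto
  from dsv_decay[OF b d2] obtain D where D: "0 < D"
    "\<And>j k. b j * pw (- (\<delta> / 2)) j k \<le> pw (- (\<delta> / 2 / 2)) j k * (D * b k)" by blast
  let ?g = "geo q (\<delta> / 2)" and ?h = "geo r (\<delta> / 2 / 2) * ennreal D"
  show ?thesis
  proof (intro exI[of _ "?g + ?h * ?g"] conjI allI impI)
    show "?g + ?h * ?g < top" using geo_less_top[OF q d2] geo_less_top[OF r d4] by (simp add: ennreal_mult_less_top)
    fix x :: "int \<Rightarrow> ennreal" and v and k :: int
    assume le: "\<forall>i\<ge>k. x i \<le> ennreal (pw (- \<delta>) i k) * v"
    have tail: "lq q {j..} x \<le> ?g * (ennreal (pw (- (\<delta> / 2)) j k) * v)" if j: "k \<le> j" for j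
    proof (rule lq_geo_le[OF q, of _ _ _ j])
      fix i assume "i \<in> {j..}"
      then have i: "j \<le> i" "k \<le> i" using j by auto
      have "\<delta> / 2 * real_of_int \<bar>i - j\<bar> + \<delta> / 2 * real_of_int \<bar>j - k\<bar> = \<delta> / 2 * real_of_int \<bar>i - k\<bar>"
        using i j by (simp add: field_simps)
      moreover have "\<delta> / 2 * real_of_int \<bar>i - k\<bar> \<le> \<delta> * real_of_int \<bar>i - k\<bar>"
        using d by (intro mult_right_mono) auto
      ultimately have "pw (- \<delta>) i k \<le> pw (- (\<delta> / 2)) i j * pw (- (\<delta> / 2)) j k"
        unfolding powr_add[symmetric] by (intro powr_mono) auto
      then have "ennreal (pw (- \<delta>) i k) * v \<le> ennreal (pw (- (\<delta> / 2)) i j * pw (- (\<delta> / 2)) j k) * v"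
        by (intro mult_right_mono ennreal_leI) auto
      then show "x i \<le> ennreal (pw (- (\<delta> / 2)) i j) * (ennreal (pw (- (\<delta> / 2)) j k) * v)"
        using le i by (fastforce simp: ennreal_mult_eq intro: order_trans)
    qed
    have "lq q {k..} x \<le> ?g * v" using tail[of k] by simp
    also have "\<dots> \<le> (?g + ?h * ?g) * v" by (intro mult_right_mono) auto
    finally show "lq q {k..} x \<le> (?g + ?h * ?g) * v" .
    have "lq r {k..} (\<lambda>j. ennreal (b j) * lq q {j..} x) \<le> geo r (\<delta> / 2 / 2) * (?g * (ennreal (D * b k) * v))"
    proof (rule lq_geo_le[OF r, of _ _ _ k])
      fix j assume "j \<in> {k..}"
      then have "ennreal (b j) * lq q {j..} x \<le> ennreal (b j) * (?g * (ennreal (pw (- (\<delta> / 2)) j k) * v))"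
        using tail[of j] by (simp add: mult_left_mono)
      also have "\<dots> = ?g * (ennreal (b j * pw (- (\<delta> / 2)) j k) * v)"
        using dsv_pos[OF b, of j] by (simp add: ennreal_mult ac_simps)
      also have "\<dots> \<le> ?g * (ennreal (pw (- (\<delta> / 2 / 2)) j k * (D * b k)) * v)"
        by (intro mult_left_mono mult_right_mono ennreal_leI D) auto
      also have "\<dots> = ennreal (pw (- (\<delta> / 2 / 2)) j k) * (?g * (ennreal (D * b k) * v))"
        by (subst ennreal_mult', simp, simp only: ac_simps)
      finally show "ennreal (b j) * lq q {j..} x \<le> ennreal (pw (- (\<delta> / 2 / 2)) j k) * (?g * (ennreal (D * b k) * v))" .
    qed
    also have "\<dots> = ?h * ?g * (ennreal (b k) * v)" using D(1) by (simp add: ennreal_mult' ac_simps)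
    also have "\<dots> \<le> (?g + ?h * ?g) * (ennreal (b k) * v)" by (intro mult_right_mono) auto
    finally show "lq r {k..} (\<lambda>j. ennreal (b j) * lq q {j..} x) \<le> (?g + ?h * ?g) * (ennreal (b k) * v)" .
  qed
qed

text \<open>The sequences \<open>X0\<close>, \<open>X1\<close>, \<open>\<rho>\<close> below are, up to constants, the values at \<open>2^k\<close> of
  \<open>\<chi>\<^sub>0\<close>, \<open>\<chi>\<^sub>1\<close>, \<open>\<rho>\<close>. With \<open>\<kappa> i = K(2^i, f)\<close>, \<open>N0 UNIV \<kappa>\<close> and \<open>N1 UNIV \<kappa>\<close> are the norms of \<open>f\<close> in the
  two R-spaces. In part (iii), \<open>I2\<close> times \<open>a \<circ> \<rho>\<close> corresponds to the integrand of the R-space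
  with weight \<open>B\<^sub>1\<close>.\<close>

locale weights =
  fixes q0 r0 q1 r1 :: ennreal and \<theta>0 :: real and a0 b0 a1 b1 :: "int \<Rightarrow> real"
  assumes q0: "0 < q0" and r0: "0 < r0" and q1: "0 < q1" and r1: "0 < r1"
    and theta0: "0 < \<theta>0" "\<theta>0 < 1"
    and dsv: "dsv a0" "dsv b0" "dsv a1" "dsv b1"
    and fin0: "lq r0 {..0} (\<lambda>i. ennreal (b0 i)) < top"
    and fin1: "DN r1 q1 {..0} (\<lambda>i. ennreal (b1 i)) (\<lambda>i. ennreal (a1 i)) < top"
begin

definition "B0 k = enn2real (lq r0 {..k} (\<lambda>i. ennreal (b0 i)))"
definition "B1 k = enn2real (lq r1 {..k} (\<lambda>i. ennreal (b1 i)))"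
definition "X0 k = a0 k * B0 k"
definition "X1 k = enn2real (DN r1 q1 {..k} (\<lambda>i. ennreal (b1 i)) (\<lambda>i. ennreal (a1 i)))"
definition "\<rho> k = 2 powr ((1 - \<theta>0) * real_of_int k) * (X0 k / X1 k)"
definition "w0 k = 2 powr (- \<theta>0 * real_of_int k) * a0 k"
definition "w1 k = 2 powr (- real_of_int k) * a1 k"
definition "S0 k = 2 powr (- \<theta>0 * real_of_int k) * X0 k"
definition "S1 k = 2 powr (- real_of_int k) * X1 k"
definition "N0 S \<kappa> = DN r0 q0 S (\<lambda>i. ennreal (b0 i)) (\<lambda>i. ennreal (w0 i) * \<kappa> i)"
definition "N1 S \<kappa> = DN r1 q1 S (\<lambda>i. ennreal (b1 i)) (\<lambda>i. ennreal (w1 i) * \<kappa> i)"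
definition "I2 k \<kappa> = ennreal (B1 k) * lq q1 {k..} (\<lambda>i. ennreal (w1 i) * \<kappa> i)"

lemma B0_eq: "lq r0 {..k} (\<lambda>i. ennreal (b0 i)) = ennreal (B0 k)"
  using dsv_lq_atMost(1)[OF r0 dsv(2) fin0] by (simp add: B0_def)

lemma X1_eq: "DN r1 q1 {..k} (\<lambda>i. ennreal (b1 i)) (\<lambda>i. ennreal (a1 i)) = ennreal (X1 k)"
  using dsv_DN_atMost(1)[OF r1 q1 dsv(4,3) fin1] by (simp add: X1_def)

text \<open>As \<open>a1\<close> is positive, an infinite partial norm of \<open>b1\<close> would
  make the finite double norm \<open>X1\<close> infinite.\<close>

lemma finB1: "lq r1 {..k} (\<lambda>i. ennreal (b1 i)) < top"
proof (rule ccontr)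
  assume "\<not> ?thesis"
  then have "lq r1 {..k} (\<lambda>i. ennreal (b1 i)) = top" using less_top by blast
  moreover have "lq r1 {..k} (\<lambda>i. ennreal (b1 i)) * ennreal (a1 k) \<le> ennreal (X1 k)"
    using DN_lower_bound[OF r1 q1, of k _ "\<lambda>i. ennreal (a1 i)"] X1_eq by metis
  ultimately show False using dsv_pos[OF dsv(3), of k] by (auto simp: ennreal_top_mult top_unique)
qed

lemma B1_eq: "lq r1 {..k} (\<lambda>i. ennreal (b1 i)) = ennreal (B1 k)"
  using finB1 by (simp add: B1_def)

lemma dsv_weights: "dsv B0" "dsv B1" "dsv X0" "dsv X1"
proof -
  show B0: "dsv B0" using dsv_lq_atMost(2)[OF r0 dsv(2) fin0] by (simp add: B0_def[abs_def])
  show "dsv B1" using dsv_lq_atMost(2)[OF r1 dsv(4) finB1] by (simp add: B1_def[abs_def])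
  show "dsv X0" using dsv_mult[OF dsv(1) B0] by (simp add: X0_def[abs_def])
  show "dsv X1" using dsv_DN_atMost(2)[OF r1 q1 dsv(4,3) fin1] by (simp add: X1_def[abs_def])
qed

lemma pos: "0 < a0 k" "0 < b0 k" "0 < a1 k" "0 < b1 k" "0 < B0 k" "0 < B1 k" "0 < X0 k" "0 < X1 k"
  "0 < w0 k" "0 < w1 k" "0 < S0 k" "0 < S1 k" "0 < \<rho> k"
proof -
  show *: "0 < a0 k" "0 < b0 k" "0 < a1 k" "0 < b1 k" "0 < B0 k" "0 < B1 k" "0 < X0 k" "0 < X1 k"
    using dsv dsv_weights by (simp_all add: dsv_pos)
  show "0 < w0 k" "0 < w1 k" "0 < S0 k" "0 < S1 k" "0 < \<rho> k"
    using * by (simp_all add: w0_def w1_def S0_def S1_def \<rho>_def)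
qed

text \<open>\<open>\<rho>\<close> is built as the ratio of the two lower bounds \<open>S0\<close>
  and \<open>S1\<close>; this identity carries estimates from one endpoint norm to the
  other.\<close>

lemma S0_eq: "S0 k = \<rho> k * S1 k"
proof -
  have "2 powr (- \<theta>0 * real_of_int k) = 2 powr ((1 - \<theta>0) * real_of_int k) * 2 powr (- real_of_int k)"
    by (simp flip: powr_add add: algebra_simps)
  then show ?thesis using pos(8)[of k] by (simp add: S0_def S1_def \<rho>_def)
qed

lemma b0_le: "b0 k \<le> B0 k"
proof -
  have "ennreal (b0 k) \<le> ennreal (B0 k)" unfolding B0_eq[symmetric] by (rule lq_upper[OF r0]) simp
  then show ?thesis using pos by (subst (asm) ennreal_le_iff) (auto simp: less_imp_le)
qed

lemma b1_le: "b1 k \<le> B1 k"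
proof -
  have "ennreal (b1 k) \<le> ennreal (B1 k)" unfolding B1_eq[symmetric] by (rule lq_upper[OF r1]) simp
  then show ?thesis using pos by (subst (asm) ennreal_le_iff) (auto simp: less_imp_le)
qed

lemma B1a1_le: "B1 k * a1 k \<le> X1 k"
proof -
  have "ennreal (B1 k) * ennreal (a1 k) \<le> ennreal (X1 k)"
    using DN_lower_bound[OF r1 q1, of k _ "\<lambda>i. ennreal (a1 i)"] X1_eq B1_eq by metis
  then have "ennreal (B1 k * a1 k) \<le> ennreal (X1 k)"
    using pos(3,6)[of k] by (simp add: ennreal_mult)
  then show ?thesis using pos(8)[of k] by (subst (asm) ennreal_le_iff) auto
qed

lemma N0_lower: "ennreal (S0 k) * \<kappa> k \<le> N0 {..k} \<kappa>"
proof -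
  have "ennreal (S0 k) * \<kappa> k = ennreal (B0 k) * (ennreal (w0 k) * \<kappa> k)"
    using pos(1,5)[of k] by (simp add: S0_def X0_def w0_def ennreal_mult ac_simps)
  also have "\<dots> \<le> N0 {..k} \<kappa>"
    unfolding B0_eq[symmetric] N0_def by (rule DN_lower_bound[OF r0 q0])
  finally show ?thesis .
qed

text \<open>Quasiconcavity turns the varying weight 2^(-i) into the constant 2^(-k), and what
  remains is exactly the double norm defining \<open>X1\<close>.\<close>

lemma N1_lower:
  assumes "\<And>i. i \<le> k \<Longrightarrow> ennreal (dyad (i - k)) * \<kappa> k \<le> \<kappa> i"
  shows "ennreal (S1 k) * \<kappa> k \<le> N1 {..k} \<kappa>"
proof -
  have "ennreal (S1 k) * \<kappa> k = (ennreal (2 powr (- real_of_int k)) * \<kappa> k) * ennreal (X1 k)"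
    using pos(8)[of k] by (simp add: S1_def ennreal_mult ac_simps)
  also have "\<dots> = DN r1 q1 {..k} (\<lambda>i. ennreal (b1 i)) (\<lambda>i. (ennreal (2 powr (- real_of_int k)) * \<kappa> k) * ennreal (a1 i))"
    by (simp add: DN_cmult[OF r1 q1] X1_eq)
  also have "\<dots> \<le> N1 {..k} \<kappa>"
    unfolding N1_def
  proof (rule DN_mono[OF r1 q1 order_refl])
    fix i assume "i \<in> {..k}"
    then have "i \<le> k" by simp
    have "2 powr (- real_of_int k) = 2 powr (- real_of_int i) * dyad (i - k)"
      by (simp flip: powr_add)
    then have "(ennreal (2 powr (- real_of_int k)) * \<kappa> k) * ennreal (a1 i) = ennreal (w1 i) * (ennreal (dyad (i - k)) * \<kappa> k)"
      using pos(3)[of i] by (simp add: w1_def ennreal_mult ac_simps)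
    also have "\<dots> \<le> ennreal (w1 i) * \<kappa> i" by (intro mult_left_mono assms[OF \<open>i \<le> k\<close>]) simp
    finally show "(ennreal (2 powr (- real_of_int k)) * \<kappa> k) * ennreal (a1 i) \<le> ennreal (w1 i) * \<kappa> i" .
  qed
  finally show ?thesis .
qed

lemma N0_mono: "S \<subseteq> T \<Longrightarrow> (\<And>i. i \<in> S \<Longrightarrow> \<kappa> i \<le> \<kappa>' i) \<Longrightarrow> N0 S \<kappa> \<le> N0 T \<kappa>'"
  unfolding N0_def by (intro DN_mono r0 q0) (auto intro: mult_left_mono)

lemma N1_mono: "S \<subseteq> T \<Longrightarrow> (\<And>i. i \<in> S \<Longrightarrow> \<kappa> i \<le> \<kappa>' i) \<Longrightarrow> N1 S \<kappa> \<le> N1 T \<kappa>'"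
  unfolding N1_def by (intro DN_mono r1 q1) (auto intro: mult_left_mono)

text \<open>Since \<open>w0\<close> is \<open>S0\<close> divided by \<open>B0\<close>, half of the
  decay absorbs the variation of 1/\<open>B0\<close>. The inner norm is then a multiple of v /
  \<open>B0 k\<close> uniformly in j, and the outer norm of \<open>b0\<close> contributes exactly
  \<open>B0 k\<close>.\<close>

lemma N0_geom:
  assumes d: "0 < \<delta>"
  shows "\<exists>C<top. \<forall>\<kappa> v k. (\<forall>i\<le>k. ennreal (S0 i) * \<kappa> i \<le> ennreal (pw (- \<delta>) i k) * v)
     \<longrightarrow> N0 {..k} \<kappa> \<le> C * v"
proof -
  from dsv_decay[OF dsv_inverse[OF dsv_weights(1)] d] obtain C where C: "0 < C"
    "\<And>i k. inverse (B0 i) * pw (- \<delta>) i k \<le> pw (- (\<delta> / 2)) i k * (C * inverse (B0 k))" by blast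
  let ?g = "geo q0 (\<delta> / 2)"
  show ?thesis
  proof (intro exI[of _ "?g * ennreal C"] conjI allI impI)
    show "?g * ennreal C < top" using geo_less_top[OF q0] d by (simp add: ennreal_mult_less_top)
    fix \<kappa> :: "int \<Rightarrow> ennreal" and v and k :: int
    assume le: "\<forall>i\<le>k. ennreal (S0 i) * \<kappa> i \<le> ennreal (pw (- \<delta>) i k) * v"
    let ?v = "ennreal (C * inverse (B0 k)) * v"
    have tm: "ennreal (w0 i) * \<kappa> i \<le> ennreal (pw (- (\<delta> / 2)) i k) * ?v" if "i \<le> k" for i
    proof -
      have "ennreal (w0 i) * \<kappa> i = ennreal (inverse (B0 i)) * (ennreal (S0 i) * \<kappa> i)"
        using pos(5)[of i] by (subst ennreal_mult_eq) (auto simp: S0_def X0_def w0_def field_simps)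
      also have "\<dots> \<le> ennreal (inverse (B0 i)) * (ennreal (pw (- \<delta>) i k) * v)"
        using le that by (intro mult_left_mono) auto
      also have "\<dots> = ennreal (inverse (B0 i) * pw (- \<delta>) i k) * v"
        using pos(5)[of i] by (intro ennreal_mult_eq) simp
      also have "\<dots> \<le> ennreal (pw (- (\<delta> / 2)) i k * (C * inverse (B0 k))) * v"
        by (intro mult_right_mono ennreal_leI C) simp
      finally show ?thesis by (simp only: ennreal_mult_eq powr_ge_zero)
    qed
    have "lq q0 ({..k} \<inter> {j..}) (\<lambda>i. ennreal (w0 i) * \<kappa> i) \<le> ?g * ?v" for j
      by (rule lq_geo_le[OF q0]) (erule IntE, rule tm, simp)
    then have "N0 {..k} \<kappa> \<le> lq r0 {..k} (\<lambda>j. ennreal (b0 j) * (?g * ?v))"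
      unfolding N0_def DN_def by (intro lq_mono r0 mult_left_mono) auto
    also have "\<dots> = ?g * (ennreal (B0 k) * ?v)"
      by (simp only: lq_cmult_right[OF r0] B0_eq) (simp only: ac_simps)
    also have "ennreal (B0 k) * ?v = ennreal C * v"
      using pos(5)[of k] by (subst ennreal_mult_eq) (auto simp: field_simps)
    finally show "N0 {..k} \<kappa> \<le> ?g * ennreal C * v" by (simp only: mult.assoc)
  qed
qed

text \<open>Here \<open>w1\<close> is \<open>S1\<close> times the slowly varying
  \<open>a1 / X1\<close>, so \<open>tail_bounds\<close> produces the factor
  \<open>B1 k * a1 k / X1 k\<close>, which is at most 1. The outer tail carries \<open>b1 k\<close>,
  which is at most \<open>B1 k\<close>.\<close>

lemma N1_geom:
  assumes d: "0 < \<delta>"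
  shows "\<exists>C<top. \<forall>\<kappa> v k. (\<forall>i\<ge>k. ennreal (S1 i) * \<kappa> i \<le> ennreal (pw (- \<delta>) i k) * v)
     \<longrightarrow> I2 k \<kappa> + N1 {k..} \<kappa> \<le> C * v"
proof -
  have d2: "0 < \<delta> / 2" using d by simp
  from dsv_decay[OF dsv_divide[OF dsv(3) dsv_weights(4)] d] obtain C where C: "0 < C"
    "\<And>i k. a1 i / X1 i * pw (- \<delta>) i k \<le> pw (- (\<delta> / 2)) i k * (C * (a1 k / X1 k))" by blast
  obtain D where D: "D < top" "\<And>x v k. (\<forall>i\<ge>k. x i \<le> ennreal (pw (- (\<delta> / 2)) i k) * v) \<Longrightarrow>
    lq q1 {k..} x \<le> D * v \<and> lq r1 {k..} (\<lambda>j. ennreal (b1 j) * lq q1 {j..} x) \<le> D * (ennreal (b1 k) * v)"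
    using tail_bounds[OF r1 q1 dsv(4) d2] by blast
  show ?thesis
  proof (intro exI[of _ "2 * (D * ennreal C)"] conjI allI impI)
    show "2 * (D * ennreal C) < top" using D(1) by (simp add: ennreal_mult_less_top)
    fix \<kappa> :: "int \<Rightarrow> ennreal" and v and k :: int
    assume le: "\<forall>i\<ge>k. ennreal (S1 i) * \<kappa> i \<le> ennreal (pw (- \<delta>) i k) * v"
    define c where "c = C * (a1 k / X1 k)"
    have c: "0 < c" using C(1) pos(3,8)[of k] by (simp add: c_def)
    let ?x = "\<lambda>i. ennreal (w1 i) * \<kappa> i"
    have "?x i \<le> ennreal (pw (- (\<delta> / 2)) i k) * (ennreal c * v)" if "k \<le> i" for i
    proof -
      have "?x i = ennreal (a1 i / X1 i) * (ennreal (S1 i) * \<kappa> i)"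
        using pos(3,8)[of i] by (subst ennreal_mult_eq) (auto simp: S1_def w1_def ac_simps)
      also have "\<dots> \<le> ennreal (a1 i / X1 i) * (ennreal (pw (- \<delta>) i k) * v)"
        using le that by (intro mult_left_mono) auto
      also have "\<dots> = ennreal (a1 i / X1 i * pw (- \<delta>) i k) * v"
        using pos(3,8)[of i] by (intro ennreal_mult_eq) simp
      also have "\<dots> \<le> ennreal (pw (- (\<delta> / 2)) i k * c) * v"
        unfolding c_def by (intro mult_right_mono ennreal_leI C) simp
      finally show ?thesis by (simp only: ennreal_mult_eq powr_ge_zero)
    qed
    then have b: "lq q1 {k..} ?x \<le> D * (ennreal c * v)"
      "lq r1 {k..} (\<lambda>j. ennreal (b1 j) * lq q1 {j..} ?x) \<le> D * (ennreal (b1 k) * (ennreal c * v))"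
      using D(2)[of k ?x "ennreal c * v"] by auto
    have B: "ennreal (B1 k) * (ennreal c * v) \<le> ennreal C * v"
    proof -
      have "B1 k * c = C * ((B1 k * a1 k) / X1 k)" by (simp add: c_def)
      also have "\<dots> \<le> C * 1" using B1a1_le[of k] pos(8)[of k] C(1) by (intro mult_left_mono) auto
      finally show ?thesis using pos(6)[of k] by (simp add: ennreal_mult_eq mult_right_mono ennreal_leI)
    qed
    have "I2 k \<kappa> \<le> ennreal (B1 k) * (D * (ennreal c * v))"
      unfolding I2_def by (intro mult_left_mono b) simp
    moreover have "N1 {k..} \<kappa> \<le> D * (ennreal (b1 k) * (ennreal c * v))"
      unfolding N1_def DN_def by (rule order_trans[OF _ b(2)]) (intro lq_mono r1 q1 mult_left_mono; simp)
    moreover have "\<dots> \<le> D * (ennreal (B1 k) * (ennreal c * v))"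
      by (intro mult_left_mono mult_right_mono ennreal_leI b1_le) auto
    ultimately have "I2 k \<kappa> + N1 {k..} \<kappa> \<le> D * (ennreal (B1 k) * (ennreal c * v)) + D * (ennreal (B1 k) * (ennreal c * v))"
      by (intro add_mono) (auto simp: mult.left_commute)
    also have "\<dots> \<le> D * (ennreal C * v) + D * (ennreal C * v)" by (intro add_mono mult_left_mono B) auto
    finally show "I2 k \<kappa> + N1 {k..} \<kappa> \<le> 2 * (D * ennreal C) * v" by (simp only: mult_2 distrib_right mult.assoc)
  qed
qed

lemma N0_frozen:
  "\<exists>C<top. \<forall>\<kappa> \<kappa>' k. (\<forall>i\<le>k. \<kappa>' i \<le> \<kappa> i) \<longrightarrow> (\<forall>i\<ge>k. \<kappa>' i \<le> \<kappa> k) \<longrightarrow> N0 UNIV \<kappa>' \<le> C * N0 {..k} \<kappa>"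
proof -
  have d: "0 < \<theta>0 / 2" using theta0 by auto
  from dsv_geom_down[OF dsv(1) theta0(1)] obtain C where C: "1 \<le> C"
    "\<And>i k. k \<le> i \<Longrightarrow> w0 i \<le> C * pw (- (\<theta>0 / 2)) i k * w0 k" unfolding w0_def by blast
  obtain D where D: "D < top" "\<And>x v k. (\<forall>i\<ge>k. x i \<le> ennreal (pw (- (\<theta>0 / 2)) i k) * v) \<Longrightarrow>
    lq q0 {k..} x \<le> D * v \<and> lq r0 {k..} (\<lambda>j. ennreal (b0 j) * lq q0 {j..} x) \<le> D * (ennreal (b0 k) * v)"
    using tail_bounds[OF r0 q0 dsv(2) d] by blast
  let ?c = "quasi_const q0" let ?cr = "quasi_const r0"
  let ?low = "?c * ?cr * (1 + D * ennreal C)"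
  show ?thesis
  proof (intro exI[of _ "?cr * (?low + D * ennreal C)"] conjI allI impI)
    show "?cr * (?low + D * ennreal C) < top"
      using D(1) quasi_const_less_top by (simp add: ennreal_mult_less_top)
    fix \<kappa> \<kappa>' :: "int \<Rightarrow> ennreal" and k :: int
    assume lo: "\<forall>i\<le>k. \<kappa>' i \<le> \<kappa> i" and hi: "\<forall>i\<ge>k. \<kappa>' i \<le> \<kappa> k"
    let ?x = "\<lambda>i. ennreal (w0 i) * \<kappa> i" let ?x' = "\<lambda>i. ennreal (w0 i) * \<kappa>' i"
    define z where "z = ennreal C * (ennreal (w0 k) * \<kappa> k)"
    have "ennreal (B0 k) * (ennreal (w0 k) * \<kappa> k) \<le> N0 {..k} \<kappa>"
      using N0_lower[of k \<kappa>] pos(5)[of k] pos(1)[of k] by (simp add: S0_def X0_def w0_def ennreal_mult ac_simps)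
    from mult_left_mono[OF this, of "ennreal C"]
    have y: "ennreal (B0 k) * z \<le> ennreal C * N0 {..k} \<kappa>" by (simp add: z_def mult.left_commute)
    have "?x' i \<le> ennreal (pw (- (\<theta>0 / 2)) i k) * z" if "k \<le> i" for i
    proof -
      have "?x' i \<le> ennreal (C * pw (- (\<theta>0 / 2)) i k * w0 k) * \<kappa> k"
        using hi that C(2)[OF that] by (intro mult_mono ennreal_leI) auto
      then show ?thesis using pos(9)[of k] C(1) by (simp add: z_def ennreal_mult ac_simps)
    qed
    then have tail: "lq q0 {k..} ?x' \<le> D * z"
      "lq r0 {k..} (\<lambda>j. ennreal (b0 j) * lq q0 {j..} ?x') \<le> D * (ennreal (b0 k) * z)"
      using D(2)[of k ?x' z] by auto
    have low: "lq r0 {..k} (\<lambda>j. ennreal (b0 j) * lq q0 {j..} ?x') \<le> ?low * N0 {..k} \<kappa>"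
    proof -
      let ?F = "\<lambda>j. ennreal (b0 j) * lq q0 ({..k} \<inter> {j..}) ?x"
      \<comment> \<open>The inner range is cut at k: the part below reproduces
        \<open>N0 {..k} \<kappa>\<close>, the tail bound is independent of j and meets the full
        outer norm \<open>B0 k\<close>.\<close>
      have "lq q0 {j..} ?x' \<le> ?c * (lq q0 ({..k} \<inter> {j..}) ?x + D * z)" for j
      proof -
        have "lq q0 {j..} ?x' \<le> lq q0 (({..k} \<inter> {j..}) \<union> {k..}) ?x'" by (intro lq_mono q0) auto
        also have "\<dots> \<le> ?c * (lq q0 ({..k} \<inter> {j..}) ?x' + lq q0 {k..} ?x')" by (rule lq_Un_le[OF q0])
        also have "\<dots> \<le> ?c * (lq q0 ({..k} \<inter> {j..}) ?x + D * z)"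
          using lo tail(1) by (intro mult_left_mono add_mono lq_mono q0) auto
        finally show ?thesis .
      qed
      then have "lq r0 {..k} (\<lambda>j. ennreal (b0 j) * lq q0 {j..} ?x')
         \<le> lq r0 {..k} (\<lambda>j. ennreal (b0 j) * (?c * (lq q0 ({..k} \<inter> {j..}) ?x + D * z)))"
        by (intro lq_mono r0 mult_left_mono) auto
      also have "\<dots> = ?c * lq r0 {..k} (\<lambda>j. ?F j + ennreal (b0 j) * (D * z))"
        unfolding lq_cmult[OF r0, symmetric] by (simp add: distrib_left ac_simps)
      also have "\<dots> \<le> ?c * (?cr * (lq r0 {..k} ?F + lq r0 {..k} (\<lambda>j. ennreal (b0 j) * (D * z))))"
        by (intro mult_left_mono lq_add_le r0) simp
      also have "lq r0 {..k} (\<lambda>j. ennreal (b0 j) * (D * z)) = D * (ennreal (B0 k) * z)"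
        by (simp only: lq_cmult_right[OF r0] B0_eq) (simp only: ac_simps)
      also have "lq r0 {..k} ?F = N0 {..k} \<kappa>" by (simp add: N0_def DN_def)
      also have "?c * (?cr * (N0 {..k} \<kappa> + D * (ennreal (B0 k) * z)))
         \<le> ?c * (?cr * (N0 {..k} \<kappa> + D * (ennreal C * N0 {..k} \<kappa>)))"
        by (intro mult_left_mono add_mono y) auto
      also have "\<dots> = ?low * N0 {..k} \<kappa>" by (simp add: algebra_simps)
      finally show ?thesis .
    qed
    have "D * (ennreal (b0 k) * z) \<le> D * (ennreal (B0 k) * z)"
      by (intro mult_left_mono mult_right_mono ennreal_leI b0_le) auto
    also have "\<dots> \<le> D * (ennreal C * N0 {..k} \<kappa>)" by (intro mult_left_mono y) simp
    finally have high: "lq r0 {k..} (\<lambda>j. ennreal (b0 j) * lq q0 {j..} ?x') \<le> D * ennreal C * N0 {..k} \<kappa>"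
      using tail(2) by (simp add: mult.assoc)
    have "UNIV = {..k} \<union> {k..}" by auto
    then have "N0 UNIV \<kappa>' \<le> ?cr * (lq r0 {..k} (\<lambda>j. ennreal (b0 j) * lq q0 {j..} ?x') + lq r0 {k..} (\<lambda>j. ennreal (b0 j) * lq q0 {j..} ?x'))"
      unfolding N0_def DN_def using lq_Un_le[OF r0, of "{..k}" "{k..}"] by simp
    also have "\<dots> \<le> ?cr * (?low * N0 {..k} \<kappa> + D * ennreal C * N0 {..k} \<kappa>)"
      by (intro mult_left_mono add_mono low high) auto
    finally show "N0 UNIV \<kappa>' \<le> ?cr * (?low + D * ennreal C) * N0 {..k} \<kappa>"
      by (simp add: distrib_right mult.assoc)
  qed
qed

text \<open>\<open>\<kappa>'\<close> models K for the second part of the split. Cutting both indices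
  at k leaves three pieces: both below, where 2^(-i) 2^(i-k) = 2^(-k) leaves the norm
  \<open>X1 k\<close>; outer below and inner above, which is \<open>I2\<close>; both above, which is
  \<open>N1 {k..}\<close>.\<close>

lemma N1_frozen:
  "\<exists>C<top. \<forall>\<kappa> \<kappa>' k. (\<forall>i\<le>k. \<kappa>' i \<le> ennreal (dyad (i - k)) * \<kappa> k) \<longrightarrow> (\<forall>i\<ge>k. \<kappa>' i \<le> \<kappa> i) \<longrightarrow>
     N1 UNIV \<kappa>' \<le> C * (ennreal (S1 k) * \<kappa> k + (I2 k \<kappa> + N1 {k..} \<kappa>))"
proof -
  let ?c = "quasi_const q1" let ?cr = "quasi_const r1"
  show ?thesis
  proof (intro exI[of _ "?cr * (?c * ?cr + 1)"] conjI allI impI)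
    show "?cr * (?c * ?cr + 1) < top" using quasi_const_less_top by (simp add: ennreal_mult_less_top)
    fix \<kappa> \<kappa>' :: "int \<Rightarrow> ennreal" and k :: int
    assume lo: "\<forall>i\<le>k. \<kappa>' i \<le> ennreal (dyad (i - k)) * \<kappa> k" and hi: "\<forall>i\<ge>k. \<kappa>' i \<le> \<kappa> i"
    let ?x = "ennreal (S1 k) * \<kappa> k + (I2 k \<kappa> + N1 {k..} \<kappa>)"
    let ?inner = "\<lambda>j. lq q1 (UNIV \<inter> {j..}) (\<lambda>i. ennreal (w1 i) * \<kappa>' i)"
    define y where "y = ennreal (2 powr (- real_of_int k)) * \<kappa> k"
    define z where "z = lq q1 {k..} (\<lambda>i. ennreal (w1 i) * \<kappa> i)"
    have lo': "ennreal (w1 i) * \<kappa>' i \<le> y * ennreal (a1 i)" if "i \<le> k" for i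
    proof -
      have "ennreal (w1 i) * \<kappa>' i \<le> ennreal (w1 i) * (ennreal (dyad (i - k)) * \<kappa> k)"
        using lo that by (intro mult_left_mono) auto
      also have "\<dots> = ennreal ((2 powr (- real_of_int i) * dyad (i - k)) * a1 i) * \<kappa> k"
        using pos(3)[of i] by (simp add: ennreal_mult w1_def ac_simps)
      also have "2 powr (- real_of_int i) * dyad (i - k) = 2 powr (- real_of_int k)"
        by (simp flip: powr_add)
      finally show ?thesis using pos(3)[of i] by (simp add: y_def ennreal_mult ac_simps)
    qed
    have low: "lq r1 {..k} (\<lambda>j. ennreal (b1 j) * ?inner j) \<le> ?c * ?cr * ?x"
    proof -
      let ?F = "\<lambda>j. ennreal (b1 j) * lq q1 ({..k} \<inter> {j..}) (\<lambda>i. ennreal (a1 i))"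
      have "?inner j \<le> ?c * (y * lq q1 ({..k} \<inter> {j..}) (\<lambda>i. ennreal (a1 i)) + z)" for j
      proof -
        have "?inner j \<le> lq q1 (({..k} \<inter> {j..}) \<union> {k..}) (\<lambda>i. ennreal (w1 i) * \<kappa>' i)"
          by (intro lq_mono q1) auto
        also have "\<dots> \<le> ?c * (lq q1 ({..k} \<inter> {j..}) (\<lambda>i. ennreal (w1 i) * \<kappa>' i) + lq q1 {k..} (\<lambda>i. ennreal (w1 i) * \<kappa>' i))"
          by (rule lq_Un_le[OF q1])
        also have "\<dots> \<le> ?c * (lq q1 ({..k} \<inter> {j..}) (\<lambda>i. y * ennreal (a1 i)) + z)"
          unfolding z_def using lo' hi by (intro mult_left_mono add_mono lq_mono q1) (auto intro: mult_left_mono)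
        finally show ?thesis by (simp only: lq_cmult[OF q1])
      qed
      then have "lq r1 {..k} (\<lambda>j. ennreal (b1 j) * ?inner j)
         \<le> lq r1 {..k} (\<lambda>j. ennreal (b1 j) * (?c * (y * lq q1 ({..k} \<inter> {j..}) (\<lambda>i. ennreal (a1 i)) + z)))"
        by (intro lq_mono r1 mult_left_mono) auto
      also have "\<dots> = lq r1 {..k} (\<lambda>j. ?c * (y * ?F j + ennreal (b1 j) * z))"
        by (simp add: distrib_left ac_simps)
      also have "\<dots> = ?c * lq r1 {..k} (\<lambda>j. y * ?F j + ennreal (b1 j) * z)"
        by (rule lq_cmult[OF r1])
      also have "\<dots> \<le> ?c * (?cr * (lq r1 {..k} (\<lambda>j. y * ?F j) + lq r1 {..k} (\<lambda>j. ennreal (b1 j) * z)))"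
        by (intro mult_left_mono lq_add_le r1) simp
      also have "lq r1 {..k} (\<lambda>j. ennreal (b1 j) * z) = I2 k \<kappa>"
        by (simp only: lq_cmult_right[OF r1] B1_eq I2_def z_def)
      also have "lq r1 {..k} (\<lambda>j. y * ?F j) = y * ennreal (X1 k)"
        by (simp only: lq_cmult[OF r1] DN_def[symmetric] X1_eq)
      also have "y * ennreal (X1 k) = ennreal (S1 k) * \<kappa> k"
        using pos(8)[of k] by (simp add: y_def S1_def ennreal_mult ac_simps)
      also have "?c * (?cr * (ennreal (S1 k) * \<kappa> k + I2 k \<kappa>)) \<le> ?c * (?cr * ?x)"
        by (intro mult_left_mono add_mono) auto
      finally show ?thesis by (simp add: mult.assoc)
    qed
    have high: "lq r1 {k..} (\<lambda>j. ennreal (b1 j) * ?inner j) \<le> ?x"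
    proof -
      have "lq r1 {k..} (\<lambda>j. ennreal (b1 j) * ?inner j) \<le> N1 {k..} \<kappa>"
        unfolding N1_def DN_def using hi by (intro lq_mono r1 q1 mult_left_mono) (auto intro: mult_left_mono)
      also have "\<dots> \<le> ?x" by (simp add: add_increasing)
      finally show ?thesis .
    qed
    have "UNIV = {..k} \<union> {k..}" by auto
    then have "N1 UNIV \<kappa>' \<le> ?cr * (lq r1 {..k} (\<lambda>j. ennreal (b1 j) * ?inner j) + lq r1 {k..} (\<lambda>j. ennreal (b1 j) * ?inner j))"
      unfolding N1_def DN_def using lq_Un_le[OF r1, of "{..k}" "{k..}"] by simp
    also have "\<dots> \<le> ?cr * (?c * ?cr * ?x + ?x)"
      by (intro mult_left_mono add_mono low high) auto
    also have "\<dots> = ?cr * (?c * ?cr + 1) * ?x"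
      by (simp only: distrib_right[of "?c * ?cr"] mult_1 mult.assoc)
    finally show "N1 UNIV \<kappa>' \<le> ?cr * (?c * ?cr + 1) * ?x" .
  qed
qed

definition "H k \<kappa> = N0 {..k} \<kappa> + ennreal (\<rho> k) * (I2 k \<kappa> + N1 {k..} \<kappa>)"

lemma \<rho>_eq: "\<rho> = (\<lambda>k. 2 powr ((1 - \<theta>0) * real_of_int k) * (X0 k / X1 k))"
  by (simp add: \<rho>_def fun_eq_iff)

lemma growing_\<rho>: "\<exists>C D. growing \<rho> C ((1 - \<theta>0) / 2) D"
  unfolding \<rho>_eq using theta0 by (intro growing_geom dsv_divide dsv_weights) auto

text \<open>The rate 2 is crude: less than 1 from the power of 2 and 1 from the slowly varying
  quotient. Any finite rate suffices for composing with a slowly varying function.\<close>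

lemma \<rho>_doubling: "\<exists>C>0. \<forall>i j. \<rho> i \<le> C * pw 2 i j * \<rho> j"
proof -
  from dsvE[OF dsv_divide[OF dsv_weights(3,4)], of 1] obtain C where
    C: "0 < C" "\<And>i j. X0 i / X1 i \<le> C * pw 1 i j * (X0 j / X1 j)" by auto
  have "\<rho> i \<le> C * pw 2 i j * \<rho> j" for i j
  proof -
    have "\<rho> i \<le> 2 powr ((1 - \<theta>0) * real_of_int i) * (C * pw 1 i j * (X0 j / X1 j))"
      unfolding \<rho>_def by (intro mult_left_mono C) simp
    also have "\<dots> \<le> (2 powr (real_of_int \<bar>i - j\<bar>) * 2 powr ((1 - \<theta>0) * real_of_int j)) * (C * pw 1 i j * (X0 j / X1 j))"
    proof (intro mult_right_mono)
      have "(1 - \<theta>0) * (real_of_int i - real_of_int j) \<le> \<bar>(1 - \<theta>0) * (real_of_int i - real_of_int j)\<bar>" by simp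
      also have "\<dots> = (1 - \<theta>0) * real_of_int \<bar>i - j\<bar>" using theta0 by (simp add: abs_mult)
      also have "\<dots> \<le> 1 * real_of_int \<bar>i - j\<bar>" using theta0 by (intro mult_right_mono) auto
      finally have "(1 - \<theta>0) * real_of_int i \<le> real_of_int \<bar>i - j\<bar> + (1 - \<theta>0) * real_of_int j"
        by (simp add: algebra_simps)
      then show "2 powr ((1 - \<theta>0) * real_of_int i) \<le> 2 powr (real_of_int \<bar>i - j\<bar>) * 2 powr ((1 - \<theta>0) * real_of_int j)"
        by (simp flip: powr_add)
      show "0 \<le> C * pw 1 i j * (X0 j / X1 j)" using C(1) pos(7,8)[of j] by simp
    qed
    also have "\<dots> = C * (2 powr (real_of_int \<bar>i - j\<bar>) * 2 powr (real_of_int \<bar>i - j\<bar>)) * \<rho> j"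
      by (simp add: \<rho>_def)
    also have "2 powr (real_of_int \<bar>i - j\<bar>) * 2 powr (real_of_int \<bar>i - j\<bar>) = pw 2 i j"
      by (simp flip: powr_add)
    finally show ?thesis .
  qed
  then show ?thesis using C(1) by blast
qed

lemma S0_mult: "ennreal (S0 i) * u = ennreal (\<rho> i) * (ennreal (S1 i) * u)"
  using pos by (simp add: S0_eq ennreal_mult_eq less_imp_le)

text \<open>This is the half of quasiconcavity used for \<open>N1_lower\<close>: 2^(-i)
  \<open>\<kappa> i\<close> decreases.\<close>

definition "quasiconcave \<kappa> \<longleftrightarrow> (\<forall>i k. i \<le> k \<longrightarrow> ennreal (dyad (i - k)) * \<kappa> k \<le> \<kappa> i)"

lemma N1_lower_UNIV: "quasiconcave \<kappa> \<Longrightarrow> ennreal (S1 k) * \<kappa> k \<le> N1 UNIV \<kappa>"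
  using N1_lower[of k \<kappa>] N1_mono[of "{..k}" UNIV \<kappa> \<kappa>] by (auto simp: quasiconcave_def)

lemma N0_lower_UNIV: "ennreal (S0 k) * \<kappa> k \<le> N0 UNIV \<kappa>"
  using N0_lower[of k \<kappa>] N0_mono[of "{..k}" UNIV \<kappa> \<kappa>] by auto

lemma N0_add: "\<exists>C<top. \<forall>S \<kappa> \<kappa>'. N0 S (\<lambda>i. \<kappa> i + \<kappa>' i) \<le> C * (N0 S \<kappa> + N0 S \<kappa>')"
proof -
  obtain C where C: "C < top"
    "\<And>S y x x'. DN r0 q0 S y (\<lambda>i. x i + x' i) \<le> C * (DN r0 q0 S y x + DN r0 q0 S y x')"
    using DN_add[OF r0 q0] by blast
  then show ?thesis unfolding N0_def distrib_left[of "ennreal (w0 _)"] by (intro exI[of _ C] conjI allI C)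
qed

lemma N1_add: "\<exists>C<top. \<forall>S \<kappa> \<kappa>'. N1 S (\<lambda>i. \<kappa> i + \<kappa>' i) \<le> C * (N1 S \<kappa> + N1 S \<kappa>')"
proof -
  obtain C where C: "C < top"
    "\<And>S y x x'. DN r1 q1 S y (\<lambda>i. x i + x' i) \<le> C * (DN r1 q1 S y x + DN r1 q1 S y x')"
    using DN_add[OF r1 q1] by blast
  then show ?thesis unfolding N1_def distrib_left[of "ennreal (w1 _)"] by (intro exI[of _ C] conjI allI C)
qed

lemma I2_add: "I2 k (\<lambda>i. \<kappa> i + \<kappa>' i) \<le> quasi_const q1 * (I2 k \<kappa> + I2 k \<kappa>')"
proof -
  have "I2 k (\<lambda>i. \<kappa> i + \<kappa>' i) \<le> ennreal (B1 k) * (quasi_const q1 * (lq q1 {k..} (\<lambda>i. ennreal (w1 i) * \<kappa> i) + lq q1 {k..} (\<lambda>i. ennreal (w1 i) * \<kappa>' i)))"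
    unfolding I2_def distrib_left[of "ennreal (w1 _)"] by (intro mult_left_mono lq_add_le q1) simp
  then show ?thesis by (simp add: I2_def distrib_left ac_simps)
qed

lemma I2_mono: "(\<And>i. k \<le> i \<Longrightarrow> \<kappa> i \<le> \<kappa>' i) \<Longrightarrow> I2 k \<kappa> \<le> I2 k \<kappa>'"
  unfolding I2_def by (intro mult_left_mono lq_mono q1) auto

lemma N_cmult:
  "N0 S (\<lambda>i. c * \<kappa> i) = c * N0 S \<kappa>" "N1 S (\<lambda>i. c * \<kappa> i) = c * N1 S \<kappa>" "I2 k (\<lambda>i. c * \<kappa> i) = c * I2 k \<kappa>"
  unfolding N0_def N1_def I2_def mult.left_commute[of "ennreal _" c]
  by (simp_all only: DN_cmult r0 q0 r1 q1 lq_cmult mult.left_commute[of "ennreal _" c])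

section \<open>Outer weights and domination by a single term\<close>

context
  fixes \<alpha> :: "int \<Rightarrow> real" and \<theta> :: real
  assumes alpha: "dsv \<alpha>"
begin

text \<open>The outer weight s^(-\<theta>) a(s) at s = \<open>\<rho> k\<close>, with
  \<open>\<alpha>\<close> standing for the sampled composition.\<close>

definition "wt k = \<rho> k powr (- \<theta>) * \<alpha> k"

definition "main \<kappa> k = ennreal (wt k) * (ennreal (S0 k) * \<kappa> k)"

lemma wt_pos: "0 < wt k"
  using dsv_pos[OF alpha, of k] pos(13)[of k] by (simp add: wt_def)

lemma main_div: "ennreal (S0 k) * \<kappa> k = ennreal (1 / wt k) * main \<kappa> k"
  using wt_pos[of k] by (simp add: main_def ennreal_mult_eq)

text \<open>The coefficient t decays at rate 2\<delta> away from k, the envelope grows at rate at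
  most \<delta>, and decay at rate \<delta> is left.\<close>

lemma decay_env:
  assumes "0 < \<delta>" "t \<le> D * pw (- (2 * \<delta>)) i k * t'" "0 \<le> D" "0 \<le> t'" "u \<le> ennreal t * main \<kappa> i"
  shows "u \<le> ennreal (pw (- \<delta>) i k) * (ennreal (D * t') * env \<delta> (main \<kappa>) k)"
proof -
  have "u \<le> ennreal t * (ennreal (pw \<delta> i k) * env \<delta> (main \<kappa>) k)"
    using assms(5) le_env[of "main \<kappa>" i \<delta>] env_regular[OF assms(1), of "main \<kappa>" i k]
    by (meson mult_left_mono order_trans zero_le)
  also have "\<dots> \<le> ennreal (D * pw (- (2 * \<delta>)) i k * t') * (ennreal (pw \<delta> i k) * env \<delta> (main \<kappa>) k)"
    by (intro mult_right_mono ennreal_leI assms) simp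
  also have "\<dots> = ennreal ((pw (- (2 * \<delta>)) i k * pw \<delta> i k) * (D * t')) * env \<delta> (main \<kappa>) k"
    using assms(3,4) by (subst ennreal_mult_eq) (auto simp: ac_simps)
  also have "pw (- (2 * \<delta>)) i k * pw \<delta> i k = pw (- \<delta>) i k"
    by (simp flip: powr_add)
  finally show ?thesis by (simp add: ennreal_mult_eq)
qed

text \<open>\<open>S0 i * \<kappa> i\<close> is \<open>main\<close> divided by \<open>wt\<close>,
  and 1/\<open>wt\<close> contains \<rho>^\<theta>, which grows geometrically because \<theta> > 0.
  So the contributions from below k form a geometric series with its largest term at k.\<close>

lemma N0_env:
  assumes "0 < \<theta>"
  shows "\<exists>C<top. \<exists>\<delta>>0. \<forall>\<kappa> k. ennreal (wt k) * N0 {..k} \<kappa> \<le> C * env \<delta> (main \<kappa>) k"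
proof -
  \<comment> \<open>1/\<open>wt\<close> grows at rate \<theta>(1 - \<theta>0);
    \<open>dsv_geom_up\<close> keeps half of this, and that half must be the 2\<delta> of
    \<open>decay_env\<close>.\<close>
  define \<delta> where "\<delta> = \<theta> * (1 - \<theta>0) / 4"
  have d: "0 < \<delta>" using assms theta0 by (simp add: \<delta>_def)
  let ?\<sigma> = "\<lambda>i. (X0 i / X1 i) powr \<theta> / \<alpha> i"
  have eq: "1 / wt i = 2 powr (\<theta> * (1 - \<theta>0) * real_of_int i) * ?\<sigma> i" for i
  proof -
    have "\<rho> i powr \<theta> = 2 powr (\<theta> * (1 - \<theta>0) * real_of_int i) * (X0 i / X1 i) powr \<theta>"
      using pos(7,8)[of i] unfolding \<rho>_def by (subst powr_mult) (auto simp: powr_powr ac_simps)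
    then show ?thesis by (simp add: wt_def powr_minus field_simps)
  qed
  have "dsv ?\<sigma>" by (intro dsv_divide dsv_powr dsv_weights alpha)
  from dsv_geom_up[OF this, of "\<theta> * (1 - \<theta>0)"] assms theta0 obtain D where D: "1 \<le> D"
    "\<And>i k. i \<le> k \<Longrightarrow> 1 / wt i \<le> D * 2 powr (- (\<theta> * (1 - \<theta>0) / 2) * real_of_int \<bar>i - k\<bar>) * (1 / wt k)"
    unfolding eq by auto
  from N0_geom[OF d] obtain C where C: "C < top"
    "\<And>\<kappa> v k. (\<forall>i\<le>k. ennreal (S0 i) * \<kappa> i \<le> ennreal (pw (- \<delta>) i k) * v) \<Longrightarrow> N0 {..k} \<kappa> \<le> C * v"
    by blast
  have "ennreal (wt k) * N0 {..k} \<kappa> \<le> C * ennreal D * env \<delta> (main \<kappa>) k" for \<kappa> k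
  proof -
    have "N0 {..k} \<kappa> \<le> C * (ennreal (D * (1 / wt k)) * env \<delta> (main \<kappa>) k)"
    proof (rule C(2), intro allI impI)
      fix i assume "i \<le> k"
      then have "1 / wt i \<le> D * pw (- (2 * \<delta>)) i k * (1 / wt k)"
        using D(2)[of i k] by (simp add: \<delta>_def)
      then show "ennreal (S0 i) * \<kappa> i \<le> ennreal (pw (- \<delta>) i k) * (ennreal (D * (1 / wt k)) * env \<delta> (main \<kappa>) k)"
        using wt_pos D(1) by (intro decay_env[OF d]) (auto simp: main_div less_imp_le)
    qed
    then have "ennreal (wt k) * N0 {..k} \<kappa> \<le> ennreal (wt k) * (C * (ennreal (D * (1 / wt k)) * env \<delta> (main \<kappa>) k))"
      by (rule mult_left_mono) simp
    also have "\<dots> = C * (ennreal (wt k) * (ennreal (D * (1 / wt k)) * env \<delta> (main \<kappa>) k))" by (simp only: mult.left_commute)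
    also have "ennreal (wt k) * (ennreal (D * (1 / wt k)) * env \<delta> (main \<kappa>) k) = ennreal D * env \<delta> (main \<kappa>) k"
      using wt_pos[of k] by (simp add: ennreal_mult_eq)
    finally show ?thesis by (simp add: mult.assoc)
  qed
  then show ?thesis using C(1) d by (intro exI[of _ "C * ennreal D"] conjI exI[of _ \<delta>]) (auto simp: ennreal_mult_less_top)
qed

text \<open>\<open>S1 i * \<kappa> i\<close> is \<open>main\<close> divided by
  \<open>wt * \<rho>\<close>, which contains \<rho>^(1-\<theta>) and grows geometrically for
  \<theta> < 1. The contributions from above k are therefore geometric; at \<theta> = 1 this growth
  disappears.\<close>

lemma N1_env:
  assumes "\<theta> < 1"
  shows "\<exists>C<top. \<exists>\<delta>>0. \<forall>\<kappa> k. ennreal (wt k) * (ennreal (\<rho> k) * (I2 k \<kappa> + N1 {k..} \<kappa>)) \<le> C * env \<delta> (main \<kappa>) k"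
proof -
  define \<gamma> where "\<gamma> = (1 - \<theta>) * (1 - \<theta>0)"
  define \<delta> where "\<delta> = \<gamma> / 4"
  have g: "0 < \<gamma>" using assms theta0 by (simp add: \<gamma>_def)
  then have d: "0 < \<delta>" by (simp add: \<delta>_def)
  let ?\<sigma> = "\<lambda>i. (X0 i / X1 i) powr (\<theta> - 1) / \<alpha> i"
  have eq: "1 / (wt i * \<rho> i) = 2 powr (- \<gamma> * real_of_int i) * ?\<sigma> i" for i
  proof -
    have "\<rho> i powr (\<theta> - 1) = 2 powr (- \<gamma> * real_of_int i) * (X0 i / X1 i) powr (\<theta> - 1)"
      using pos(7,8)[of i] unfolding \<rho>_def by (subst powr_mult) (auto simp: powr_powr \<gamma>_def algebra_simps)
    moreover have "wt i * \<rho> i = \<alpha> i / \<rho> i powr (\<theta> - 1)"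
      using pos(13)[of i] by (simp add: wt_def powr_minus powr_diff field_simps)
    ultimately show ?thesis by simp
  qed
  have "dsv ?\<sigma>" by (intro dsv_divide dsv_powr dsv_weights alpha)
  from dsv_geom_down[OF this g] obtain D where D: "1 \<le> D"
    "\<And>i k. k \<le> i \<Longrightarrow> 1 / (wt i * \<rho> i) \<le> D * pw (- (\<gamma> / 2)) i k * (1 / (wt k * \<rho> k))"
    unfolding eq by auto
  from N1_geom[OF d] obtain C where C: "C < top"
    "\<And>\<kappa> v k. (\<forall>i\<ge>k. ennreal (S1 i) * \<kappa> i \<le> ennreal (pw (- \<delta>) i k) * v) \<Longrightarrow> I2 k \<kappa> + N1 {k..} \<kappa> \<le> C * v"
    by blast
  have wr: "0 < wt k * \<rho> k" for k using wt_pos[of k] pos(13)[of k] by simp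
  have "ennreal (wt k) * (ennreal (\<rho> k) * (I2 k \<kappa> + N1 {k..} \<kappa>)) \<le> C * ennreal D * env \<delta> (main \<kappa>) k" for \<kappa> k
  proof -
    let ?w = "wt k * \<rho> k"
    have "I2 k \<kappa> + N1 {k..} \<kappa> \<le> C * (ennreal (D * (1 / ?w)) * env \<delta> (main \<kappa>) k)"
    proof (rule C(2), intro allI impI)
      fix i assume "k \<le> i"
      then have *: "1 / (wt i * \<rho> i) \<le> D * pw (- (2 * \<delta>)) i k * (1 / ?w)"
        using D(2)[of k i] by (simp add: \<delta>_def)
      have "ennreal (S1 i) * \<kappa> i = ennreal (1 / \<rho> i) * (ennreal (S0 i) * \<kappa> i)"
        using pos(13)[of i] by (simp add: S0_eq ennreal_mult_eq)
      also have "\<dots> = ennreal (1 / (wt i * \<rho> i)) * main \<kappa> i"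
        unfolding main_div using pos(13)[of i] by (subst ennreal_mult_eq) (auto simp: mult.commute)
      finally have "ennreal (S1 i) * \<kappa> i \<le> ennreal (1 / (wt i * \<rho> i)) * main \<kappa> i" by simp
      then show "ennreal (S1 i) * \<kappa> i \<le> ennreal (pw (- \<delta>) i k) * (ennreal (D * (1 / ?w)) * env \<delta> (main \<kappa>) k)"
        using wr[of k] D(1) by (intro decay_env[OF d *]) auto
    qed
    then have "ennreal ?w * (I2 k \<kappa> + N1 {k..} \<kappa>) \<le> ennreal ?w * (C * (ennreal (D * (1 / ?w)) * env \<delta> (main \<kappa>) k))"
      by (rule mult_left_mono) simp
    also have "\<dots> = C * (ennreal ?w * (ennreal (D * (1 / ?w)) * env \<delta> (main \<kappa>) k))" by (simp only: mult.left_commute)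
    also have "ennreal ?w * (ennreal (D * (1 / ?w)) * env \<delta> (main \<kappa>) k) = ennreal (?w * (D * (1 / ?w))) * env \<delta> (main \<kappa>) k"
      using wr[of k] by (intro ennreal_mult_eq) simp
    also have "?w * (D * (1 / ?w)) = D" using wt_pos[of k] pos(13)[of k] by simp
    finally show ?thesis using wt_pos[of k] by (simp add: mult.assoc ennreal_mult_eq)
  qed
  then show ?thesis using C(1) d by (intro exI[of _ "C * ennreal D"] conjI exI[of _ \<delta>]) (auto simp: ennreal_mult_less_top)
qed

lemma lq_env_bound:
  assumes r: "0 < r" and C: "C < top" and d: "0 < \<delta>"
    and le: "\<And>\<kappa> k. F \<kappa> k \<le> C * env \<delta> (main \<kappa>) k"
  shows "\<exists>C<top. \<forall>\<kappa>. lq r UNIV (F \<kappa>) \<le> C * lq r UNIV (main \<kappa>)"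
proof (intro exI[of _ "C * (1 + geo r \<delta>)"] conjI allI)
  show "C * (1 + geo r \<delta>) < top" using C geo_less_top[OF r d] by (simp add: ennreal_mult_less_top)
  fix \<kappa>
  have "lq r UNIV (F \<kappa>) \<le> C * lq r UNIV (env \<delta> (main \<kappa>))"
    unfolding lq_cmult[OF r, symmetric] by (intro lq_mono r le) auto
  then show "lq r UNIV (F \<kappa>) \<le> C * (1 + geo r \<delta>) * lq r UNIV (main \<kappa>)"
    by (rule le_mult_trans) (rule lq_env_le[OF r d])
qed

lemma lq_main_le: "0 < r \<Longrightarrow> lq r UNIV (main \<kappa>) \<le> lq r UNIV (\<lambda>k. ennreal (wt k) * N0 {..k} \<kappa>)"
  unfolding main_def by (intro lq_mono mult_left_mono N0_lower) auto

text \<open>A discrete Hardy inequality, valid for every outer exponent through the norm bound on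
  the envelope.\<close>

lemma lq_N0_le_main:
  assumes "0 < \<theta>" "0 < r"
  shows "\<exists>C<top. \<forall>\<kappa>. lq r UNIV (\<lambda>k. ennreal (wt k) * N0 {..k} \<kappa>) \<le> C * lq r UNIV (main \<kappa>)"
proof -
  obtain C \<delta> where "C < top" "0 < \<delta>" "\<And>\<kappa> k. ennreal (wt k) * N0 {..k} \<kappa> \<le> C * env \<delta> (main \<kappa>) k"
    using N0_env[OF assms(1)] by blast
  then show ?thesis by (rule lq_env_bound[OF assms(2)])
qed

lemma lq_N1_le_main:
  assumes "\<theta> < 1" "0 < r"
  shows "\<exists>C<top. \<forall>\<kappa>. lq r UNIV (\<lambda>k. ennreal (wt k) * (ennreal (\<rho> k) * (I2 k \<kappa> + N1 {k..} \<kappa>))) \<le> C * lq r UNIV (main \<kappa>)"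
proof -
  obtain C \<delta> where "C < top" "0 < \<delta>" "\<And>\<kappa> k. ennreal (wt k) * (ennreal (\<rho> k) * (I2 k \<kappa> + N1 {k..} \<kappa>)) \<le> C * env \<delta> (main \<kappa>) k"
    using N1_env[OF assms(1)] by blast
  then show ?thesis by (rule lq_env_bound[OF assms(2)])
qed

lemma lq_H_le:
  assumes "0 < r"
  shows "lq r UNIV (\<lambda>k. ennreal (wt k) * H k \<kappa>) \<le> quasi_const r *
    (lq r UNIV (\<lambda>k. ennreal (wt k) * N0 {..k} \<kappa>) +
     lq r UNIV (\<lambda>k. ennreal (wt k) * (ennreal (\<rho> k) * (I2 k \<kappa> + N1 {k..} \<kappa>))))"
  unfolding H_def distrib_left[of "ennreal (wt _)"] by (rule lq_add_le[OF assms])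

lemma lq_H_ge:
  assumes "0 < r"
  shows "lq r UNIV (\<lambda>k. ennreal (wt k) * N0 {..k} \<kappa>) \<le> lq r UNIV (\<lambda>k. ennreal (wt k) * H k \<kappa>)"
    "lq r UNIV (\<lambda>k. ennreal (wt k) * (ennreal (\<rho> k) * (I2 k \<kappa> + N1 {k..} \<kappa>))) \<le> lq r UNIV (\<lambda>k. ennreal (wt k) * H k \<kappa>)"
  unfolding H_def by (intro lq_mono assms mult_left_mono; simp)+

end

lemma env_le:
  assumes "0 < \<delta>" "\<And>l. D l \<le> v"
  shows "env \<delta> D k \<le> v"
  unfolding env_def
proof (rule SUP_least)
  fix l
  show "ennreal (pw (- \<delta>) k l) * D l \<le> v"
    using mult_mono[OF ennreal_decay_le_one[OF assms(1), of "k - l"] assms(2)[of l]] by simp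
qed

lemma dsv_1: "dsv (\<lambda>_. 1)"
  using dsv_powr[OF dsv(1), of 0] pos(1) by (simp add: less_imp_neq[symmetric])

text \<open>The case \<theta> = 1, \<alpha> = 1 of \<open>N0_env\<close>: \<open>main\<close> is
  then \<open>S1 k * \<kappa> k\<close>, bounded by \<open>N1 UNIV \<kappa>\<close>, and so is its
  envelope. This controls the first term of \<open>H\<close> on the second endpoint space.\<close>

lemma N0_le_N1:
  "\<exists>C<top. \<forall>\<kappa> k. quasiconcave \<kappa> \<longrightarrow> N0 {..k} \<kappa> \<le> C * (ennreal (\<rho> k) * N1 UNIV \<kappa>)"
proof -
  obtain C \<delta> where C: "C < top" "0 < \<delta>"
    "\<And>\<kappa> k. ennreal (wt (\<lambda>_. 1) 1 k) * N0 {..k} \<kappa> \<le> C * env \<delta> (main (\<lambda>_. 1) 1 \<kappa>) k"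
    using N0_env[OF dsv_1, of 1] by auto
  have w: "ennreal (wt (\<lambda>_. 1) 1 k) * (ennreal (\<rho> k) * u) = u" "ennreal (\<rho> k) * (ennreal (wt (\<lambda>_. 1) 1 k) * u) = u" for k u
    using pos(13)[of k] by (simp_all add: wt_def[OF dsv_1] ennreal_mult_eq powr_minus)
  have "N0 {..k} \<kappa> \<le> C * (ennreal (\<rho> k) * N1 UNIV \<kappa>)" if q: "quasiconcave \<kappa>" for \<kappa> k
  proof -
    have "main (\<lambda>_. 1) 1 \<kappa> l \<le> N1 UNIV \<kappa>" for l
      unfolding main_def[OF dsv_1] S0_mult w by (rule N1_lower_UNIV[OF q])
    then have "C * env \<delta> (main (\<lambda>_. 1) 1 \<kappa>) k \<le> C * N1 UNIV \<kappa>" by (intro mult_left_mono env_le C) auto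
    with C(3)[of k \<kappa>] have "ennreal (wt (\<lambda>_. 1) 1 k) * N0 {..k} \<kappa> \<le> C * N1 UNIV \<kappa>" by (rule order_trans)
    then have "ennreal (\<rho> k) * (ennreal (wt (\<lambda>_. 1) 1 k) * N0 {..k} \<kappa>) \<le> ennreal (\<rho> k) * (C * N1 UNIV \<kappa>)"
      by (rule mult_left_mono) simp
    then show ?thesis by (simp only: w mult.left_commute)
  qed
  then show ?thesis using C(1) by blast
qed

text \<open>The case \<theta> = 0, \<alpha> = 1 of \<open>N1_env\<close>: \<open>main\<close> is
  \<open>S0 k * \<kappa> k\<close>, bounded by \<open>N0 UNIV \<kappa>\<close>. This controls the
  second term of \<open>H\<close> on the first endpoint space.\<close>

lemma N1_le_N0:
  "\<exists>C<top. \<forall>\<kappa> k. ennreal (\<rho> k) * (I2 k \<kappa> + N1 {k..} \<kappa>) \<le> C * N0 UNIV \<kappa>"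
proof -
  have w: "wt (\<lambda>_. 1) 0 k = 1" for k using pos(13)[of k] by (simp add: wt_def[OF dsv_1])
  obtain C \<delta> where C: "C < top" "0 < \<delta>"
    "\<And>\<kappa> k. ennreal (wt (\<lambda>_. 1) 0 k) * (ennreal (\<rho> k) * (I2 k \<kappa> + N1 {k..} \<kappa>)) \<le> C * env \<delta> (main (\<lambda>_. 1) 0 \<kappa>) k"
    using N1_env[OF dsv_1, of 0] by auto
  have le: "C * env \<delta> (main (\<lambda>_. 1) 0 \<kappa>) k \<le> C * N0 UNIV \<kappa>" for \<kappa> k
    by (intro mult_left_mono env_le C) (simp_all add: main_def[OF dsv_1] w N0_lower_UNIV)
  have "ennreal (\<rho> k) * (I2 k \<kappa> + N1 {k..} \<kappa>) \<le> C * N0 UNIV \<kappa>" for \<kappa> k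
    using order_trans[OF C(3)[of k \<kappa>] le[of \<kappa> k]] by (simp add: w)
  then show ?thesis using C(1) by blast
qed

end

section \<open>The K-functional\<close>

text \<open>The elementary facts on K are based on this alone, so that they apply to the R-spaces
  without a proof that those are quasi-normed.\<close>

definition nonneg_norm :: "'a qspace \<Rightarrow> bool" where
  "nonneg_norm X \<longleftrightarrow> (\<forall>f\<in>qcarrier X. 0 \<le> qnorm X f)"

lemma nonneg_norm_space_of: "nonneg_norm (space_of X Y \<Phi>)"
  by (simp add: nonneg_norm_def space_of_def)

context
  fixes X Y :: "'a::real_vector qspace"
  assumes X: "nonneg_norm X" and Y: "nonneg_norm Y"
begin

abbreviation (input) "K_set t f \<equiv> {qnorm X f\<^sub>0 + t * qnorm Y f\<^sub>1 | f\<^sub>0 f\<^sub>1.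
            f\<^sub>0 \<in> qcarrier X \<and> f\<^sub>1 \<in> qcarrier Y \<and> f = f\<^sub>0 + f\<^sub>1}"

lemma K_set_bounds:
  assumes "0 \<le> t"
  shows "\<And>x. x \<in> K_set t f \<Longrightarrow> 0 \<le> x" "bdd_below (K_set t f)"
proof -
  show *: "0 \<le> x" if "x \<in> K_set t f" for x
    using that X Y assms by (auto simp: nonneg_norm_def)
  show "bdd_below (K_set t f)" by (rule bdd_belowI[of _ 0]) (rule *)
qed

lemma K_fun_le:
  assumes "0 \<le> t" "f\<^sub>0 \<in> qcarrier X" "f\<^sub>1 \<in> qcarrier Y" "f = f\<^sub>0 + f\<^sub>1"
  shows "K_fun X Y t f \<le> qnorm X f\<^sub>0 + t * qnorm Y f\<^sub>1"
  unfolding K_fun_def by (rule cInf_lower[OF _ K_set_bounds(2)[OF assms(1)]]) (use assms in blast)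

lemma K_fun_ge:
  assumes "f \<in> sum_carrier X Y"
    and "\<And>f\<^sub>0 f\<^sub>1. f\<^sub>0 \<in> qcarrier X \<Longrightarrow> f\<^sub>1 \<in> qcarrier Y \<Longrightarrow> f = f\<^sub>0 + f\<^sub>1 \<Longrightarrow> c \<le> qnorm X f\<^sub>0 + t * qnorm Y f\<^sub>1"
  shows "c \<le> K_fun X Y t f"
  unfolding K_fun_def using assms by (intro cInf_greatest) (auto simp: sum_carrier_def)

lemma K_fun_approx:
  assumes "f \<in> sum_carrier X Y" "K_fun X Y t f < c"
  obtains f\<^sub>0 f\<^sub>1 where "f\<^sub>0 \<in> qcarrier X" "f\<^sub>1 \<in> qcarrier Y" "f = f\<^sub>0 + f\<^sub>1" "qnorm X f\<^sub>0 + t * qnorm Y f\<^sub>1 < c"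
proof -
  have "K_set t f \<noteq> {}" using assms(1) by (auto simp: sum_carrier_def)
  from cInf_lessD[OF this, of c] assms(2) that show thesis unfolding K_fun_def by blast
qed

lemma K_fun_nonneg: "f \<in> sum_carrier X Y \<Longrightarrow> 0 \<le> t \<Longrightarrow> 0 \<le> K_fun X Y t f"
  by (rule K_fun_ge) (use X Y in \<open>auto simp: nonneg_norm_def\<close>)

lemma K_fun_mono:
  assumes "f \<in> sum_carrier X Y" "0 \<le> s" "s \<le> t"
  shows "K_fun X Y s f \<le> K_fun X Y t f"
proof (rule K_fun_ge[OF assms(1)])
  fix f\<^sub>0 f\<^sub>1 assume *: "f\<^sub>0 \<in> qcarrier X" "f\<^sub>1 \<in> qcarrier Y" "f = f\<^sub>0 + f\<^sub>1"
  have "s * qnorm Y f\<^sub>1 \<le> t * qnorm Y f\<^sub>1" using Y * assms by (intro mult_right_mono) (auto simp: nonneg_norm_def)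
  then show "K_fun X Y s f \<le> qnorm X f\<^sub>0 + t * qnorm Y f\<^sub>1" using K_fun_le[OF assms(2) *] by linarith
qed

lemma K_fun_quasiconcave:
  assumes "f \<in> sum_carrier X Y" "0 < s" "s \<le> t"
  shows "(s / t) * K_fun X Y t f \<le> K_fun X Y s f"
proof (rule K_fun_ge[OF assms(1)])
  fix f\<^sub>0 f\<^sub>1 assume *: "f\<^sub>0 \<in> qcarrier X" "f\<^sub>1 \<in> qcarrier Y" "f = f\<^sub>0 + f\<^sub>1"
  have t: "0 < t" using assms by simp
  have "(s / t) * K_fun X Y t f \<le> (s / t) * (qnorm X f\<^sub>0 + t * qnorm Y f\<^sub>1)"
    using K_fun_le[of t f\<^sub>0 f\<^sub>1 f] * assms t by (intro mult_left_mono) auto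
  also have "\<dots> = (s / t) * qnorm X f\<^sub>0 + s * qnorm Y f\<^sub>1" using t by (simp add: distrib_left)
  also have "\<dots> \<le> 1 * qnorm X f\<^sub>0 + s * qnorm Y f\<^sub>1"
    using X Y * assms by (intro add_mono mult_right_mono) (auto simp: nonneg_norm_def)
  finally show "(s / t) * K_fun X Y t f \<le> qnorm X f\<^sub>0 + s * qnorm Y f\<^sub>1" by simp
qed

text \<open>When the argument changes by a factor at most 2, K changes by at most 2, by monotonicity
  or quasiconcavity, and t^(-\<theta>) by at most 2 because \<theta> lies in [0,1]; hence 4.\<close>

lemma comparable_K_fun:
  assumes f: "f \<in> sum_carrier X Y" and \<theta>: "0 \<le> \<theta>" "\<theta> \<le> 1"
  shows "comparable 4 (\<lambda>t. ennreal (t powr (- \<theta>) * K_fun X Y t f))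
    (\<lambda>k. ennreal (dyad k powr (- \<theta>) * K_fun X Y (dyad k) f))"
proof -
  have "comparable (ennreal (max 1 4)) (\<lambda>t. ennreal (t powr (- \<theta>) * K_fun X Y t f))
    (\<lambda>k. ennreal (dyad k powr (- \<theta>) * K_fun X Y (dyad k) f))"
  proof (rule comparableI)
    fix s t :: real assume st: "0 < s" "0 < t" "s \<le> 2 * t" "t \<le> 2 * s"
    have "K_fun X Y s f \<le> 2 * K_fun X Y t f"
    proof (cases "s \<le> t")
      case True
      then show ?thesis using K_fun_mono[OF f, of s t] K_fun_nonneg[OF f, of t] st by simp
    next
      case False
      then have "K_fun X Y s f \<le> (s / t) * K_fun X Y t f"
        using K_fun_quasiconcave[OF f, of t s] st by (simp add: field_simps)
      also have "\<dots> \<le> 2 * K_fun X Y t f"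
        using K_fun_nonneg[OF f, of t] st by (intro mult_right_mono) (auto simp: field_simps)
      finally show ?thesis .
    qed
    moreover have "s powr (- \<theta>) \<le> 2 * t powr (- \<theta>)"
    proof -
      have "s powr (- \<theta>) \<le> (t / 2) powr (- \<theta>)"
        using st \<theta> by (intro powr_mono2') auto
      also have "\<dots> = 2 powr \<theta> * t powr (- \<theta>)" using st by (simp add: powr_divide powr_minus field_simps)
      also have "\<dots> \<le> 2 * t powr (- \<theta>)"
        using powr_mono[of \<theta> 1 2] \<theta> by (intro mult_right_mono) auto
      finally show ?thesis .
    qed
    ultimately have "s powr (- \<theta>) * K_fun X Y s f \<le> (2 * t powr (- \<theta>)) * (2 * K_fun X Y t f)"
      using K_fun_nonneg[OF f, of s] st by (intro mult_mono) auto
    then show "s powr (- \<theta>) * K_fun X Y s f \<le> 4 * (t powr (- \<theta>) * K_fun X Y t f)" by simp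
  qed (use K_fun_nonneg[OF f] in auto)
  then show ?thesis by simp
qed

end

text \<open>If K vanished, f would be a sum of two parts small enough to lie in any neighbourhoods
  of 0, so continuity of addition would place f in every neighbourhood of 0, against the Hausdorff
  property. Positivity makes 2K strictly larger than K, which gives near-optimal
  decompositions.\<close>

lemma K_fun_pos:
  assumes X: "quasi_normed X" and Y: "quasi_normed Y" and comp: "compatible_couple X Y"
    and f: "f \<in> sum_carrier X Y" "f \<noteq> 0" and t: "0 < t"
  shows "0 < K_fun X Y t f"
proof (rule ccontr)
  assume *: "\<not> 0 < K_fun X Y t f"
  have nn: "nonneg_norm X" "nonneg_norm Y" using X Y by (auto simp: quasi_normed_def nonneg_norm_def)
  obtain T where T: "topspace T = UNIV" "Hausdorff_space T"
    "continuous_map (prod_topology T T) T (\<lambda>(f, g). f + g)"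
    "continuously_included X T" "continuously_included Y T"
    using comp unfolding compatible_couple_def hausdorff_vector_topology_def by blast
  from T(2) f(2) obtain U V where UV: "openin T U" "openin T V" "0 \<in> U" "f \<in> V" "disjnt U V"
    unfolding Hausdorff_space_def T(1) by (metis UNIV_I)
  let ?W = "{p \<in> topspace (prod_topology T T). (case p of (x, y) \<Rightarrow> x + y) \<in> U}"
  have "openin (prod_topology T T) ?W"
    using T(3) UV(1) by (rule openin_continuous_map_preimage)
  moreover have "(0, 0) \<in> ?W" using UV(3) T(1) by simp
  ultimately have "\<exists>V0 V1. openin T V0 \<and> openin T V1 \<and> 0 \<in> V0 \<and> 0 \<in> V1 \<and> V0 \<times> V1 \<subseteq> ?W"
    by (simp only: openin_prod_topology_alt)
  then obtain V0 V1 where V: "openin T V0" "openin T V1" "0 \<in> V0" "0 \<in> V1" "V0 \<times> V1 \<subseteq> ?W"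
    by (elim exE conjE)
  have z: "0 \<in> qcarrier X" "0 \<in> qcarrier Y" using X Y by (auto simp: quasi_normed_def subspace_0)
  have "0 \<in> qcarrier X \<inter> V0" using z V(3) by blast
  with T(4) V(1) obtain e0 where e0: "0 < e0" "\<And>g. g \<in> qcarrier X \<Longrightarrow> qnorm X (g - 0) < e0 \<Longrightarrow> g \<in> V0"
    unfolding continuously_included_def by meson
  have "0 \<in> qcarrier Y \<inter> V1" using z V(4) by blast
  with T(5) V(2) obtain e1 where e1: "0 < e1" "\<And>g. g \<in> qcarrier Y \<Longrightarrow> qnorm Y (g - 0) < e1 \<Longrightarrow> g \<in> V1"
    unfolding continuously_included_def by meson
  \<comment> \<open>The bound t * e1 becomes e1 for the second part after division by t.\<close>
  have "K_fun X Y t f < min e0 (t * e1)" using * e0(1) mult_pos_pos[OF t e1(1)] by simp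
  from K_fun_approx[OF nn f(1) this] obtain f0 f1 where
    d: "f0 \<in> qcarrier X" "f1 \<in> qcarrier Y" "f = f0 + f1" "qnorm X f0 + t * qnorm Y f1 < min e0 (t * e1)" by blast
  have "0 \<le> qnorm X f0" "0 \<le> t * qnorm Y f1" using nn d t by (auto simp: nonneg_norm_def)
  then have "qnorm X f0 < e0" "t * qnorm Y f1 < t * e1" using d(4) by auto
  then have "f0 \<in> V0" "f1 \<in> V1" using e0(2) e1(2) d t by auto
  then have "f \<in> U" using V(5) d(3) by auto
  then show False using UV by (auto simp: disjnt_iff)
qed

lemma quasi_normed_diff:
  assumes "quasi_normed X"
  shows "\<exists>C\<ge>1. \<forall>f\<in>qcarrier X. \<forall>g\<in>qcarrier X.
     qnorm X (f + g) \<le> C * (qnorm X f + qnorm X g) \<and> qnorm X (f - g) \<le> C * (qnorm X f + qnorm X g)"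
proof -
  obtain C where C: "1 \<le> C" "\<And>f g. f \<in> qcarrier X \<Longrightarrow> g \<in> qcarrier X \<Longrightarrow> qnorm X (f + g) \<le> C * (qnorm X f + qnorm X g)"
  proof -
    have "\<exists>C\<ge>1. \<forall>f\<in>qcarrier X. \<forall>g\<in>qcarrier X. qnorm X (f + g) \<le> C * (qnorm X f + qnorm X g)"
      using assms unfolding quasi_normed_def by (elim conjE)
    then show thesis using that by blast
  qed
  have "qnorm X (f - g) \<le> C * (qnorm X f + qnorm X g)" if "f \<in> qcarrier X" "g \<in> qcarrier X" for f g
  proof -
    have "(-1) *\<^sub>R g \<in> qcarrier X" using that assms by (simp add: quasi_normed_def subspace_neg)
    moreover have "qnorm X ((-1) *\<^sub>R g) = qnorm X g"
    proof -
      have "\<forall>c. qnorm X (c *\<^sub>R g) = \<bar>c\<bar> * qnorm X g" using assms that unfolding quasi_normed_def by simp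
      then show ?thesis by (simp only:)
    qed
    ultimately show ?thesis using C(2)[of f "(-1) *\<^sub>R g"] that by simp
  qed
  then show ?thesis using C by blast
qed

lemma sum_carrier_closed:
  assumes "quasi_normed X" "quasi_normed Y" "f \<in> sum_carrier X Y" "g \<in> sum_carrier X Y"
  shows "f + g \<in> sum_carrier X Y" "f - g \<in> sum_carrier X Y"
proof -
  obtain f0 f1 g0 g1 where *: "f = f0 + f1" "g = g0 + g1" "f0 \<in> qcarrier X" "g0 \<in> qcarrier X" "f1 \<in> qcarrier Y" "g1 \<in> qcarrier Y"
    using assms unfolding sum_carrier_def by blast
  have "f + g = (f0 + g0) + (f1 + g1)" "f - g = (f0 - g0) + (f1 - g1)" by (simp_all add: *)
  moreover have "f0 + g0 \<in> qcarrier X" "f0 - g0 \<in> qcarrier X" "f1 + g1 \<in> qcarrier Y" "f1 - g1 \<in> qcarrier Y"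
    using * assms by (auto simp: quasi_normed_def subspace_add subspace_diff)
  ultimately show "f + g \<in> sum_carrier X Y" "f - g \<in> sum_carrier X Y"
    unfolding sum_carrier_def by blast+
qed

text \<open>Differences are included because each part of a split is also estimated as f minus the
  other part.\<close>

lemma K_fun_triangle:
  assumes X: "quasi_normed X" and Y: "quasi_normed Y"
  shows "\<exists>C\<ge>1. \<forall>f\<in>sum_carrier X Y. \<forall>g\<in>sum_carrier X Y. \<forall>t\<ge>0.
     K_fun X Y t (f + g) \<le> C * (K_fun X Y t f + K_fun X Y t g) \<and>
     K_fun X Y t (f - g) \<le> C * (K_fun X Y t f + K_fun X Y t g)"
proof -
  have nn: "nonneg_norm X" "nonneg_norm Y" using X Y by (auto simp: quasi_normed_def nonneg_norm_def)
  have sub: "subspace (qcarrier X)" "subspace (qcarrier Y)" using X Y by (auto simp: quasi_normed_def)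
  from quasi_normed_diff[OF X] obtain C where C: "1 \<le> C"
    "\<And>f g. f \<in> qcarrier X \<Longrightarrow> g \<in> qcarrier X \<Longrightarrow> qnorm X (f + g) \<le> C * (qnorm X f + qnorm X g)"
    "\<And>f g. f \<in> qcarrier X \<Longrightarrow> g \<in> qcarrier X \<Longrightarrow> qnorm X (f - g) \<le> C * (qnorm X f + qnorm X g)" by blast
  from quasi_normed_diff[OF Y] obtain D where D: "1 \<le> D"
    "\<And>f g. f \<in> qcarrier Y \<Longrightarrow> g \<in> qcarrier Y \<Longrightarrow> qnorm Y (f + g) \<le> D * (qnorm Y f + qnorm Y g)"
    "\<And>f g. f \<in> qcarrier Y \<Longrightarrow> g \<in> qcarrier Y \<Longrightarrow> qnorm Y (f - g) \<le> D * (qnorm Y f + qnorm Y g)" by blast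
  define E where "E = max C D"
  have E: "1 \<le> E" using C(1) by (simp add: E_def)
  have main: "K_fun X Y t h \<le> E * (K_fun X Y t f + K_fun X Y t g)"
    if f: "f \<in> sum_carrier X Y" and g: "g \<in> sum_carrier X Y" and t: "0 \<le> t" and h: "h = f + g \<or> h = f - g" for f g h t
  proof -
    have "K_fun X Y t h / E \<le> K_fun X Y t f + K_fun X Y t g"
    proof (rule field_le_epsilon)
      fix e :: real assume "0 < e"
      then have "K_fun X Y t f < K_fun X Y t f + e / 2" "K_fun X Y t g < K_fun X Y t g + e / 2" by auto
      from K_fun_approx[OF nn f this(1)] K_fun_approx[OF nn g this(2)] obtain f0 f1 g0 g1 where
        d: "f0 \<in> qcarrier X" "f1 \<in> qcarrier Y" "f = f0 + f1" "qnorm X f0 + t * qnorm Y f1 < K_fun X Y t f + e / 2"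
        "g0 \<in> qcarrier X" "g1 \<in> qcarrier Y" "g = g0 + g1" "qnorm X g0 + t * qnorm Y g1 < K_fun X Y t g + e / 2"
        by metis
      have le: "C * (qnorm X f0 + qnorm X g0) \<le> E * (qnorm X f0 + qnorm X g0)"
        "D * (qnorm Y f1 + qnorm Y g1) \<le> E * (qnorm Y f1 + qnorm Y g1)"
        using nn d by (auto simp: E_def nonneg_norm_def intro!: mult_right_mono)
      have "\<exists>h0 h1. h0 \<in> qcarrier X \<and> h1 \<in> qcarrier Y \<and> h = h0 + h1 \<and>
         qnorm X h0 \<le> E * (qnorm X f0 + qnorm X g0) \<and> qnorm Y h1 \<le> E * (qnorm Y f1 + qnorm Y g1)"
        using h
      proof
        assume "h = f + g"
        then show ?thesis using d le C(2)[OF d(1,5)] D(2)[OF d(2,6)] sub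
          by (intro exI[of _ "f0 + g0"] exI[of _ "f1 + g1"]) (auto simp: subspace_add)
      next
        assume "h = f - g"
        then show ?thesis using d le C(3)[OF d(1,5)] D(3)[OF d(2,6)] sub
          by (intro exI[of _ "f0 - g0"] exI[of _ "f1 - g1"]) (auto simp: subspace_diff)
      qed
      then obtain h0 h1 where h01: "h0 \<in> qcarrier X" "h1 \<in> qcarrier Y" "h = h0 + h1"
        "qnorm X h0 \<le> E * (qnorm X f0 + qnorm X g0)" "qnorm Y h1 \<le> E * (qnorm Y f1 + qnorm Y g1)" by blast
      have "K_fun X Y t h \<le> qnorm X h0 + t * qnorm Y h1" by (rule K_fun_le[OF nn t h01(1-3)])
      also have "\<dots> \<le> E * (qnorm X f0 + qnorm X g0) + t * (E * (qnorm Y f1 + qnorm Y g1))"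
        using h01 t by (intro add_mono mult_left_mono) auto
      also have "\<dots> = E * ((qnorm X f0 + t * qnorm Y f1) + (qnorm X g0 + t * qnorm Y g1))" by (simp add: algebra_simps)
      also have "\<dots> \<le> E * (K_fun X Y t f + K_fun X Y t g + e)"
        using d E by (intro mult_left_mono) auto
      finally show "K_fun X Y t h / E \<le> K_fun X Y t f + K_fun X Y t g + e"
        using E by (simp add: divide_le_eq mult.commute)
    qed
    then show ?thesis using E by (simp add: divide_le_eq mult.commute)
  qed
  then show ?thesis using E by (intro exI[of _ E]) blast
qed

section \<open>Sampled weights\<close>

text \<open>For finite positive weights. The notion passes to products, quotients, powers and images
  under functions in \<open>SV\<close>, which is how the weights of the statement are built, and it
  requires no measurability of them.\<close>

definition sampled :: "(real \<Rightarrow> real) \<Rightarrow> (int \<Rightarrow> real) \<Rightarrow> bool" where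
  "sampled g x \<longleftrightarrow> (\<forall>t>0. 0 < g t) \<and> (\<forall>k. 0 < x k) \<and>
     (\<exists>C\<ge>1. \<forall>t>0. g t \<le> C * x (dlog t) \<and> x (dlog t) \<le> C * g t)"

lemma sampledE:
  assumes "sampled g x"
  obtains C where "1 \<le> C" "\<And>t. 0 < t \<Longrightarrow> g t \<le> C * x (dlog t)" "\<And>t. 0 < t \<Longrightarrow> x (dlog t) \<le> C * g t"
  using assms unfolding sampled_def by blast

lemma sampled_pos: "sampled g x \<Longrightarrow> 0 < t \<Longrightarrow> 0 < g t" "sampled g x \<Longrightarrow> 0 < x k"
  by (auto simp: sampled_def)

lemma sampled_mult:
  assumes g: "sampled g x" and h: "sampled h y"
  shows "sampled (\<lambda>t. g t * h t) (\<lambda>k. x k * y k)"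
proof -
  obtain C where C: "1 \<le> C" "\<And>t. 0 < t \<Longrightarrow> g t \<le> C * x (dlog t)" "\<And>t. 0 < t \<Longrightarrow> x (dlog t) \<le> C * g t" using sampledE[OF g] by blast
  obtain D where D: "1 \<le> D" "\<And>t. 0 < t \<Longrightarrow> h t \<le> D * y (dlog t)" "\<And>t. 0 < t \<Longrightarrow> y (dlog t) \<le> D * h t" using sampledE[OF h] by blast
  have mm: "u * v \<le> C * D * (u' * v')" if "u \<le> C * u'" "v \<le> D * v'" "0 < u" "0 < v" for u v u' v'
  proof -
    have "u * v \<le> (C * u') * (D * v')" using that by (intro mult_mono) auto
    then show ?thesis by (simp add: ac_simps)
  qed
  have "1 \<le> C * D" using mult_mono[OF C(1) D(1)] C(1) D(1) by simp
  then show ?thesis unfolding sampled_def using sampled_pos[OF g] sampled_pos[OF h]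
    by (intro conjI exI[of _ "C * D"] allI impI mm C D) (auto simp: C D)
qed

lemma sampled_inverse:
  assumes g: "sampled g x"
  shows "sampled (\<lambda>t. inverse (g t)) (\<lambda>k. inverse (x k))"
proof -
  obtain C where C: "1 \<le> C" "\<And>t. 0 < t \<Longrightarrow> g t \<le> C * x (dlog t)" "\<And>t. 0 < t \<Longrightarrow> x (dlog t) \<le> C * g t" using sampledE[OF g] by blast
  have inv: "inverse u \<le> C * inverse v" if "v \<le> C * u" "0 < u" "0 < v" for u v
    using that by (simp add: field_simps)
  show ?thesis unfolding sampled_def using sampled_pos[OF g] C
    by (intro conjI exI[of _ C] allI impI inv) auto
qed

lemma sampled_divide: "sampled g x \<Longrightarrow> sampled h y \<Longrightarrow> sampled (\<lambda>t. g t / h t) (\<lambda>k. x k / y k)"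
  unfolding divide_inverse by (intro sampled_mult sampled_inverse)

lemma sampled_powr:
  assumes g: "sampled g x"
  shows "sampled (\<lambda>t. g t powr s) (\<lambda>k. x k powr s)"
proof -
  have nn: "sampled (\<lambda>t. g t powr s) (\<lambda>k. x k powr s)" if s: "0 \<le> s" for s
  proof -
    obtain C where C: "1 \<le> C" "\<And>t. 0 < t \<Longrightarrow> g t \<le> C * x (dlog t)" "\<And>t. 0 < t \<Longrightarrow> x (dlog t) \<le> C * g t" using sampledE[OF g] by blast
    have pm: "u powr s \<le> C powr s * v powr s" if "u \<le> C * v" "0 < u" "0 < v" for u v
    proof -
      have "u powr s \<le> (C * v) powr s" using that s by (intro powr_mono2) auto
      then show ?thesis using that C(1) by (simp add: powr_mult)
    qed
    have "1 \<le> C powr s" using C(1) s by (rule ge_one_powr_ge_zero)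
    then show ?thesis unfolding sampled_def using sampled_pos[OF g]
      by (intro conjI exI[of _ "C powr s"] allI impI pm C) (auto simp: less_imp_neq[symmetric])
  qed
  show ?thesis
  proof (cases "0 \<le> s")
    case False
    then have "sampled (\<lambda>t. inverse (g t powr (- s))) (\<lambda>k. inverse (x k powr (- s)))"
      by (intro sampled_inverse nn) simp
    then show ?thesis by (simp add: powr_minus)
  qed (rule nn)
qed

lemma sampled_id: "sampled (\<lambda>t. t) dyad"
  unfolding sampled_def using dlog_lower dlog_upper
  by (intro conjI exI[of _ 2]) (auto simp: less_imp_le intro: order_trans[OF dlog_lower])

lemma sampled_SV_compose:
  assumes b: "b \<in> SV" and g: "sampled g x"
  shows "sampled (\<lambda>t. b (g t)) (\<lambda>k. b (x k))"
proof -
  obtain C where C: "1 \<le> C" "\<And>t. 0 < t \<Longrightarrow> g t \<le> C * x (dlog t)" "\<And>t. 0 < t \<Longrightarrow> x (dlog t) \<le> C * g t" using sampledE[OF g] by blast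
  from SV_growth[OF b, of 1] obtain D where D: "0 < D"
    "\<And>s t. 0 < s \<Longrightarrow> 0 < t \<Longrightarrow> b s \<le> D * max (s / t) (t / s) powr 1 * b t" by auto
  have near: "b u \<le> max 1 (D * C) * b v" if uv: "u \<le> C * v" "v \<le> C * u" "0 < u" "0 < v" for u v
  proof -
    have "u / v \<le> C" "v / u \<le> C" using uv by (simp_all add: divide_le_eq)
    then have "max (u / v) (v / u) powr 1 \<le> C" using uv by (simp add: le_max_iff_disj)
    then have "D * max (u / v) (v / u) powr 1 * b v \<le> D * C * b v"
      using D(1) SV_pos[OF b uv(4)] by (intro mult_right_mono mult_left_mono) auto
    also have "\<dots> \<le> max 1 (D * C) * b v" using SV_pos[OF b uv(4)] by (intro mult_right_mono) auto
    finally show ?thesis using D(2)[OF uv(3,4)] by linarith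
  qed
  show ?thesis unfolding sampled_def using sampled_pos[OF g] SV_pos[OF b] C
    by (intro conjI exI[of _ "max 1 (D * C)"] allI impI near) auto
qed

lemma sampled_SV: "b \<in> SV \<Longrightarrow> sampled b (\<lambda>k. b (dyad k))"
  using sampled_SV_compose[OF _ sampled_id] .

text \<open>The two bounds force \<open>F t\<close> to be finite and positive, so
  \<open>enn2real\<close> never falls back to its value 0 at infinity.\<close>

lemma sampled_enn2real:
  assumes le0: "\<And>t. 0 < t \<Longrightarrow> F t \<le> M0 * ennreal (x (dlog t))" "\<And>t. 0 < t \<Longrightarrow> ennreal (x (dlog t)) \<le> M1 * F t"
    and M01: "M0 < top" "M1 < top" and x: "\<And>k. 0 < x k"
  shows "sampled (\<lambda>t. enn2real (F t)) x"
proof -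
  define M where "M = M0 + M1"
  have M: "M < top" using M01 by (simp add: M_def)
  have le: "F t \<le> M * ennreal (x (dlog t))" "ennreal (x (dlog t)) \<le> M * F t" if "0 < t" for t
    using le0[OF that] by (auto simp: M_def distrib_right add_increasing add_increasing2)
  have fin: "F t < top" if "0 < t" for t
    using M by (intro le_less_trans[OF le(1)[OF that]]) (simp add: ennreal_mult_less_top)
  define m where "m = max 1 (enn2real M)"
  have Mm: "M \<le> ennreal m"
  proof -
    have "M = ennreal (enn2real M)" using M by simp
    also have "\<dots> \<le> ennreal m" unfolding m_def by (intro ennreal_leI) simp
    finally show ?thesis .
  qed
  have le': "enn2real (F t) \<le> m * x (dlog t) \<and> x (dlog t) \<le> m * enn2real (F t)" if t: "0 < t" for t
  proof
    have "ennreal (enn2real (F t)) \<le> ennreal m * ennreal (x (dlog t))"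
      using le(1)[OF t] mult_right_mono[OF Mm, of "ennreal (x (dlog t))"] fin[OF t] by simp
    also have "\<dots> = ennreal (m * x (dlog t))" using x[of "dlog t"] by (simp add: ennreal_mult'')
    finally show "enn2real (F t) \<le> m * x (dlog t)"
      using x[of "dlog t"] by (subst (asm) ennreal_le_iff) (auto simp: m_def)
    have "ennreal (x (dlog t)) \<le> ennreal m * ennreal (enn2real (F t))"
      using le(2)[OF t] mult_right_mono[OF Mm, of "F t"] fin[OF t] by simp
    also have "\<dots> = ennreal (m * enn2real (F t))" by (simp add: ennreal_mult'')
    finally show "x (dlog t) \<le> m * enn2real (F t)"
      by (subst (asm) ennreal_le_iff) (auto simp: m_def)
  qed
  have "0 < enn2real (F t)" if t: "0 < t" for t
  proof (rule ccontr)
    assume "\<not> ?thesis"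
    then have "enn2real (F t) = 0" using enn2real_nonneg[of "F t"] by linarith
    then show False using le'[OF t] x[of "dlog t"] by simp
  qed
  then show ?thesis unfolding sampled_def using x le' by (intro conjI exI[of _ m]) (auto simp: m_def)
qed

text \<open>Q depends on \<open>c\<close>, \<open>\<alpha>\<close>, \<open>r\<close> and
  \<open>M\<close> but not on F, as constants independent of f require.\<close>

lemma sampled_wnorm:
  assumes c: "sampled c \<alpha>" and r: "0 < r" and M: "1 \<le> M" "M < top"
  shows "\<exists>Q<top. \<forall>F z. (\<forall>t>0. F t \<le> M * z (dlog t) \<and> z (dlog t) \<le> M * F t) \<longrightarrow>
     wnorm r c {0<..} F \<le> Q * lq r UNIV (\<lambda>k. ennreal (\<alpha> k) * z k) \<and>
     lq r UNIV (\<lambda>k. ennreal (\<alpha> k) * z k) \<le> Q * wnorm r c {0<..} F"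
proof -
  obtain C where C: "1 \<le> C" "\<And>t. 0 < t \<Longrightarrow> c t \<le> C * \<alpha> (dlog t)" "\<And>t. 0 < t \<Longrightarrow> \<alpha> (dlog t) \<le> C * c t" using sampledE[OF c] by blast
  let ?N = "ennreal C * M"
  have N: "1 \<le> ?N" "?N < top"
    using mult_mono[of 1 "ennreal C" 1 M] C(1) M by (auto simp: ennreal_mult_less_top)
  show ?thesis
  proof (intro exI[of _ "?N * (1 + ennreal (2 powr recip r))"] conjI allI impI)
    show "?N * (1 + ennreal (2 powr recip r)) < top" using N by (simp add: ennreal_mult_less_top)
    fix F z assume Fz: "\<forall>t>0. F t \<le> M * z (dlog t) \<and> z (dlog t) \<le> M * F t"
    let ?z = "\<lambda>k. ennreal (\<alpha> k) * z k"
    have "wnorm r c {0<..} F \<le> lq r UNIV (\<lambda>k. ?N * ?z k)"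
    proof (rule wnorm_le_lq[OF r])
      fix t :: real assume "t \<in> {0<..}"
      then have t: "0 < t" by simp
      have "ennreal (c t) \<le> ennreal C * ennreal (\<alpha> (dlog t))"
        using C(1) C(2)[OF t] by (simp flip: ennreal_mult' add: ennreal_leI)
      then have "ennreal (c t) * F t \<le> (ennreal C * ennreal (\<alpha> (dlog t))) * (M * z (dlog t))"
        using Fz t by (intro mult_mono) auto
      then show "dlog t \<in> UNIV \<and> ennreal (c t) * F t \<le> ?N * ?z (dlog t)" by (simp add: ac_simps)
    qed simp
    also have "\<dots> = ?N * lq r UNIV ?z" by (rule lq_cmult[OF r])
    also have "\<dots> \<le> ?N * (1 + ennreal (2 powr recip r)) * lq r UNIV ?z"
      by (intro mult_right_mono) (auto simp: distrib_left)
    finally show "wnorm r c {0<..} F \<le> ?N * (1 + ennreal (2 powr recip r)) * lq r UNIV ?z" .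
    have "lq r UNIV ?z \<le> ?N * ennreal (2 powr recip r) * wnorm r c {0<..} F"
    proof (rule lq_le_wnorm_scaled[OF r N])
      fix t :: real assume t: "0 < t"
      have "ennreal (\<alpha> (dlog t)) \<le> ennreal C * ennreal (c t)"
        using C(1) C(3)[OF t] by (simp flip: ennreal_mult' add: ennreal_leI)
      then have "?z (dlog t) \<le> (ennreal C * ennreal (c t)) * (M * F t)"
        using Fz t by (intro mult_mono) auto
      then show "t \<in> {0<..} \<and> ?z (dlog t) \<le> ?N * (ennreal (c t) * F t)" using t by (simp add: ac_simps)
    qed
    also have "\<dots> \<le> ?N * (1 + ennreal (2 powr recip r)) * wnorm r c {0<..} F"
      by (intro mult_right_mono) (auto simp: distrib_left)
    finally show "lq r UNIV ?z \<le> ?N * (1 + ennreal (2 powr recip r)) * wnorm r c {0<..} F" .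
  qed
qed

section \<open>Embeddings\<close>

text \<open>An embedding constant has to be positive, which \<open>C\<close> need not be; hence the
  added 1.\<close>

lemma cont_embedded_space_of:
  assumes C: "C < top"
    and le: "\<And>f. f \<in> sum_carrier X Y \<Longrightarrow> \<Phi> f < top \<Longrightarrow> f \<in> sum_carrier X' Y' \<and> \<Psi> f \<le> C * \<Phi> f"
  shows "cont_embedded (space_of X Y \<Phi>) (space_of X' Y' \<Psi>)"
proof -
  have *: "\<Psi> f < top" "enn2real (\<Psi> f) \<le> (enn2real C + 1) * enn2real (\<Phi> f)"
    if "f \<in> sum_carrier X Y" "\<Phi> f < top" for f
  proof -
    have lt: "C * \<Phi> f < top" using that C by (simp add: ennreal_mult_less_top)
    have l: "\<Psi> f \<le> C * \<Phi> f" using le that by blast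
    show "\<Psi> f < top" using l lt by (rule le_less_trans)
    have "enn2real (\<Psi> f) \<le> enn2real (C * \<Phi> f)" using l lt by (rule enn2real_mono)
    also have "\<dots> \<le> (enn2real C + 1) * enn2real (\<Phi> f)" by (simp add: enn2real_mult distrib_right)
    finally show "enn2real (\<Psi> f) \<le> (enn2real C + 1) * enn2real (\<Phi> f)" .
  qed
  have "0 < enn2real C + 1" by (simp add: add_nonneg_pos)
  then show ?thesis unfolding cont_embedded_def space_of_def using * le by auto
qed

lemma cont_embedded_trans:
  assumes "cont_embedded X Y" "cont_embedded Y Z"
  shows "cont_embedded X Z"
proof -
  obtain C where C: "0 < C" "\<And>f. f \<in> qcarrier X \<Longrightarrow> qnorm Y f \<le> C * qnorm X f" using assms unfolding cont_embedded_def by blast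
  obtain D where D: "0 < D" "\<And>f. f \<in> qcarrier Y \<Longrightarrow> qnorm Z f \<le> D * qnorm Y f" using assms unfolding cont_embedded_def by blast
  have s: "qcarrier X \<subseteq> qcarrier Y" "qcarrier Y \<subseteq> qcarrier Z" using assms unfolding cont_embedded_def by auto
  have "qnorm Z f \<le> D * C * qnorm X f" if "f \<in> qcarrier X" for f
  proof -
    have "qnorm Z f \<le> D * qnorm Y f" using D s that by blast
    also have "\<dots> \<le> D * (C * qnorm X f)" using C(2)[OF that] D(1) by simp
    finally show ?thesis by (simp add: mult.assoc)
  qed
  then show ?thesis unfolding cont_embedded_def using s C(1) D(1) by (intro conjI exI[of _ "D * C"]) auto
qed

lemma cont_embedded_inter:
  assumes X: "nonneg_norm X" and "cont_embedded X Y" "cont_embedded X Z"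
  shows "cont_embedded X (Y \<sqinter>\<^sub>q Z)"
proof -
  obtain C where C: "0 < C" "\<And>f. f \<in> qcarrier X \<Longrightarrow> qnorm Y f \<le> C * qnorm X f" using assms unfolding cont_embedded_def by blast
  obtain D where D: "0 < D" "\<And>f. f \<in> qcarrier X \<Longrightarrow> qnorm Z f \<le> D * qnorm X f" using assms unfolding cont_embedded_def by blast
  have "max (qnorm Y f) (qnorm Z f) \<le> max C D * qnorm X f" if "f \<in> qcarrier X" for f
  proof -
    have "0 \<le> qnorm X f" using X that by (simp add: nonneg_norm_def)
    then have "C * qnorm X f \<le> max C D * qnorm X f" "D * qnorm X f \<le> max C D * qnorm X f"
      by (auto intro: mult_right_mono)
    then show ?thesis using C(2)[OF that] D(2)[OF that] by linarith
  qed
  then show ?thesis using assms C(1) unfolding cont_embedded_def space_inter_def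
    by (intro conjI exI[of _ "max C D"]) auto
qed

lemma space_inter_embedded_sum:
  "cont_embedded (space_of X Y \<Phi> \<sqinter>\<^sub>q space_of X Y \<Psi> \<sqinter>\<^sub>q space_of X Y \<Xi>) (space_of X Y (\<lambda>f. \<Phi> f + \<Psi> f + \<Xi> f))"
  unfolding cont_embedded_def space_inter_def space_of_def
  by (intro conjI exI[of _ 3]) (auto simp: enn2real_plus)

text \<open>Carries a bound valid for each decomposition to the real infimum defining K. The added 1
  permits division, and \<open>x0\<close> makes H finite and the set nonempty.\<close>

lemma cInf_scale_ennreal:
  assumes "H \<le> C * ennreal x0" "x0 \<in> S" "C < top" and le: "\<And>x. x \<in> S \<Longrightarrow> 0 \<le> x \<and> H \<le> C * ennreal x"
  shows "H \<le> (C + 1) * ennreal (Inf S)"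
proof -
  define c h where "c = enn2real C + 1" and "h = enn2real H"
  have c: "0 < c" by (simp add: c_def add_nonneg_pos)
  have C: "C \<le> ennreal c" "ennreal c = C + 1" using assms(3) by (simp_all add: c_def ennreal_plus)
  have "H < top" using assms(1,3) by (auto intro: le_less_trans simp: ennreal_mult_less_top)
  then have H: "H = ennreal h" "0 \<le> h" by (auto simp: h_def)
  have "h / c \<le> Inf S"
  proof (rule cInf_greatest)
    show "S \<noteq> {}" using assms(2) by blast
    fix x assume x: "x \<in> S"
    have "H \<le> ennreal c * ennreal x" using le[OF x] C(1) by (meson mult_right_mono order_trans zero_le)
    then have "ennreal h \<le> ennreal (c * x)" using c by (simp add: H(1) ennreal_mult')
    then show "h / c \<le> x" using c le[OF x] by (subst (asm) ennreal_le_iff) (auto simp: divide_le_eq mult.commute)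
  qed
  then have "h \<le> c * Inf S" using c by (simp add: divide_le_eq mult.commute)
  then have "ennreal h \<le> ennreal (c * Inf S)" by (rule ennreal_leI)
  also have "\<dots> = (C + 1) * ennreal (Inf S)" using c by (simp add: ennreal_mult' C(2)[symmetric])
  finally show ?thesis using H by simp
qed

text \<open>Values may be infinite: as Q is finite, both functionals are finite at the same points
  of X, so an equivalence also matches carriers.\<close>

definition equiv_fam :: "'a set \<Rightarrow> ('a \<Rightarrow> ennreal) \<Rightarrow> ('a \<Rightarrow> ennreal) \<Rightarrow> bool" where
  "equiv_fam X F G \<longleftrightarrow> (\<exists>Q<top. \<forall>f\<in>X. F f \<le> Q * G f \<and> G f \<le> Q * F f)"

lemma equiv_famI:
  assumes "Q < top" "Q' < top" "\<And>f. f \<in> X \<Longrightarrow> F f \<le> Q * G f" "\<And>f. f \<in> X \<Longrightarrow> G f \<le> Q' * F f"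
  shows "equiv_fam X F G"
  unfolding equiv_fam_def
proof (intro exI[of _ "Q + Q'"] conjI ballI)
  fix f assume "f \<in> X"
  from assms(3,4)[OF this] show "F f \<le> (Q + Q') * G f" "G f \<le> (Q + Q') * F f"
    by (auto simp: distrib_right add_increasing add_increasing2)
qed (use assms in auto)

lemma equiv_famE:
  assumes "equiv_fam X F G"
  obtains Q where "Q < top" "\<And>f. f \<in> X \<Longrightarrow> F f \<le> Q * G f" "\<And>f. f \<in> X \<Longrightarrow> G f \<le> Q * F f"
  using assms unfolding equiv_fam_def by blast

lemma equiv_fam_sym: "equiv_fam X F G \<Longrightarrow> equiv_fam X G F"
  unfolding equiv_fam_def by blast

lemma equiv_fam_trans:
  assumes "equiv_fam X F G" "equiv_fam X G H"
  shows "equiv_fam X F H"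
proof -
  obtain Q where Q: "Q < top" "\<And>f. f \<in> X \<Longrightarrow> F f \<le> Q * G f" "\<And>f. f \<in> X \<Longrightarrow> G f \<le> Q * F f"
    using equiv_famE[OF assms(1)] by blast
  obtain P where P: "P < top" "\<And>f. f \<in> X \<Longrightarrow> G f \<le> P * H f" "\<And>f. f \<in> X \<Longrightarrow> H f \<le> P * G f"
    using equiv_famE[OF assms(2)] by blast
  show ?thesis
  proof (rule equiv_famI[of "Q * P" "P * Q"])
    fix f assume f: "f \<in> X"
    show "F f \<le> Q * P * H f" by (rule le_mult_trans[OF Q(2)[OF f] P(2)[OF f]])
    show "H f \<le> P * Q * F f" by (rule le_mult_trans[OF P(3)[OF f] Q(3)[OF f]])
  qed (use Q P in \<open>auto simp: ennreal_mult_less_top\<close>)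
qed

lemma equiv_fam_add:
  assumes "equiv_fam X F F'" "equiv_fam X G G'"
  shows "equiv_fam X (\<lambda>f. F f + G f) (\<lambda>f. F' f + G' f)"
proof -
  obtain Q where Q: "Q < top" "\<And>f. f \<in> X \<Longrightarrow> F f \<le> Q * F' f" "\<And>f. f \<in> X \<Longrightarrow> F' f \<le> Q * F f"
    using equiv_famE[OF assms(1)] by blast
  obtain P where P: "P < top" "\<And>f. f \<in> X \<Longrightarrow> G f \<le> P * G' f" "\<And>f. f \<in> X \<Longrightarrow> G' f \<le> P * G f"
    using equiv_famE[OF assms(2)] by blast
  have add: "u + v \<le> (Q + P) * (u' + v')" if "u \<le> Q * u'" "v \<le> P * v'" for u v u' v'
    using add_mono[OF that] by (rule order_trans) (auto simp: algebra_simps intro!: add_mono add_increasing2)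
  show ?thesis
    by (rule equiv_famI[of "Q + P" "Q + P"]) (use Q P in \<open>auto intro: add\<close>)
qed

text \<open>In the application \<Phi> involves K for the R-spaces, an infimum over the empty set
  outside their sum. It is therefore compared with \<open>G\<close> only on that sum, and finiteness
  of \<open>G\<close> has to supply membership in it.\<close>

lemma space_eq_of_equivalent:
  assumes sub: "sum_carrier X Y \<subseteq> sum_carrier X' Y'"
    and 1: "equiv_fam (sum_carrier X Y) \<Phi> G"
    and 2: "equiv_fam (sum_carrier X' Y') G \<Psi>"
    and fin: "\<And>f. f \<in> sum_carrier X' Y' \<Longrightarrow> G f < top \<Longrightarrow> f \<in> sum_carrier X Y"
  shows "space_of X Y \<Phi> \<doteq> space_of X' Y' \<Psi>"
proof -
  obtain Q where Q: "Q < top" "\<And>f. f \<in> sum_carrier X Y \<Longrightarrow> \<Phi> f \<le> Q * G f" "\<And>f. f \<in> sum_carrier X Y \<Longrightarrow> G f \<le> Q * \<Phi> f"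
    using equiv_famE[OF 1] by blast
  obtain P where P: "P < top" "\<And>f. f \<in> sum_carrier X' Y' \<Longrightarrow> G f \<le> P * \<Psi> f" "\<And>f. f \<in> sum_carrier X' Y' \<Longrightarrow> \<Psi> f \<le> P * G f"
    using equiv_famE[OF 2] by blast
  show ?thesis unfolding space_eq_def
  proof
    show "cont_embedded (space_of X Y \<Phi>) (space_of X' Y' \<Psi>)"
      by (rule cont_embedded_space_of[of "P * Q"])
         (use P Q sub in \<open>auto intro!: le_mult_trans[OF P(3) Q(3)] simp: ennreal_mult_less_top\<close>)
    show "cont_embedded (space_of X' Y' \<Psi>) (space_of X Y \<Phi>)"
    proof (rule cont_embedded_space_of[of "Q * P"])
      fix f assume f: "f \<in> sum_carrier X' Y'" "\<Psi> f < top"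
      then have "G f < top" using P by (intro le_less_trans[OF P(2)[OF f(1)]]) (simp add: ennreal_mult_less_top)
      then have f': "f \<in> sum_carrier X Y" using fin f by blast
      then show "f \<in> sum_carrier X Y \<and> \<Phi> f \<le> Q * P * \<Psi> f"
        using le_mult_trans[OF Q(2)[OF f'] P(2)[OF f(1)]] by blast
    qed (use P Q in \<open>auto simp: ennreal_mult_less_top\<close>)
  qed
qed

lemma space_eq_trans: "X \<doteq> Y \<Longrightarrow> Y \<doteq> Z \<Longrightarrow> X \<doteq> Z"
  unfolding space_eq_def by (blast intro: cont_embedded_trans)

lemma space_eq_inter_sum:
  "space_of X Y (\<lambda>f. \<Phi> f + \<Psi> f + \<Xi> f) \<doteq> space_of X Y \<Phi> \<sqinter>\<^sub>q space_of X Y \<Psi> \<sqinter>\<^sub>q space_of X Y \<Xi>"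
  unfolding space_eq_def
proof
  show "cont_embedded (space_of X Y (\<lambda>f. \<Phi> f + \<Psi> f + \<Xi> f)) (space_of X Y \<Phi> \<sqinter>\<^sub>q space_of X Y \<Psi> \<sqinter>\<^sub>q space_of X Y \<Xi>)"
    by (intro cont_embedded_inter nonneg_norm_space_of cont_embedded_space_of[of 1])
       (auto simp: add_increasing add_increasing2)
qed (rule space_inter_embedded_sum)

section \<open>The couple of R-spaces\<close>

locale reiteration =
  fixes A0 A1 :: "'a::real_vector qspace"
    and q0 q1 r0 r1 :: ennreal
    and a0 a1 b0 b1 :: "real \<Rightarrow> real"
    and \<theta>0 :: real
  assumes A: "quasi_normed A0" "quasi_normed A1" "compatible_couple A0 A1"
    and exponents: "0 < q0" "0 < r0" "0 < q1" "0 < r1"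
    and SV: "a0 \<in> SV" "b0 \<in> SV" "a1 \<in> SV" "b1 \<in> SV"
    and theta: "0 < \<theta>0" "\<theta>0 < 1"
    and finite0: "wnorm r0 b0 {0<..<1} (\<lambda>_. 1) < top"
    and finite1: "wnorm r1 b1 {0<..<1} (\<lambda>s. wnorm q1 a1 {s<..<1} (\<lambda>_. 1)) < top"
begin

lemma dlog_1: "dlog 1 = 0"
  by (simp add: dlog_def)

lemma common_constant:
  "\<exists>M. comparable M (\<lambda>t. ennreal (b0 t)) (\<lambda>k. ennreal (b0 (dyad k))) \<and>
       comparable M (\<lambda>t. ennreal (b1 t)) (\<lambda>k. ennreal (b1 (dyad k))) \<and>
       comparable M (\<lambda>t. ennreal (a0 t)) (\<lambda>k. ennreal (a0 (dyad k))) \<and>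
       comparable M (\<lambda>t. ennreal (a1 t)) (\<lambda>k. ennreal (a1 (dyad k)))"
proof -
  obtain Ma Mb Mc Md where *:
    "comparable Ma (\<lambda>t. ennreal (b0 t)) (\<lambda>k. ennreal (b0 (dyad k)))"
    "comparable Mb (\<lambda>t. ennreal (b1 t)) (\<lambda>k. ennreal (b1 (dyad k)))"
    "comparable Mc (\<lambda>t. ennreal (a0 t)) (\<lambda>k. ennreal (a0 (dyad k)))"
    "comparable Md (\<lambda>t. ennreal (a1 t)) (\<lambda>k. ennreal (a1 (dyad k)))"
    using comparable_SV SV by metis
  have "Ma < top" "Mb < top" "Mc < top" "Md < top" using * comparableD(6) by blast+
  then have lt: "Ma + Mb + Mc + Md < top" by simp
  have le: "Ma \<le> Ma + Mb + Mc + Md" "Mb \<le> Ma + Mb + Mc + Md" "Mc \<le> Ma + Mb + Mc + Md" "Md \<le> Ma + Mb + Mc + Md"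
    by (auto simp: add_increasing add_increasing2)
  show ?thesis
    using comparable_mono[OF *(1) le(1) lt] comparable_mono[OF *(2) le(2) lt]
      comparable_mono[OF *(3) le(3) lt] comparable_mono[OF *(4) le(4) lt] by blast
qed

lemma weights_axioms:
  "weights q0 r0 q1 r1 \<theta>0 (\<lambda>k. a0 (dyad k)) (\<lambda>k. b0 (dyad k)) (\<lambda>k. a1 (dyad k)) (\<lambda>k. b1 (dyad k))"
proof
  obtain M where M:
    "comparable M (\<lambda>t. ennreal (b0 t)) (\<lambda>k. ennreal (b0 (dyad k)))"
    "comparable M (\<lambda>t. ennreal (b1 t)) (\<lambda>k. ennreal (b1 (dyad k)))"
    "comparable M (\<lambda>t. ennreal (a1 t)) (\<lambda>k. ennreal (a1 (dyad k)))"
    using common_constant by blast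
  note lt = comparableD(6)[OF M(1)]
  \<comment> \<open>The hypothesis covers (0,1), whereas index 0 stands for [1,2);
    \<open>single_lower\<close> recovers the missing block.\<close>
  have "lq r0 {..dlog 1} (\<lambda>i. ennreal (b0 (dyad i))) \<le> M * M * ennreal (2 powr recip r0) * wnorm r0 b0 {0<..<1} (\<lambda>_. 1)"
    using M exponents by (intro single_lower(2)) auto
  also have "\<dots> < top" using lt finite0 by (simp add: ennreal_mult_less_top)
  finally show "lq r0 {..0} (\<lambda>i. ennreal (b0 (dyad i))) < top" by (simp add: dlog_1)
  have "DN r1 q1 {..dlog 1} (\<lambda>i. ennreal (b1 (dyad i))) (\<lambda>i. ennreal (a1 (dyad i)))
     \<le> M * M * M * M * nested_const r1 q1 M * wnorm r1 b1 {0<..<1} (\<lambda>s. wnorm q1 a1 {s<..<1} (\<lambda>_. 1))"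
    using M exponents by (intro iterated_lower(2)) auto
  also have "\<dots> < top" using lt finite1 by (simp add: ennreal_mult_less_top nested_const_def)
  finally show "DN r1 q1 {..0} (\<lambda>i. ennreal (b1 (dyad i))) (\<lambda>i. ennreal (a1 (dyad i))) < top" by (simp add: dlog_1)
qed (use exponents theta SV in \<open>auto intro: dsv_SV\<close>)

sublocale weights q0 r0 q1 r1 \<theta>0 "\<lambda>k. a0 (dyad k)" "\<lambda>k. b0 (dyad k)" "\<lambda>k. a1 (dyad k)" "\<lambda>k. b1 (dyad k)"
  by (rule weights_axioms)

abbreviation "K \<equiv> K_fun A0 A1"
abbreviation "SA \<equiv> sum_carrier A0 A1"

definition "\<kappa> f i = ennreal (K (dyad i) f)"

lemma nn: "nonneg_norm A0" "nonneg_norm A1"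
  using A by (auto simp: quasi_normed_def nonneg_norm_def)

lemma \<kappa>_quasiconcave: "f \<in> SA \<Longrightarrow> quasiconcave (\<kappa> f)"
  unfolding quasiconcave_def
proof (intro allI impI)
  fix i k :: int assume f: "f \<in> SA" and "i \<le> k"
  then have "dyad i / dyad k * K (dyad k) f \<le> K (dyad i) f"
    by (intro K_fun_quasiconcave nn) auto
  then have "dyad (i - k) * K (dyad k) f \<le> K (dyad i) f"
    by (simp add: powr_diff)
  then show "ennreal (dyad (i - k)) * \<kappa> f k \<le> \<kappa> f i"
    by (simp add: \<kappa>_def ennreal_leI flip: ennreal_mult')
qed

lemma dyad_powr: "dyad k powr s = 2 powr (s * real_of_int k)"
  by (simp add: powr_powr mult.commute)

text \<open>Chosen once, before any f, so that the equivalences have constants independent of f. The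
  4 is the constant of \<open>comparable_K_fun\<close>.\<close>

definition "M = (SOME M. comparable M (\<lambda>t. ennreal (b0 t)) (\<lambda>k. ennreal (b0 (dyad k))) \<and>
  comparable M (\<lambda>t. ennreal (b1 t)) (\<lambda>k. ennreal (b1 (dyad k))) \<and>
  comparable M (\<lambda>t. ennreal (a0 t)) (\<lambda>k. ennreal (a0 (dyad k))) \<and>
  comparable M (\<lambda>t. ennreal (a1 t)) (\<lambda>k. ennreal (a1 (dyad k)))) * 4"

lemma M:
  "comparable M (\<lambda>t. ennreal (b0 t)) (\<lambda>k. ennreal (b0 (dyad k)))"
  "comparable M (\<lambda>t. ennreal (b1 t)) (\<lambda>k. ennreal (b1 (dyad k)))"
  "comparable M (\<lambda>t. ennreal (a1 t)) (\<lambda>k. ennreal (a1 (dyad k)))"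
  "f \<in> SA \<Longrightarrow> comparable M (\<lambda>t. ennreal (a0 t) * ennreal (t powr (- \<theta>0) * K t f)) (\<lambda>i. ennreal (w0 i) * \<kappa> f i)"
  "f \<in> SA \<Longrightarrow> comparable M (\<lambda>t. ennreal (a1 t) * ennreal (t powr (- 1) * K t f)) (\<lambda>i. ennreal (w1 i) * \<kappa> f i)"
  "M < top"
proof -
  define m where "m = (SOME M. comparable M (\<lambda>t. ennreal (b0 t)) (\<lambda>k. ennreal (b0 (dyad k))) \<and>
    comparable M (\<lambda>t. ennreal (b1 t)) (\<lambda>k. ennreal (b1 (dyad k))) \<and>
    comparable M (\<lambda>t. ennreal (a0 t)) (\<lambda>k. ennreal (a0 (dyad k))) \<and>
    comparable M (\<lambda>t. ennreal (a1 t)) (\<lambda>k. ennreal (a1 (dyad k))))"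
  then have M_eq: "M = m * 4" by (simp only: M_def)
  note m = someI_ex[OF common_constant, folded m_def, THEN conjunct1]
    someI_ex[OF common_constant, folded m_def, THEN conjunct2, THEN conjunct1]
    someI_ex[OF common_constant, folded m_def, THEN conjunct2, THEN conjunct2, THEN conjunct1]
    someI_ex[OF common_constant, folded m_def, THEN conjunct2, THEN conjunct2, THEN conjunct2]
  have lt: "m \<le> M" "M < top"
    using comparableD(6)[OF m(1)] mult_left_mono[of 1 4 m] by (auto simp: M_eq ennreal_mult_less_top)
  then show "M < top" by blast
  show "comparable M (\<lambda>t. ennreal (b0 t)) (\<lambda>k. ennreal (b0 (dyad k)))"
    "comparable M (\<lambda>t. ennreal (b1 t)) (\<lambda>k. ennreal (b1 (dyad k)))"
    "comparable M (\<lambda>t. ennreal (a1 t)) (\<lambda>k. ennreal (a1 (dyad k)))"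
    by (rule comparable_mono[OF _ lt], rule m)+
  have w: "ennreal (a0 (dyad i)) * ennreal (dyad i powr (- \<theta>0) * K (dyad i) f) = ennreal (w0 i) * \<kappa> f i"
    "ennreal (a1 (dyad i)) * ennreal (dyad i powr (- 1) * K (dyad i) f) = ennreal (w1 i) * \<kappa> f i" for i f
    using pos(1,3)[of i] unfolding dyad_powr
    by (simp_all add: w0_def w1_def \<kappa>_def ennreal_mult' ac_simps)
  show "comparable M (\<lambda>t. ennreal (a0 t) * ennreal (t powr (- \<theta>0) * K t f)) (\<lambda>i. ennreal (w0 i) * \<kappa> f i)"
    "comparable M (\<lambda>t. ennreal (a1 t) * ennreal (t powr (- 1) * K t f)) (\<lambda>i. ennreal (w1 i) * \<kappa> f i)" if "f \<in> SA"
    unfolding w[symmetric] M_eq using theta that by (intro comparable_mult m comparable_K_fun nn; simp)+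
qed

section \<open>The weights of the statement as sampled functions\<close>

definition "chi0 t = a0 t * enn2real (wnorm r0 b0 {0<..<t} (\<lambda>_. 1))"
definition "chi1 t = enn2real (wnorm r1 b1 {0<..<t} (\<lambda>s. wnorm q1 a1 {s<..<t} (\<lambda>_. 1)))"
definition "rho t = t powr (1 - \<theta>0) * (chi0 t / chi1 t)"

lemma sampled_B:
  "sampled (\<lambda>t. enn2real (wnorm r0 b0 {0<..<t} (\<lambda>_. 1))) B0"
  "sampled (\<lambda>t. enn2real (wnorm r1 b1 {0<..<t} (\<lambda>_. 1))) B1"
proof -
  note M = M(6,6,1,2)
  have c: "comparable M (\<lambda>t. ennreal (b0 t) * 1) (\<lambda>k. ennreal (b0 (dyad k)))"
    "comparable M (\<lambda>t. ennreal (b1 t) * 1) (\<lambda>k. ennreal (b1 (dyad k)))" using M(3,4) by simp_all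
  show "sampled (\<lambda>t. enn2real (wnorm r0 b0 {0<..<t} (\<lambda>_. 1))) B0"
    by (rule sampled_enn2real, erule single_lower(1)[OF exponents(2) c(1), unfolded B0_eq],
        erule single_lower(2)[OF exponents(2) c(1), unfolded B0_eq])
       (use M(2) pos(5) in \<open>auto simp: ennreal_mult_less_top\<close>)
  show "sampled (\<lambda>t. enn2real (wnorm r1 b1 {0<..<t} (\<lambda>_. 1))) B1"
    by (rule sampled_enn2real, erule single_lower(1)[OF exponents(4) c(2), unfolded B1_eq],
        erule single_lower(2)[OF exponents(4) c(2), unfolded B1_eq])
       (use M(2) pos(6) in \<open>auto simp: ennreal_mult_less_top\<close>)
qed

lemma sampled_chi0: "sampled chi0 X0"
  unfolding chi0_def[abs_def] X0_def[abs_def] by (intro sampled_mult sampled_SV SV sampled_B)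

lemma sampled_chi1: "sampled chi1 X1"
proof -
  note M = M(6,6,2,3)
  have c: "comparable M (\<lambda>t. ennreal (a1 t) * 1) (\<lambda>k. ennreal (a1 (dyad k)))" using M(4) by simp
  show ?thesis unfolding chi1_def[abs_def]
    by (rule sampled_enn2real, erule iterated_lower(1)[OF exponents(4,3) M(3) c, unfolded X1_eq],
        erule iterated_lower(2)[OF exponents(4,3) M(3) c, unfolded X1_eq])
       (use M(2) pos(8) in \<open>auto simp: ennreal_mult_less_top nested_const_def\<close>)
qed

lemma sampled_rho: "sampled rho \<rho>"
proof -
  have "sampled (\<lambda>t. t powr (1 - \<theta>0) * (chi0 t / chi1 t)) (\<lambda>k. dyad k powr (1 - \<theta>0) * (X0 k / X1 k))"
    by (intro sampled_mult sampled_powr sampled_id sampled_divide sampled_chi0 sampled_chi1)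
  then show ?thesis unfolding dyad_powr rho_def[abs_def] \<rho>_eq .
qed

abbreviation "R0 \<equiv> R_space A0 A1 \<theta>0 r0 b0 q0 a0"
abbreviation "R1 \<equiv> R_space A0 A1 1 r1 b1 q1 a1"
abbreviation "KR \<equiv> K_fun R0 R1"
abbreviation "SR \<equiv> sum_carrier R0 R1"

definition "\<Phi>0 f = wnorm r0 b0 {0<..} (\<lambda>t. K_norm A0 A1 \<theta>0 q0 a0 {t<..} f)"
definition "\<Phi>1 f = wnorm r1 b1 {0<..} (\<lambda>t. K_norm A0 A1 1 q1 a1 {t<..} f)"

lemma R0_simps: "f \<in> qcarrier R0 \<longleftrightarrow> f \<in> SA \<and> \<Phi>0 f < top" "qnorm R0 f = enn2real (\<Phi>0 f)"
  by (auto simp: R_space_def space_of_def \<Phi>0_def)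

lemma R1_simps: "f \<in> qcarrier R1 \<longleftrightarrow> f \<in> SA \<and> \<Phi>1 f < top" "qnorm R1 f = enn2real (\<Phi>1 f)"
  by (auto simp: R_space_def space_of_def \<Phi>1_def)

lemma nnR: "nonneg_norm R0" "nonneg_norm R1"
  by (auto simp: R_space_def nonneg_norm_space_of)

lemma SR_subset: "SR \<subseteq> SA"
  unfolding sum_carrier_def[of R0 R1] using sum_carrier_closed(1)[OF A(1,2)] R0_simps R1_simps by auto

lemma \<Phi>_equivalent:
  "equiv_fam SA \<Phi>0 (\<lambda>f. N0 UNIV (\<kappa> f))" "equiv_fam SA \<Phi>1 (\<lambda>f. N1 UNIV (\<kappa> f))"
proof -
  note M = M(6,6,1,2,4,5)
  show "equiv_fam SA \<Phi>0 (\<lambda>f. N0 UNIV (\<kappa> f))"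
    unfolding \<Phi>0_def[abs_def] N0_def K_norm_def
    using iterated_whole[OF exponents(2,1) M(3) M(5)] M(2)
    by (intro equiv_famI[of "M * M" "nested_const r0 q0 M"]) (auto simp: nested_const_def ennreal_mult_less_top)
  show "equiv_fam SA \<Phi>1 (\<lambda>f. N1 UNIV (\<kappa> f))"
    unfolding \<Phi>1_def[abs_def] N1_def K_norm_def
    using iterated_whole[OF exponents(4,3) M(4) M(6)] M(2)
    by (intro equiv_famI[of "M * M" "nested_const r1 q1 M"]) (auto simp: nested_const_def ennreal_mult_less_top)
qed

subsection \<open>Holmstedt's formula\<close>

text \<open>Near-optimality at 2^k bounds the norms of both parts, hence K of f0 by 2 K(2^k,f) and K
  of f1 linearly. The other two bounds use the triangle inequality: below k the bound for f1 is at
  most 2 K(2^i,f) by quasiconcavity, above k that for f0 is by monotonicity. The constant is c(1 +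
  2).\<close>

lemma near_optimal_split:
  "\<exists>C\<ge>1. \<forall>f\<in>SA. \<forall>k. \<exists>f0 f1. f = f0 + f1 \<and> f0 \<in> SA \<and> f1 \<in> SA \<and>
     (\<forall>i\<le>k. \<kappa> f0 i \<le> ennreal C * \<kappa> f i) \<and> (\<forall>i\<ge>k. \<kappa> f0 i \<le> ennreal C * \<kappa> f k) \<and>
     (\<forall>i\<le>k. \<kappa> f1 i \<le> ennreal (dyad (i - k)) * (ennreal C * \<kappa> f k)) \<and> (\<forall>i\<ge>k. \<kappa> f1 i \<le> ennreal C * \<kappa> f i)"
proof -
  from K_fun_triangle[OF A(1,2)] obtain c where c: "1 \<le> c"
    "\<And>f g t. f \<in> SA \<Longrightarrow> g \<in> SA \<Longrightarrow> 0 \<le> t \<Longrightarrow> K t (f - g) \<le> c * (K t f + K t g)"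
    by blast
  have z: "0 \<in> qcarrier A0" "0 \<in> qcarrier A1" "qnorm A0 0 = 0" "qnorm A1 0 = 0"
    using A by (auto simp: quasi_normed_def subspace_0)
  have "\<exists>f0 f1. f = f0 + f1 \<and> f0 \<in> SA \<and> f1 \<in> SA \<and>
     (\<forall>i\<le>k. \<kappa> f0 i \<le> ennreal (3 * c) * \<kappa> f i) \<and> (\<forall>i\<ge>k. \<kappa> f0 i \<le> ennreal (3 * c) * \<kappa> f k) \<and>
     (\<forall>i\<le>k. \<kappa> f1 i \<le> ennreal (dyad (i - k)) * (ennreal (3 * c) * \<kappa> f k)) \<and> (\<forall>i\<ge>k. \<kappa> f1 i \<le> ennreal (3 * c) * \<kappa> f i)"
    if f: "f \<in> SA" for f k
  proof -
    let ?K = "\<lambda>i f. K (dyad i) f"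
    have Kf: "0 \<le> ?K i f" for i by (rule K_fun_nonneg[OF nn f]) simp
    \<comment> \<open>For f = 0 the strict inequality K < 2K fails, but the zero decomposition
      serves.\<close>
    have "\<exists>f0 f1. f0 \<in> qcarrier A0 \<and> f1 \<in> qcarrier A1 \<and> f = f0 + f1 \<and> qnorm A0 f0 + dyad k * qnorm A1 f1 \<le> 2 * ?K k f"
    proof (cases "f = 0")
      case True
      then show ?thesis using z Kf[of k] by (intro exI[of _ 0]) auto
    next
      case False
      then have "?K k f < 2 * ?K k f" using K_fun_pos[OF A f, of "dyad k"] by simp
      from K_fun_approx[OF nn f this] show ?thesis by (metis less_imp_le)
    qed
    then obtain f0 f1 where d: "f0 \<in> qcarrier A0" "f1 \<in> qcarrier A1" "f = f0 + f1"
      "qnorm A0 f0 + dyad k * qnorm A1 f1 \<le> 2 * ?K k f" by blast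
    have n: "0 \<le> qnorm A0 f0" "0 \<le> qnorm A1 f1" using d nn by (auto simp: nonneg_norm_def)
    have n': "0 \<le> dyad k * qnorm A1 f1" using n by simp
    have n0: "qnorm A0 f0 \<le> 2 * ?K k f" and n1: "dyad k * qnorm A1 f1 \<le> 2 * ?K k f"
      using d(4) n n' by linarith+
    have S: "f0 \<in> SA" "f1 \<in> SA"
      unfolding sum_carrier_def using d(1,2) z(1,2) by (force intro: exI[of _ 0])+
    have K0: "?K i f0 \<le> qnorm A0 f0" for i
      using K_fun_le[OF nn, of "dyad i" f0 0 f0] d z by simp
    have K1: "?K i f1 \<le> dyad (i - k) * (2 * ?K k f)" for i
    proof -
      have "?K i f1 \<le> dyad i * qnorm A1 f1"
        using K_fun_le[OF nn, of "dyad i" 0 f1 f1] d z by simp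
      also have "\<dots> = dyad (i - k) * (dyad k * qnorm A1 f1)" by (simp add: powr_diff)
      also have "\<dots> \<le> dyad (i - k) * (2 * ?K k f)" by (intro mult_left_mono n1) simp
      finally show ?thesis .
    qed
    have up: "?K i f \<le> ?K j f" if "i \<le> j" for i j
      using that by (intro K_fun_mono[OF nn f]) auto
    have down: "dyad (i - k) * ?K k f \<le> ?K i f" if "i \<le> k" for i
      using K_fun_quasiconcave[OF nn f, of "dyad i" "dyad k"] that by (simp add: powr_diff)
    have tri: "?K i f0 \<le> c * (?K i f + ?K i f1)" "?K i f1 \<le> c * (?K i f + ?K i f0)" for i
      using c(2)[OF f S(2), of "dyad i"] c(2)[OF f S(1), of "dyad i"] d(3) by (simp_all add: algebra_simps)
    have c3: "2 * x \<le> 3 * c * x" if "0 \<le> x" for x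
      using that c(1) by (intro mult_right_mono) auto
    have c33: "c * (x + y) \<le> 3 * c * x" if "y \<le> 2 * x" for x y
      using mult_left_mono[of "x + y" "3 * x" c] that c(1) by simp
    have 1: "?K i f0 \<le> 3 * c * ?K i f" if "i \<le> k" for i
      using tri(1)[of i] K1[of i] down[OF that] by (intro order_trans[OF tri(1) c33]) simp
    have 2: "?K i f0 \<le> 3 * c * ?K k f" for i
      using K0[of i] n0 c3[OF Kf[of k]] by linarith
    have 3: "?K i f1 \<le> dyad (i - k) * (3 * c * ?K k f)" for i
      by (rule order_trans[OF K1]) (intro mult_left_mono c3 Kf; simp)
    have 4: "?K i f1 \<le> 3 * c * ?K i f" if "k \<le> i" for i
      using K0[of i] n0 up[OF that] by (intro order_trans[OF tri(2) c33]) simp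
    have e: "ennreal x \<le> ennreal (3 * c) * ennreal y" if "x \<le> 3 * c * y" for x y
      using that c(1) by (simp flip: ennreal_mult' add: ennreal_leI)
    have e': "ennreal x \<le> ennreal (dyad (i - k)) * (ennreal (3 * c) * ennreal y)" if "x \<le> dyad (i - k) * (3 * c * y)" for x y i
      using that c(1) by (simp flip: ennreal_mult' add: ennreal_leI)
    show ?thesis unfolding \<kappa>_def
      by (intro exI[of _ f0] exI[of _ f1] conjI allI impI d S e e' 1 2 3 4)
  qed
  then show ?thesis using c(1) by (intro exI[of _ "3 * c"]) auto
qed

text \<open>Finiteness of \<open>H\<close> at a single k makes both parts of the split at 2^k
  members of the R-spaces, which is how f is seen to lie in their sum.\<close>

lemma Holmstedt_upper:
  "\<exists>C<top. \<forall>f\<in>SA. \<forall>k. H k (\<kappa> f) < top \<longrightarrow> f \<in> SR \<and> ennreal (KR (\<rho> k) f) \<le> C * H k (\<kappa> f)"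
proof -
  obtain c where c: "1 \<le> c" "\<forall>f\<in>SA. \<forall>k. \<exists>f0 f1. f = f0 + f1 \<and> f0 \<in> SA \<and> f1 \<in> SA \<and>
     (\<forall>i\<le>k. \<kappa> f0 i \<le> ennreal c * \<kappa> f i) \<and> (\<forall>i\<ge>k. \<kappa> f0 i \<le> ennreal c * \<kappa> f k) \<and>
     (\<forall>i\<le>k. \<kappa> f1 i \<le> ennreal (dyad (i - k)) * (ennreal c * \<kappa> f k)) \<and> (\<forall>i\<ge>k. \<kappa> f1 i \<le> ennreal c * \<kappa> f i)"
    using near_optimal_split by blast
  obtain C0 where C0: "C0 < top" "\<And>\<kappa> \<kappa>' k. (\<forall>i\<le>k. \<kappa>' i \<le> \<kappa> i) \<Longrightarrow> (\<forall>i\<ge>k. \<kappa>' i \<le> \<kappa> k) \<Longrightarrow> N0 UNIV \<kappa>' \<le> C0 * N0 {..k} \<kappa>"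
    using N0_frozen by blast
  obtain C1 where C1: "C1 < top" "\<And>\<kappa> \<kappa>' k. (\<forall>i\<le>k. \<kappa>' i \<le> ennreal (dyad (i - k)) * \<kappa> k) \<Longrightarrow> (\<forall>i\<ge>k. \<kappa>' i \<le> \<kappa> i) \<Longrightarrow>
     N1 UNIV \<kappa>' \<le> C1 * (ennreal (S1 k) * \<kappa> k + (I2 k \<kappa> + N1 {k..} \<kappa>))"
    using N1_frozen by blast
  obtain Q0 where Q0: "Q0 < top" "\<And>f. f \<in> SA \<Longrightarrow> \<Phi>0 f \<le> Q0 * N0 UNIV (\<kappa> f)"
    using equiv_famE[OF \<Phi>_equivalent(1)] by metis
  obtain Q1 where Q1: "Q1 < top" "\<And>f. f \<in> SA \<Longrightarrow> \<Phi>1 f \<le> Q1 * N1 UNIV (\<kappa> f)"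
    using equiv_famE[OF \<Phi>_equivalent(2)] by metis
  let ?C0 = "Q0 * (C0 * ennreal c)" and ?C1 = "Q1 * (C1 * ennreal c)"
  have fin: "?C0 < top" "?C1 < top" using Q0 Q1 C0 C1 by (auto simp: ennreal_mult_less_top)
  show ?thesis
  proof (intro exI[of _ "?C0 + ?C1"] conjI ballI allI impI)
    show "?C0 + ?C1 < top" using fin by simp
    fix f k assume f: "f \<in> SA" and Hfin: "H k (\<kappa> f) < top"
    obtain f0 f1 where d: "f = f0 + f1" "f0 \<in> SA" "f1 \<in> SA"
      "\<forall>i\<le>k. \<kappa> f0 i \<le> ennreal c * \<kappa> f i" "\<forall>i\<ge>k. \<kappa> f0 i \<le> ennreal c * \<kappa> f k"
      "\<forall>i\<le>k. \<kappa> f1 i \<le> ennreal (dyad (i - k)) * (ennreal c * \<kappa> f k)" "\<forall>i\<ge>k. \<kappa> f1 i \<le> ennreal c * \<kappa> f i"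
      using c(2) f by blast
    let ?I = "I2 k (\<kappa> f) + N1 {k..} (\<kappa> f)" let ?S = "ennreal (S1 k) * \<kappa> f k"
    have 0: "\<Phi>0 f0 \<le> ?C0 * N0 {..k} (\<kappa> f)"
    proof -
      have "N0 UNIV (\<kappa> f0) \<le> C0 * N0 {..k} (\<lambda>i. ennreal c * \<kappa> f i)"
        by (rule C0(2)[OF d(4,5)])
      then have "N0 UNIV (\<kappa> f0) \<le> C0 * ennreal c * N0 {..k} (\<kappa> f)"
        by (simp only: N_cmult mult.assoc)
      from le_mult_trans[OF Q0(2)[OF d(2)] this] show ?thesis .
    qed
    have 1: "\<Phi>1 f1 \<le> ?C1 * (?S + ?I)"
    proof -
      have "N1 UNIV (\<kappa> f1) \<le> C1 * (ennreal (S1 k) * (ennreal c * \<kappa> f k) + (I2 k (\<lambda>i. ennreal c * \<kappa> f i) + N1 {k..} (\<lambda>i. ennreal c * \<kappa> f i)))"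
        by (rule C1(2)[OF d(6,7)])
      also have "\<dots> = C1 * ennreal c * (?S + ?I)"
        by (simp only: N_cmult) (simp add: algebra_simps)
      finally have "N1 UNIV (\<kappa> f1) \<le> C1 * ennreal c * (?S + ?I)" .
      from le_mult_trans[OF Q1(2)[OF d(3)] this] show ?thesis .
    qed
    \<comment> \<open>The extra term from \<open>N1_frozen\<close> times \<open>\<rho> k\<close>
      equals \<open>S0 k * \<kappa> f k\<close>, which lies below \<open>N0 {..k}\<close>; this is
      why \<open>H\<close> does not list it.\<close>
    have 2: "ennreal (\<rho> k) * (?S + ?I) \<le> H k (\<kappa> f)"
      using N0_lower[of k "\<kappa> f"] unfolding S0_mult H_def by (simp add: distrib_left add_mono)
    have lt0: "\<Phi>0 f0 < top"
    proof -
      have "N0 {..k} (\<kappa> f) < top" using Hfin by (simp add: H_def)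
      then show ?thesis using 0 fin by (auto intro!: le_less_trans[OF 0] simp: ennreal_mult_less_top)
    qed
    have lt1: "\<Phi>1 f1 < top"
    proof -
      have "ennreal (\<rho> k) * (?S + ?I) < top" using 2 Hfin by (rule le_less_trans)
      then have "?S + ?I < top" using pos(13)[of k] by (auto simp: ennreal_mult_less_top)
      then show ?thesis using fin by (auto intro!: le_less_trans[OF 1] simp: ennreal_mult_less_top)
    qed
    have m: "f0 \<in> qcarrier R0" "f1 \<in> qcarrier R1" using d lt0 lt1 by (auto simp: R0_simps R1_simps)
    then show "f \<in> SR" using d(1) by (auto simp: sum_carrier_def)
    have "KR (\<rho> k) f \<le> enn2real (\<Phi>0 f0) + \<rho> k * enn2real (\<Phi>1 f1)"
      using K_fun_le[OF nnR _ m d(1), of "\<rho> k"] pos(13)[of k] by (simp add: R0_simps R1_simps)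
    then have "ennreal (KR (\<rho> k) f) \<le> ennreal (enn2real (\<Phi>0 f0) + \<rho> k * enn2real (\<Phi>1 f1))"
      by (rule ennreal_leI)
    also have "\<dots> = \<Phi>0 f0 + ennreal (\<rho> k) * \<Phi>1 f1"
      using pos(13)[of k] lt0 lt1 by (simp add: ennreal_mult)
    also have "\<dots> \<le> ?C0 * N0 {..k} (\<kappa> f) + ennreal (\<rho> k) * (?C1 * (?S + ?I))"
      by (intro add_mono mult_left_mono 0 1) simp
    also have "\<dots> = ?C0 * N0 {..k} (\<kappa> f) + ?C1 * (ennreal (\<rho> k) * (?S + ?I))"
      by (simp only: mult.left_commute)
    also have "\<dots> \<le> ?C0 * H k (\<kappa> f) + ?C1 * H k (\<kappa> f)"
      using 2 by (intro add_mono mult_left_mono) (auto simp: H_def)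
    finally show "ennreal (KR (\<rho> k) f) \<le> (?C0 + ?C1) * H k (\<kappa> f)"
      by (simp only: distrib_right)
  qed
qed

text \<open>\<open>H\<close> is monotone and quasi-subadditive, so it is enough to bound it by the
  norm on the first space and by \<open>\<rho> k\<close> times the norm on the second; the infimum
  over decompositions then gives K.\<close>

lemma Holmstedt_lower:
  "\<exists>C<top. \<forall>f\<in>SR. \<forall>k. H k (\<kappa> f) \<le> C * ennreal (KR (\<rho> k) f)"
proof -
  from K_fun_triangle[OF A(1,2)] obtain c where c: "1 \<le> c"
    "\<And>f g t. f \<in> SA \<Longrightarrow> g \<in> SA \<Longrightarrow> 0 \<le> t \<Longrightarrow> K t (f + g) \<le> c * (K t f + K t g)"
    by blast
  obtain Q0 where Q0: "Q0 < top" "\<And>f. f \<in> SA \<Longrightarrow> N0 UNIV (\<kappa> f) \<le> Q0 * \<Phi>0 f"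
    using equiv_famE[OF \<Phi>_equivalent(1)] by metis
  obtain Q1 where Q1: "Q1 < top" "\<And>f. f \<in> SA \<Longrightarrow> N1 UNIV (\<kappa> f) \<le> Q1 * \<Phi>1 f"
    using equiv_famE[OF \<Phi>_equivalent(2)] by metis
  obtain T0 where T0: "T0 < top" "\<And>S \<kappa> \<kappa>'. N0 S (\<lambda>i. \<kappa> i + \<kappa>' i) \<le> T0 * (N0 S \<kappa> + N0 S \<kappa>')"
    using N0_add by blast
  obtain T1 where T1: "T1 < top" "\<And>S \<kappa> \<kappa>'. N1 S (\<lambda>i. \<kappa> i + \<kappa>' i) \<le> T1 * (N1 S \<kappa> + N1 S \<kappa>')"
    using N1_add by blast
  obtain C0 where C0: "C0 < top" "\<And>\<kappa> k. quasiconcave \<kappa> \<Longrightarrow> N0 {..k} \<kappa> \<le> C0 * (ennreal (\<rho> k) * N1 UNIV \<kappa>)"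
    using N0_le_N1 by blast
  obtain C1 where C1: "C1 < top" "\<And>\<kappa> k. ennreal (\<rho> k) * (I2 k \<kappa> + N1 {k..} \<kappa>) \<le> C1 * N0 UNIV \<kappa>"
    using N1_le_N0 by blast
  let ?J = "\<lambda>k \<kappa>. I2 k \<kappa> + N1 {k..} \<kappa>"
  define T where "T = T0 + (quasi_const q1 + T1)"
  have T: "T < top" using T0 T1 quasi_const_less_top by (simp add: T_def)
  have H_add: "H k (\<lambda>i. \<kappa> i + \<kappa>' i) \<le> T * (H k \<kappa> + H k \<kappa>')" for k \<kappa> \<kappa>'
  proof -
    have "N0 {..k} (\<lambda>i. \<kappa> i + \<kappa>' i) \<le> T * (N0 {..k} \<kappa> + N0 {..k} \<kappa>')"
      by (rule order_trans[OF T0(2)]) (auto simp: T_def intro!: mult_right_mono)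
    moreover have "?J k (\<lambda>i. \<kappa> i + \<kappa>' i) \<le> T * (?J k \<kappa> + ?J k \<kappa>')"
    proof -
      have "I2 k (\<lambda>i. \<kappa> i + \<kappa>' i) \<le> T * (I2 k \<kappa> + I2 k \<kappa>')"
        by (rule order_trans[OF I2_add]) (auto simp: T_def add_increasing add_increasing2 intro!: mult_right_mono)
      moreover have "N1 {k..} (\<lambda>i. \<kappa> i + \<kappa>' i) \<le> T * (N1 {k..} \<kappa> + N1 {k..} \<kappa>')"
        by (rule order_trans[OF T1(2)]) (auto simp: T_def add_increasing add_increasing2 intro!: mult_right_mono)
      ultimately show ?thesis using add_mono by (fastforce simp: algebra_simps)
    qed
    then have "ennreal (\<rho> k) * ?J k (\<lambda>i. \<kappa> i + \<kappa>' i) \<le> ennreal (\<rho> k) * (T * (?J k \<kappa> + ?J k \<kappa>'))"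
      by (rule mult_left_mono) simp
    ultimately have "H k (\<lambda>i. \<kappa> i + \<kappa>' i) \<le> T * (N0 {..k} \<kappa> + N0 {..k} \<kappa>') + ennreal (\<rho> k) * (T * (?J k \<kappa> + ?J k \<kappa>'))"
      unfolding H_def by (rule add_mono)
    also have "\<dots> = T * (H k \<kappa> + H k \<kappa>')" by (simp add: H_def algebra_simps)
    finally show ?thesis .
  qed
  have H_mono: "H k \<kappa> \<le> H k \<kappa>'" if "\<And>i. \<kappa> i \<le> \<kappa>' i" for k \<kappa> \<kappa>'
    unfolding H_def using that by (intro add_mono mult_left_mono N0_mono N1_mono I2_mono) auto
  have H_cmult: "H k (\<lambda>i. x * \<kappa> i) = x * H k \<kappa>" for k x \<kappa>
    by (simp only: H_def N_cmult) (simp add: algebra_simps)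
  define P where "P = (1 + C1) * Q0 + (C0 + 2) * Q1"
  have P: "P < top" using Q0 Q1 C0 C1 by (simp add: P_def ennreal_mult_less_top)
  have H0: "H k (\<kappa> g) \<le> P * \<Phi>0 g" if "g \<in> SA" for g k
  proof -
    have "H k (\<kappa> g) \<le> N0 UNIV (\<kappa> g) + C1 * N0 UNIV (\<kappa> g)"
      unfolding H_def by (intro add_mono C1 N0_mono) auto
    also have "\<dots> = (1 + C1) * N0 UNIV (\<kappa> g)" by (simp add: distrib_right)
    also have "\<dots> \<le> (1 + C1) * (Q0 * \<Phi>0 g)" by (intro mult_left_mono Q0 that) simp
    also have "\<dots> \<le> P * \<Phi>0 g" by (simp add: P_def distrib_right mult.assoc)
    finally show ?thesis .
  qed
  \<comment> \<open>For j <= k the set {k..} is contained in {j..}, so \<open>I2\<close> is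
    dominated by the part of the double norm with outer index up to k.\<close>
  have I2_le: "I2 k \<kappa> \<le> N1 UNIV \<kappa>" for k \<kappa>
    unfolding I2_def B1_eq[symmetric] lq_cmult_right[OF r1, symmetric] N1_def DN_def
    by (intro lq_mono r1 q1 mult_left_mono) auto
  have H1: "H k (\<kappa> g) \<le> P * (ennreal (\<rho> k) * \<Phi>1 g)" if g: "g \<in> SA" for g k
  proof -
    let ?n = "N1 UNIV (\<kappa> g)"
    \<comment> \<open>One copy of \<open>N1 UNIV\<close> each for \<open>I2\<close> and for the
      tail; quasiconcavity of K handles the first term.\<close>
    have "H k (\<kappa> g) \<le> C0 * (ennreal (\<rho> k) * ?n) + ennreal (\<rho> k) * (?n + ?n)"
      unfolding H_def by (intro add_mono mult_left_mono C0(2) \<kappa>_quasiconcave g I2_le N1_mono) auto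
    also have "\<dots> = (C0 + 2) * (ennreal (\<rho> k) * ?n)"
      by (simp only: distrib_left[of "ennreal (\<rho> k)"] distrib_right mult_2)
    also have "\<dots> \<le> (C0 + 2) * (ennreal (\<rho> k) * (Q1 * \<Phi>1 g))" by (intro mult_left_mono Q1 g) auto
    also have "\<dots> = (C0 + 2) * Q1 * (ennreal (\<rho> k) * \<Phi>1 g)" by (simp only: ac_simps)
    also have "\<dots> \<le> P * (ennreal (\<rho> k) * \<Phi>1 g)" by (simp add: P_def distrib_right[of _ "_ * Q1"])
    finally show ?thesis .
  qed
  define C where "C = ennreal c * T * P"
  have C: "C < top" using T P by (simp add: C_def ennreal_mult_less_top)
  have main: "H k (\<kappa> f) \<le> C * ennreal (qnorm R0 g0 + \<rho> k * qnorm R1 g1)"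
    if g: "g0 \<in> qcarrier R0" "g1 \<in> qcarrier R1" "f = g0 + g1" for f g0 g1 k
  proof -
    have S: "g0 \<in> SA" "g1 \<in> SA" and lt: "\<Phi>0 g0 < top" "\<Phi>1 g1 < top" using g by (auto simp: R0_simps R1_simps)
    have "\<kappa> f i \<le> ennreal c * (\<kappa> g0 i + \<kappa> g1 i)" for i
    proof -
      have "K (dyad i) f \<le> c * (K (dyad i) g0 + K (dyad i) g1)"
        unfolding g(3) by (intro c S) simp
      then have "\<kappa> f i \<le> ennreal (c * (K (dyad i) g0 + K (dyad i) g1))"
        unfolding \<kappa>_def by (rule ennreal_leI)
      then show ?thesis using c(1) K_fun_nonneg[OF nn S(1), of "dyad i"] K_fun_nonneg[OF nn S(2), of "dyad i"]
        by (simp add: \<kappa>_def ennreal_mult)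
    qed
    then have "H k (\<kappa> f) \<le> H k (\<lambda>i. ennreal c * (\<kappa> g0 i + \<kappa> g1 i))" by (rule H_mono)
    also have "\<dots> = ennreal c * H k (\<lambda>i. \<kappa> g0 i + \<kappa> g1 i)" by (rule H_cmult)
    also have "\<dots> \<le> ennreal c * (T * (H k (\<kappa> g0) + H k (\<kappa> g1)))" by (intro mult_left_mono H_add) simp
    also have "\<dots> \<le> ennreal c * (T * (P * \<Phi>0 g0 + P * (ennreal (\<rho> k) * \<Phi>1 g1)))"
      by (intro mult_left_mono add_mono H0 H1 S) auto
    also have "\<dots> = C * (\<Phi>0 g0 + ennreal (\<rho> k) * \<Phi>1 g1)"
      by (simp only: C_def distrib_left mult.assoc)
    also have "\<Phi>0 g0 + ennreal (\<rho> k) * \<Phi>1 g1 = ennreal (qnorm R0 g0 + \<rho> k * qnorm R1 g1)"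
      using lt pos(13)[of k] by (simp add: R0_simps R1_simps ennreal_mult)
    finally show ?thesis .
  qed
  have "H k (\<kappa> f) \<le> (C + 1) * ennreal (KR (\<rho> k) f)" if f: "f \<in> SR" for f k
  proof -
    let ?S = "{qnorm R0 f\<^sub>0 + \<rho> k * qnorm R1 f\<^sub>1 | f\<^sub>0 f\<^sub>1. f\<^sub>0 \<in> qcarrier R0 \<and> f\<^sub>1 \<in> qcarrier R1 \<and> f = f\<^sub>0 + f\<^sub>1}"
    obtain g0 g1 where g: "g0 \<in> qcarrier R0" "g1 \<in> qcarrier R1" "f = g0 + g1"
      using f unfolding sum_carrier_def[of R0 R1] by blast
    show ?thesis unfolding K_fun_def
    proof (rule cInf_scale_ennreal[OF main[OF g] _ C])
      show "qnorm R0 g0 + \<rho> k * qnorm R1 g1 \<in> ?S" using g by blast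
      fix x assume x: "x \<in> ?S"
      have "0 \<le> x" using K_set_bounds(1)[OF nnR _ x] pos(13)[of k] by simp
      moreover have "H k (\<kappa> f) \<le> C * ennreal x" using x main by blast
      ultimately show "0 \<le> x \<and> H k (\<kappa> f) \<le> C * ennreal x" by blast
    qed
  qed
  then show ?thesis using C by (intro exI[of _ "C + 1"]) auto
qed

subsection \<open>Discretised interpolation norms\<close>

context
  fixes a :: "real \<Rightarrow> real" and r :: ennreal
  assumes a: "a \<in> SV" and r: "0 < r"
begin

definition "\<alpha> k = a (\<rho> k)"

lemma alpha: "dsv \<alpha>"
  unfolding \<alpha>_def[abs_def] using \<rho>_doubling dsv_SV_compose[OF a, of 2 \<rho>] pos(13) by auto

lemma sampled_alpha: "sampled (\<lambda>t. a (rho t)) \<alpha>"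
  unfolding \<alpha>_def[abs_def] by (rule sampled_SV_compose[OF a sampled_rho])

text \<open>The interpolation norm of the R-couple after the substitution s =
  \<open>\<rho> k\<close>, with K replaced by Holmstedt's expression. Unlike K it is meaningful for
  every f in the sum of A0 and A1.\<close>

definition "G \<theta> f = lq r UNIV (\<lambda>k. ennreal (wt \<alpha> \<theta> k) * H k (\<kappa> f))"

lemma G_finite:
  assumes f: "f \<in> SA" and "G \<theta> f < top"
  shows "f \<in> SR"
proof -
  have "ennreal (wt \<alpha> \<theta> 0) * H 0 (\<kappa> f) \<le> G \<theta> f"
    unfolding G_def by (rule lq_upper[OF r, of 0 UNIV "\<lambda>k. ennreal (wt \<alpha> \<theta> k) * H k (\<kappa> f)"]) simp
  then have "ennreal (wt \<alpha> \<theta> 0) * H 0 (\<kappa> f) < top" using assms(2) by (rule le_less_trans)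
  then have "H 0 (\<kappa> f) < top" using wt_pos[OF alpha, of \<theta> 0] by (auto simp: ennreal_mult_less_top)
  then show ?thesis using Holmstedt_upper f by blast
qed

text \<open>Three passages: discretisation in s at powers of 2, the change of variables to s =
  \<open>\<rho> k\<close>, and Holmstedt's formula at each k.\<close>

lemma G_equivalent:
  assumes \<theta>: "0 \<le> \<theta>" "\<theta> \<le> 1"
  shows "equiv_fam SR (K_norm R0 R1 \<theta> r a {0<..}) (G \<theta>)"
proof -
  let ?F = "\<lambda>f s. ennreal (a s) * ennreal (s powr (- \<theta>) * KR s f)"
  let ?x = "\<lambda>f k. ennreal (a (dyad k)) * ennreal (dyad k powr (- \<theta>) * KR (dyad k) f)"
  obtain M where M: "comparable M (\<lambda>t. ennreal (a t)) (\<lambda>k. ennreal (a (dyad k)))"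
    using comparable_SV[OF a] by blast
  have c: "comparable (M * 4) (?F f) (?x f)" if "f \<in> SR" for f
    using \<theta> that by (intro comparable_mult M comparable_K_fun nnR)
  have Mt: "M * 4 < top" using comparableD(6)[OF M] by (simp add: ennreal_mult_less_top)
  have 1: "equiv_fam SR (K_norm R0 R1 \<theta> r a {0<..}) (\<lambda>f. lq r UNIV (?x f))"
    unfolding K_norm_def
    using wnorm_le_lq_comparable[OF r c, of _ "{0<..}" UNIV] lq_le_wnorm_comparable[OF r c, of _ UNIV "{0<..}"] Mt
    by (intro equiv_famI[of "M * 4" "M * 4 * ennreal (2 powr recip r)"]) (auto simp: ennreal_mult_less_top)
  have 2: "equiv_fam SR (\<lambda>f. lq r UNIV (?x f)) (\<lambda>f. lq r UNIV (\<lambda>k. ?F f (\<rho> k)))"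
  proof -
    obtain C D where "growing \<rho> C ((1 - \<theta>0) / 2) D" using growing_\<rho> by blast
    from growing.change_of_variables[OF this r, of "M * 4"] obtain Q where "Q < top"
      "\<And>H x. comparable (M * 4) H x \<Longrightarrow> lq r UNIV x \<le> Q * lq r UNIV (\<lambda>k. H (\<rho> k)) \<and> lq r UNIV (\<lambda>k. H (\<rho> k)) \<le> Q * lq r UNIV x"
      by blast
    then show ?thesis using c by (intro equiv_famI[of Q Q]) blast+
  qed
  have eq: "?F f (\<rho> k) = ennreal (wt \<alpha> \<theta> k) * ennreal (KR (\<rho> k) f)" for f k
    using SV_pos[OF a pos(13), of k] unfolding wt_def[OF alpha] \<alpha>_def by (simp add: ennreal_mult' ac_simps)
  obtain C where C: "C < top" "\<And>f k. f \<in> SA \<Longrightarrow> H k (\<kappa> f) < top \<Longrightarrow> ennreal (KR (\<rho> k) f) \<le> C * H k (\<kappa> f)"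
    using Holmstedt_upper by blast
  obtain D where D: "D < top" "\<And>f k. f \<in> SR \<Longrightarrow> H k (\<kappa> f) \<le> D * ennreal (KR (\<rho> k) f)"
    using Holmstedt_lower by blast
  have 3: "equiv_fam SR (\<lambda>f. lq r UNIV (\<lambda>k. ?F f (\<rho> k))) (G \<theta>)"
  proof (rule equiv_famI[OF C(1) D(1)])
    fix f assume f: "f \<in> SR"
    \<comment> \<open>The lower estimate makes \<open>H\<close> finite, since K is real, and thereby
      opens the way to the upper one.\<close>
    have "H k (\<kappa> f) < top" for k
      by (rule le_less_trans[OF D(2)[OF f]]) (simp add: ennreal_mult_less_top D(1))
    then have le: "ennreal (KR (\<rho> k) f) \<le> C * H k (\<kappa> f)" for k
      using C(2) f SR_subset by blast
    have sw: "u * v \<le> C * (u * w)" if "v \<le> C * w" for u v w C :: ennreal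
      using mult_left_mono[OF that, of u] by (simp add: mult.left_commute)
    show "lq r UNIV (\<lambda>k. ?F f (\<rho> k)) \<le> C * G \<theta> f"
      unfolding eq G_def lq_cmult[OF r, symmetric] by (intro lq_mono r sw le order_refl)
    show "G \<theta> f \<le> D * lq r UNIV (\<lambda>k. ?F f (\<rho> k))"
      unfolding eq G_def lq_cmult[OF r, symmetric] by (intro lq_mono r sw D f order_refl)
  qed
  show ?thesis by (rule equiv_fam_trans[OF 1 equiv_fam_trans[OF 2 3]])
qed

lemma outer_equivalent:
  assumes c: "sampled c \<gamma>" and N: "N < top"
    and "\<And>f t. f \<in> SA \<Longrightarrow> 0 < t \<Longrightarrow> F f t \<le> N * z f (dlog t)"
    and "\<And>f t. f \<in> SA \<Longrightarrow> 0 < t \<Longrightarrow> z f (dlog t) \<le> N * F f t"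
  shows "equiv_fam SA (\<lambda>f. wnorm r c {0<..} (F f)) (\<lambda>f. lq r UNIV (\<lambda>k. ennreal (\<gamma> k) * z f k))"
proof -
  \<comment> \<open>The sampling estimate asks for a constant at least 1, which N need not
    be.\<close>
  have "1 \<le> 1 + N" "1 + N < top" using N by auto
  from sampled_wnorm[OF c r this] obtain Q where Q: "Q < top"
    "\<And>F z. (\<forall>t>0. F t \<le> (1 + N) * z (dlog t) \<and> z (dlog t) \<le> (1 + N) * F t) \<Longrightarrow>
     wnorm r c {0<..} F \<le> Q * lq r UNIV (\<lambda>k. ennreal (\<gamma> k) * z k) \<and>
     lq r UNIV (\<lambda>k. ennreal (\<gamma> k) * z k) \<le> Q * wnorm r c {0<..} F" by blast
  have "\<forall>t>0. F f t \<le> (1 + N) * z f (dlog t) \<and> z f (dlog t) \<le> (1 + N) * F f t" if "f \<in> SA" for f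
    using assms(3,4)[OF that] by (auto simp: distrib_right add_increasing)
  then show ?thesis using Q by (intro equiv_famI[of Q Q]) blast+
qed

definition "sharp_weight \<theta> t = chi0 t powr (1 - \<theta>) * chi1 t powr \<theta> * a (rho t)"

text \<open>This is where \<eta> and the weight of part (i) originate: \<open>wt * S0\<close>
  contains \<rho>^(-\<theta>) X0, whose slowly varying part is X0^(1-\<theta>) X1^\<theta>, and the
  powers of 2 combine through \<theta>(1-\<theta>0) + \<theta>0 = \<eta>.\<close>

lemma K_space_equivalent:
  assumes \<theta>: "0 \<le> \<theta>" "\<theta> \<le> 1"
  shows "equiv_fam SA (K_norm A0 A1 ((1 - \<theta>) * \<theta>0 + \<theta>) r (sharp_weight \<theta>) {0<..}) (\<lambda>f. lq r UNIV (main \<alpha> \<theta> (\<kappa> f)))"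
proof -
  let ?\<eta> = "(1 - \<theta>) * \<theta>0 + \<theta>"
  let ?\<gamma> = "\<lambda>k. X0 k powr (1 - \<theta>) * X1 k powr \<theta> * \<alpha> k"
  have \<eta>: "0 \<le> ?\<eta>" "?\<eta> \<le> 1"
    using \<theta> theta mult_left_mono[of \<theta>0 1 "1 - \<theta>"] by (auto simp: add_nonneg_nonneg)
  have s: "sampled (sharp_weight \<theta>) ?\<gamma>"
    unfolding sharp_weight_def[abs_def] by (intro sampled_mult sampled_powr sampled_chi0 sampled_chi1 sampled_alpha)
  have "ennreal (?\<gamma> k) * ennreal (dyad k powr (- ?\<eta>) * K (dyad k) f) = main \<alpha> \<theta> (\<kappa> f) k" for k f
  proof -
    have "wt \<alpha> \<theta> k * S0 k = ?\<gamma> k * dyad k powr (- ?\<eta>)"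
    proof -
      have "\<rho> k powr (- \<theta>) = 2 powr (- \<theta> * (1 - \<theta>0) * real_of_int k) * (X0 k powr (- \<theta>) * X1 k powr \<theta>)"
      proof -
        have "(X0 k / X1 k) powr (- \<theta>) = X0 k powr (- \<theta>) * X1 k powr \<theta>"
          using pos(7,8)[of k] by (simp add: powr_divide powr_minus field_simps)
        moreover have "(2 powr ((1 - \<theta>0) * real_of_int k)) powr (- \<theta>) = 2 powr (- \<theta> * (1 - \<theta>0) * real_of_int k)"
          unfolding powr_powr by (intro arg_cong[of _ _ "\<lambda>x. 2 powr x"]) simp
        ultimately show ?thesis using pos(7,8)[of k] unfolding \<rho>_def by (subst powr_mult) auto
      qed
      then have "wt \<alpha> \<theta> k * S0 k = (2 powr (- \<theta> * (1 - \<theta>0) * real_of_int k) * 2 powr (- \<theta>0 * real_of_int k)) *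
          (X0 k powr (- \<theta>) * X0 k) * (X1 k powr \<theta> * \<alpha> k)"
        by (simp add: wt_def[OF alpha] S0_def)
      also have "2 powr (- \<theta> * (1 - \<theta>0) * real_of_int k) * 2 powr (- \<theta>0 * real_of_int k) = dyad k powr (- ?\<eta>)"
        unfolding dyad_powr powr_add[symmetric] by (intro arg_cong[of _ _ "\<lambda>x. 2 powr x"]) (simp add: algebra_simps)
      also have "X0 k powr (- \<theta>) * X0 k = X0 k powr (1 - \<theta>)"
        using pos(7)[of k] by (simp add: powr_diff powr_minus field_simps)
      finally show ?thesis by (simp only: ac_simps)
    qed
    moreover have "main \<alpha> \<theta> (\<kappa> f) k = ennreal (wt \<alpha> \<theta> k * S0 k) * \<kappa> f k"
      unfolding main_def[OF alpha] using wt_pos[OF alpha, of \<theta> k] by (simp add: ennreal_mult_eq)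
    moreover have "0 \<le> ?\<gamma> k" using dsv_pos[OF alpha, of k] by simp
    moreover have "ennreal (dyad k powr (- ?\<eta>) * K (dyad k) f) = ennreal (dyad k powr (- ?\<eta>)) * \<kappa> f k"
      unfolding \<kappa>_def by (rule ennreal_mult') simp
    ultimately show ?thesis by (simp only: ennreal_mult_eq)
  qed
  then have "main \<alpha> \<theta> (\<kappa> f) = (\<lambda>k. ennreal (?\<gamma> k) * ennreal (dyad k powr (- ?\<eta>) * K (dyad k) f))" for f
    by (simp only:)
  then show ?thesis unfolding K_norm_def
    using comparable_K_fun[OF nn _ \<eta>] by (simp only:) (intro outer_equivalent[OF s, of 4], auto simp: comparable_def)
qed

lemma wt_0: "wt \<alpha> 0 = \<alpha>"
  using pos(13) by (simp add: wt_def[OF alpha] fun_eq_iff less_imp_neq[symmetric])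

lemma RL_equivalent:
  "equiv_fam SA (\<lambda>f. wnorm r (a \<circ> rho) {0<..} (\<lambda>t. wnorm r0 b0 {0<..<t} (\<lambda>u. K_norm A0 A1 \<theta>0 q0 a0 {u<..<t} f)))
     (\<lambda>f. lq r UNIV (\<lambda>k. ennreal (\<alpha> k) * N0 {..k} (\<kappa> f)))"
proof -
  note M = M(6,6,1,4)
  note * = iterated_lower[OF exponents(2,1) M(3) M(4)]
  show ?thesis unfolding comp_def K_norm_def N0_def
    by (rule outer_equivalent[OF sampled_alpha, of "M * M + M * M * M * M * nested_const r0 q0 M"])
       (use * M(2) in \<open>auto simp: ennreal_mult_less_top nested_const_def distrib_right add_increasing add_increasing2\<close>)
qed

lemma RR_equivalent:
  "equiv_fam SA (\<lambda>f. wnorm r (a \<circ> rho) {0<..} (\<lambda>t. wnorm r1 b1 {t<..} (\<lambda>u. K_norm A0 A1 1 q1 a1 {u<..} f)))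
     (\<lambda>f. lq r UNIV (\<lambda>k. ennreal (\<alpha> k) * N1 {k..} (\<kappa> f)))"
proof -
  note M = M(6,6,2,5)
  note * = iterated_upper[OF exponents(4,3) M(3) M(4)]
  show ?thesis unfolding comp_def K_norm_def N1_def
    by (rule outer_equivalent[OF sampled_alpha, of "M * M + M * M * nested_const r1 q1 M"])
       (use * M(2) in \<open>auto simp: ennreal_mult_less_top nested_const_def distrib_right add_increasing add_increasing2\<close>)
qed

definition "Bw t = enn2real (wnorm r1 b1 {0<..<t} (\<lambda>_. 1)) * a (rho t)"

text \<open>The factor \<open>B1 k\<close> inside \<open>I2\<close> joins \<open>\<alpha> k\<close>
  to form the sample of \<open>Bw\<close>.\<close>

lemma R_equivalent:
  "equiv_fam SA (\<lambda>f. wnorm r Bw {0<..} (\<lambda>t. K_norm A0 A1 1 q1 a1 {t<..} f))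
     (\<lambda>f. lq r UNIV (\<lambda>k. ennreal (\<alpha> k) * I2 k (\<kappa> f)))"
proof -
  note M = M(6,6,5)
  note * = single_upper[OF exponents(3) M(3)]
  have s: "sampled Bw (\<lambda>k. B1 k * \<alpha> k)"
    unfolding Bw_def[abs_def] by (intro sampled_mult sampled_B sampled_alpha)
  have eq: "ennreal (\<alpha> k) * I2 k (\<kappa> f) = ennreal (B1 k * \<alpha> k) * lq q1 {k..} (\<lambda>i. ennreal (w1 i) * \<kappa> f i)" for k f
    unfolding I2_def using dsv_pos[OF alpha, of k] by (simp add: ennreal_mult_eq mult.commute)
  show ?thesis unfolding K_norm_def eq
    by (rule outer_equivalent[OF s, of "M + M * M * ennreal (2 powr recip q1)"])
       (use * M(2) in \<open>auto simp: ennreal_mult_less_top distrib_right add_increasing add_increasing2\<close>)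
qed

text \<open>For \<theta> strictly inside (0,1) both terms of \<open>H\<close> reduce to
  \<open>main\<close>, which in turn is below the first term.\<close>

lemma G_eq: 
  assumes "0 < \<theta>" "\<theta> < 1"
  shows "equiv_fam SA (G \<theta>) (\<lambda>f. lq r UNIV (main \<alpha> \<theta> (\<kappa> f)))"
proof -
  obtain C where C: "C < top" "\<And>\<kappa>. lq r UNIV (\<lambda>k. ennreal (wt \<alpha> \<theta> k) * N0 {..k} \<kappa>) \<le> C * lq r UNIV (main \<alpha> \<theta> \<kappa>)"
    using lq_N0_le_main[OF alpha assms(1) r] by blast
  obtain D where D: "D < top" "\<And>\<kappa>. lq r UNIV (\<lambda>k. ennreal (wt \<alpha> \<theta> k) * (ennreal (\<rho> k) * (I2 k \<kappa> + N1 {k..} \<kappa>))) \<le> D * lq r UNIV (main \<alpha> \<theta> \<kappa>)"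
    using lq_N1_le_main[OF alpha assms(2) r] by blast
  show ?thesis
  proof (rule equiv_famI[of "quasi_const r * (C + D)" 1])
    show "quasi_const r * (C + D) < top" using C D quasi_const_less_top by (simp add: ennreal_mult_less_top)
    fix f
    have "G \<theta> f \<le> quasi_const r * (C * lq r UNIV (main \<alpha> \<theta> (\<kappa> f)) + D * lq r UNIV (main \<alpha> \<theta> (\<kappa> f)))"
      unfolding G_def by (rule order_trans[OF lq_H_le[OF alpha r]]) (intro mult_left_mono add_mono C D; simp)
    then show "G \<theta> f \<le> quasi_const r * (C + D) * lq r UNIV (main \<alpha> \<theta> (\<kappa> f))"
      by (simp add: distrib_right mult.assoc)
    have "lq r UNIV (main \<alpha> \<theta> (\<kappa> f)) \<le> G \<theta> f"
      unfolding G_def by (rule order_trans[OF lq_main_le[OF alpha r] lq_H_ge(1)[OF alpha r]])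
    then show "lq r UNIV (main \<alpha> \<theta> (\<kappa> f)) \<le> 1 * G \<theta> f" by simp
  qed simp
qed

text \<open>At \<theta> = 0 only the second term of \<open>H\<close> reduces to \<open>main\<close>;
  since \<open>main\<close> is below the first term, the first term alone is left.\<close>

lemma G_eq_0: "equiv_fam SA (G 0) (\<lambda>f. lq r UNIV (\<lambda>k. ennreal (\<alpha> k) * N0 {..k} (\<kappa> f)))"
proof -
  obtain D where D: "D < top" "\<And>\<kappa>. lq r UNIV (\<lambda>k. ennreal (wt \<alpha> 0 k) * (ennreal (\<rho> k) * (I2 k \<kappa> + N1 {k..} \<kappa>))) \<le> D * lq r UNIV (main \<alpha> 0 \<kappa>)"
    using lq_N1_le_main[OF alpha _ r, of 0] by auto
  let ?L = "\<lambda>f. lq r UNIV (\<lambda>k. ennreal (wt \<alpha> 0 k) * N0 {..k} (\<kappa> f))"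
  have "equiv_fam SA (G 0) ?L"
  proof (rule equiv_famI[of "quasi_const r * (1 + D)" 1])
    show "quasi_const r * (1 + D) < top" using D quasi_const_less_top by (simp add: ennreal_mult_less_top)
    fix f
    have "G 0 f \<le> quasi_const r * (?L f + D * ?L f)"
      unfolding G_def
      by (rule order_trans[OF lq_H_le[OF alpha r]])
         (intro mult_left_mono add_mono order_trans[OF D(2)] lq_main_le[OF alpha r]; simp)
    then show "G 0 f \<le> quasi_const r * (1 + D) * ?L f"
      by (simp add: distrib_right mult.assoc)
    have "?L f \<le> G 0 f"
      unfolding G_def by (rule lq_H_ge(1)[OF alpha r])
    then show "?L f \<le> 1 * G 0 f" by simp
  qed simp
  then show ?thesis unfolding wt_0 .
qed

text \<open>At \<theta> = 1 only the first term of \<open>H\<close> reduces to \<open>main\<close>.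
  In the second, \<open>wt * \<rho>\<close> is just \<open>\<alpha>\<close>, and its two summands
  survive; the three resulting norms are those of the three intersected spaces.\<close>

lemma G_eq_1: 
  "equiv_fam SA (G 1) (\<lambda>f. lq r UNIV (main \<alpha> 1 (\<kappa> f)) +
     lq r UNIV (\<lambda>k. ennreal (\<alpha> k) * I2 k (\<kappa> f)) + lq r UNIV (\<lambda>k. ennreal (\<alpha> k) * N1 {k..} (\<kappa> f)))"
proof -
  obtain C where C: "C < top" "\<And>\<kappa>. lq r UNIV (\<lambda>k. ennreal (wt \<alpha> 1 k) * N0 {..k} \<kappa>) \<le> C * lq r UNIV (main \<alpha> 1 \<kappa>)"
    using lq_N0_le_main[OF alpha _ r, of 1] by auto
  have w: "ennreal (wt \<alpha> 1 k) * (ennreal (\<rho> k) * u) = ennreal (\<alpha> k) * u" for k u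
  proof -
    have "wt \<alpha> 1 k * \<rho> k = \<alpha> k" using pos(13)[of k] by (simp add: wt_def[OF alpha] powr_minus field_simps)
    then show ?thesis using wt_pos[OF alpha, of 1 k] by (simp add: ennreal_mult_eq)
  qed
  let ?m = "\<lambda>f. lq r UNIV (main \<alpha> 1 (\<kappa> f))"
  let ?i = "\<lambda>f. lq r UNIV (\<lambda>k. ennreal (\<alpha> k) * I2 k (\<kappa> f))"
  let ?n = "\<lambda>f. lq r UNIV (\<lambda>k. ennreal (\<alpha> k) * N1 {k..} (\<kappa> f))"
  let ?c = "quasi_const r"
  show ?thesis
  proof (rule equiv_famI[of "?c * (C + ?c)" "3"])
    show "?c * (C + ?c) < top" using C quasi_const_less_top by (simp add: ennreal_mult_less_top)
    fix f
    have "lq r UNIV (\<lambda>k. ennreal (\<alpha> k) * (I2 k (\<kappa> f) + N1 {k..} (\<kappa> f))) \<le> ?c * (?i f + ?n f)"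
      unfolding distrib_left[of "ennreal (\<alpha> _)"] by (rule lq_add_le[OF r])
    then have "G 1 f \<le> ?c * (C * ?m f + ?c * (?i f + ?n f))"
      unfolding G_def by (intro order_trans[OF lq_H_le[OF alpha r]] mult_left_mono add_mono C) (simp_all add: w)
    also have "\<dots> \<le> ?c * ((C + ?c) * (?m f + ?i f + ?n f))"
    proof (rule mult_left_mono)
      have "C * ?m f \<le> (C + ?c) * ?m f" by (intro mult_right_mono) auto
      moreover have "?c * (?i f + ?n f) \<le> (C + ?c) * (?i f + ?n f)" by (intro mult_right_mono) auto
      ultimately show "C * ?m f + ?c * (?i f + ?n f) \<le> (C + ?c) * (?m f + ?i f + ?n f)"
        unfolding add.assoc distrib_left[of "C + ?c" "?m f"] by (rule add_mono)
    qed simp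
    finally show "G 1 f \<le> ?c * (C + ?c) * (?m f + ?i f + ?n f)" by (simp only: mult.assoc)
    have "?m f \<le> G 1 f"
      unfolding G_def by (rule order_trans[OF lq_main_le[OF alpha r] lq_H_ge(1)[OF alpha r]])
    moreover have le: "lq r UNIV (\<lambda>k. ennreal (\<alpha> k) * (I2 k (\<kappa> f) + N1 {k..} (\<kappa> f))) \<le> G 1 f"
      using lq_H_ge(2)[OF alpha r, of 1 "\<kappa> f"] by (simp only: G_def w)
    have "?i f \<le> G 1 f" by (rule order_trans[OF _ le]) (intro lq_mono r mult_left_mono; simp)
    moreover have "?n f \<le> G 1 f" by (rule order_trans[OF _ le]) (intro lq_mono r mult_left_mono; simp)
    ultimately have "?m f + ?i f + ?n f \<le> G 1 f + G 1 f + G 1 f" by (intro add_mono)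
    also have "\<dots> = (1 + 1 + 1) * G 1 f" by (simp only: distrib_right mult_1)
    also have "(1 + 1 + 1 :: ennreal) = 3" by simp
    finally show "?m f + ?i f + ?n f \<le> 3 * G 1 f" .
  qed simp
qed

lemma interior:
  assumes "0 < \<theta>" "\<theta> < 1"
  shows "K_space R0 R1 \<theta> r a \<doteq> K_space A0 A1 ((1 - \<theta>) * \<theta>0 + \<theta>) r (sharp_weight \<theta>)"
  unfolding K_space_def
  by (rule space_eq_of_equivalent[OF SR_subset G_equivalent
        equiv_fam_trans[OF G_eq equiv_fam_sym[OF K_space_equivalent]] G_finite])
     (use assms in auto)

lemma left_end:
  "K_space R0 R1 0 r a \<doteq> RL_space A0 A1 \<theta>0 r (a \<circ> rho) r0 b0 q0 a0"
  unfolding K_space_def RL_space_def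
  by (rule space_eq_of_equivalent[OF SR_subset G_equivalent
        equiv_fam_trans[OF G_eq_0 equiv_fam_sym[OF RL_equivalent]] G_finite]) auto

lemma right_end:
  "K_space R0 R1 1 r a \<doteq> K_space A0 A1 1 r (sharp_weight 1) \<sqinter>\<^sub>q R_space A0 A1 1 r Bw q1 a1
     \<sqinter>\<^sub>q RR_space A0 A1 1 r (a \<circ> rho) r1 b1 q1 a1"
proof -
  have K: "equiv_fam SA (K_norm A0 A1 1 r (sharp_weight 1) {0<..}) (\<lambda>f. lq r UNIV (main \<alpha> 1 (\<kappa> f)))"
    using K_space_equivalent[of 1] by simp
  show ?thesis
    unfolding K_space_def R_space_def[of _ _ _ r] RR_space_def
    by (rule space_eq_trans[OF space_eq_of_equivalent[OF SR_subset G_equivalent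
          equiv_fam_trans[OF G_eq_1 equiv_fam_sym[OF
            equiv_fam_add[OF equiv_fam_add[OF K R_equivalent] RR_equivalent]]] G_finite]
          space_eq_inter_sum]) auto
qed

end

end

theorem theorem50:
  fixes A\<^sub>0 A\<^sub>1 :: "'a::real_vector qspace"
    and q\<^sub>0 q\<^sub>1 r\<^sub>0 r\<^sub>1 r :: ennreal
    and a a\<^sub>0 a\<^sub>1 b\<^sub>0 b\<^sub>1 :: "real \<Rightarrow> real"
    and \<theta>\<^sub>0 :: real
    and \<chi>\<^sub>0 \<chi>\<^sub>1 \<rho> B\<^sub>1 :: "real \<Rightarrow> real"
    and asharp :: "real \<Rightarrow> real \<Rightarrow> real"
    and \<eta> :: "real \<Rightarrow> real"
  assumes "quasi_banach A\<^sub>0" and "quasi_banach A\<^sub>1" and "compatible_couple A\<^sub>0 A\<^sub>1"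
    and "qcarrier A\<^sub>0 \<inter> qcarrier A\<^sub>1 \<noteq> {0}"
    and "0 < q\<^sub>1" and "0 < r\<^sub>1" and "a\<^sub>1 \<in> SV" and "b\<^sub>1 \<in> SV"
    and "wnorm r\<^sub>1 b\<^sub>1 {0<..<1} (\<lambda>s. wnorm q\<^sub>1 a\<^sub>1 {s<..<1} (\<lambda>_. 1)) < \<infinity>"
    and chi1: "\<chi>\<^sub>1 = (\<lambda>t. enn2real (wnorm r\<^sub>1 b\<^sub>1 {0<..<t} (\<lambda>s. wnorm q\<^sub>1 a\<^sub>1 {s<..<t} (\<lambda>_. 1))))"
    and "0 < \<theta>\<^sub>0" and "\<theta>\<^sub>0 < 1"
    and "0 < r" and "0 < r\<^sub>0" and "0 < q\<^sub>0"
    and "a \<in> SV" and "a\<^sub>0 \<in> SV" and "b\<^sub>0 \<in> SV"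
    and "wnorm r\<^sub>0 b\<^sub>0 {0<..<1} (\<lambda>_. 1) < \<infinity>"
    and chi0: "\<chi>\<^sub>0 = (\<lambda>t. a\<^sub>0 t * enn2real (wnorm r\<^sub>0 b\<^sub>0 {0<..<t} (\<lambda>_. 1)))"
    and rho: "\<rho> = (\<lambda>t. t powr (1 - \<theta>\<^sub>0) * (\<chi>\<^sub>0 t / \<chi>\<^sub>1 t))"
    and asharp: "asharp = (\<lambda>\<theta> t. \<chi>\<^sub>0 t powr (1 - \<theta>) * \<chi>\<^sub>1 t powr \<theta> * a (\<rho> t))"
    and eta: "\<eta> = (\<lambda>\<theta>. (1 - \<theta>) * \<theta>\<^sub>0 + \<theta>)"
    and B1: "B\<^sub>1 = (\<lambda>t. enn2real (wnorm r\<^sub>1 b\<^sub>1 {0<..<t} (\<lambda>_. 1)) * a (\<rho> t))"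
  shows
    "(\<forall>\<theta>. 0 < \<theta> \<and> \<theta> < 1 \<longrightarrow>
        K_space (R_space A\<^sub>0 A\<^sub>1 \<theta>\<^sub>0 r\<^sub>0 b\<^sub>0 q\<^sub>0 a\<^sub>0) (R_space A\<^sub>0 A\<^sub>1 1 r\<^sub>1 b\<^sub>1 q\<^sub>1 a\<^sub>1) \<theta> r a
          \<doteq> K_space A\<^sub>0 A\<^sub>1 (\<eta> \<theta>) r (asharp \<theta>))
   \<and> (wnorm r a {1<..} (\<lambda>_. 1) < \<infinity> \<longrightarrow>
        K_space (R_space A\<^sub>0 A\<^sub>1 \<theta>\<^sub>0 r\<^sub>0 b\<^sub>0 q\<^sub>0 a\<^sub>0) (R_space A\<^sub>0 A\<^sub>1 1 r\<^sub>1 b\<^sub>1 q\<^sub>1 a\<^sub>1) 0 r a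
          \<doteq> RL_space A\<^sub>0 A\<^sub>1 \<theta>\<^sub>0 r (a \<circ> \<rho>) r\<^sub>0 b\<^sub>0 q\<^sub>0 a\<^sub>0)
   \<and> (wnorm r a {0<..<1} (\<lambda>_. 1) < \<infinity> \<longrightarrow>
        K_space (R_space A\<^sub>0 A\<^sub>1 \<theta>\<^sub>0 r\<^sub>0 b\<^sub>0 q\<^sub>0 a\<^sub>0) (R_space A\<^sub>0 A\<^sub>1 1 r\<^sub>1 b\<^sub>1 q\<^sub>1 a\<^sub>1) 1 r a
          \<doteq> K_space A\<^sub>0 A\<^sub>1 1 r (asharp 1)
              \<sqinter>\<^sub>q R_space A\<^sub>0 A\<^sub>1 1 r B\<^sub>1 q\<^sub>1 a\<^sub>1
              \<sqinter>\<^sub>q RR_space A\<^sub>0 A\<^sub>1 1 r (a \<circ> \<rho>) r\<^sub>1 b\<^sub>1 q\<^sub>1 a\<^sub>1)"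
proof -
  interpret reiteration A\<^sub>0 A\<^sub>1 q\<^sub>0 q\<^sub>1 r\<^sub>0 r\<^sub>1 a\<^sub>0 a\<^sub>1 b\<^sub>0 b\<^sub>1 \<theta>\<^sub>0
    by unfold_locales (use assms in \<open>auto simp: quasi_banach_def\<close>)
  have chi: "\<chi>\<^sub>0 = chi0" "\<chi>\<^sub>1 = chi1"
    by (simp_all add: chi0 chi1 chi0_def chi1_def fun_eq_iff)
  then have \<rho>: "\<rho> = rho" by (simp add: rho rho_def fun_eq_iff)
  note a = \<open>a \<in> SV\<close> \<open>0 < r\<close>
  have sharp: "asharp = sharp_weight a"
    and B: "B\<^sub>1 = Bw a"
    by (simp_all add: asharp B1 chi \<rho> sharp_weight_def[OF a] Bw_def[OF a] fun_eq_iff)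
  show ?thesis
    using interior[OF a] left_end[OF a] right_end[OF a] by (simp add: eta \<rho> sharp B)
qed

end
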